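(* Let $\Omega\subset\mathbb{R}^3$ be a bounded domain with Lipschitz boundary and let $K(\bm{x})=\operatorname{diag}(\kappa_1(\bm{x}),\kappa_2(\bm{x}),\kappa_3(\bm{x}))$ be a real diagonal coefficient matrix that is continuous in the closure $\overline{\Omega}$. Then the spectrum of the operator $\mathcal{L}^{-1}\mathcal{A}: H_0^1(\Omega)\to H_0^1(\Omega)$ equals $$\mathrm{sp}(\mathcal{L}^{-1}\mathcal{A})=\mathrm{Conv}\Big(\bigcup_{i=1}^3\kappa_i(\overline{\Omega})\Big).$$
   Context: A domain is a nonempty connected open set. The operators $\mathcal{L},\mathcal{A}:H_0^1(\Omega)\to H^{-1}(\Omega)$ are defined by $$\langle \mathcal{L}u,v\rangle=\int_\Omega \nabla v\cdot\nabla u,\qquad \langle \mathcal{A}u,v\rangle=\int_\Omega \nabla v\cdot K\nabla u,\qquad u,v\in H_0^1(\Omega),$$ and $H_0^1(\Omega)$ carries the norm $\Vert u\Vert_{\mathcal{L}}^2=\langle\mathcal{L}u,u\rangle$. The spectrum is $$\mathrm{sp}(\mathcal{L}^{-1}\mathcal{A})=\{\lambda\in\mathbb{C}:\ \lambda\mathcal{I}-\mathcal{L}^{-1}\mathcal{A}\ \text{does not have a bounded inverse}\},$$ where $\mathcal{I}$ is the identity; for non-real $\lambda$ the operator is understood on the complexification of $H_0^1(\Omega)$. $\kappa_i(\overline{\Omega})$ denotes the image of $\overline{\Omega}$ under $\kappa_i$, and $\mathrm{Conv}$ denotes the convex hull (in $\mathbb{R}\subset\mathbb{C}$). *)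

theory Defs
  imports "HOL-Analysis.Analysis"
begin

section \<open>Domains with Lipschitz boundary\<close>

definition is_domain :: "'a::topological_space set \<Rightarrow> bool" where
  "is_domain \<Omega> \<longleftrightarrow> \<Omega> \<noteq> {} \<and> open \<Omega> \<and> connected \<Omega>"

text \<open>Near every boundary point \<open>p\<close>, the set is the strict epigraph of a Lipschitz function after a
  change of orthonormal coordinates. Here the unit vector \<open>\<nu>\<close> is the vertical axis, and the
  hyperplane orthogonal to \<open>\<nu>\<close> plays the role of the horizontal coordinate space.\<close>

definition lipschitz_boundary :: "'a::euclidean_space set \<Rightarrow> bool" where
  "lipschitz_boundary \<Omega> \<longleftrightarrow>
     (\<forall>p\<in>frontier \<Omega>. \<exists>r>0. \<exists>\<nu> C. \<exists>\<gamma>::'a \<Rightarrow> real.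
        norm \<nu> = 1 \<and> C-lipschitz_on {y. y \<bullet> \<nu> = 0} \<gamma> \<and>
        \<Omega> \<inter> ball p r = {x \<in> ball p r. \<gamma> (x - (x \<bullet> \<nu>) *\<^sub>R \<nu>) < x \<bullet> \<nu>})"


section \<open>Test functions and Sobolev spaces\<close>

definition partial_deriv :: "'n::finite \<Rightarrow> (real^'n \<Rightarrow> real) \<Rightarrow> real^'n \<Rightarrow> real" where
  "partial_deriv i f x = frechet_derivative f (at x) (axis i 1)"

primrec C_k :: "nat \<Rightarrow> (real^'n::finite \<Rightarrow> real) \<Rightarrow> bool" where
  "C_k 0 f \<longleftrightarrow> continuous_on UNIV f"
| "C_k (Suc k) f \<longleftrightarrow> f differentiable_on UNIV \<and> (\<forall>i. C_k k (partial_deriv i f))"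

definition test_functions :: "(real^'n::finite) set \<Rightarrow> (real^'n \<Rightarrow> real) set" where
  "test_functions \<Omega> =
     {\<phi>. (\<forall>k. C_k k \<phi>) \<and> compact (closure {x. \<phi> x \<noteq> 0}) \<and> closure {x. \<phi> x \<noteq> 0} \<subseteq> \<Omega>}"

text \<open>Elements of Lebesgue and Sobolev spaces are represented by functions on the whole space. Only
  their values on \<open>\<Omega>\<close> matter, and two functions represent the same element iff they agree almost
  everywhere on \<open>\<Omega>\<close>.\<close>

definition L2 :: "(real^'n::finite) set \<Rightarrow> (real^'n \<Rightarrow> 'b::euclidean_space) set" where
  "L2 \<Omega> = {u \<in> borel_measurable (lebesgue_on \<Omega>). integrable (lebesgue_on \<Omega>) (\<lambda>x. (norm (u x))\<^sup>2)}"

definition ae_eq :: "(real^'n::finite) set \<Rightarrow> (real^'n \<Rightarrow> 'b) \<Rightarrow> (real^'n \<Rightarrow> 'b) \<Rightarrow> bool" where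
  "ae_eq \<Omega> u v \<longleftrightarrow> (AE x in lebesgue_on \<Omega>. u x = v x)"

definition weak_gradient ::
    "(real^'n::finite) set \<Rightarrow> (real^'n \<Rightarrow> real) \<Rightarrow> (real^'n \<Rightarrow> real^'n) \<Rightarrow> bool" where
  "weak_gradient \<Omega> u g \<longleftrightarrow>
     (\<forall>\<phi>\<in>test_functions \<Omega>. \<forall>i.
        (LINT x|lebesgue_on \<Omega>. u x * partial_deriv i \<phi> x) = - (LINT x|lebesgue_on \<Omega>. g x $ i * \<phi> x))"

definition H1 :: "(real^'n::finite) set \<Rightarrow> (real^'n \<Rightarrow> real) set" where
  "H1 \<Omega> = {u \<in> L2 \<Omega>. \<exists>g\<in>L2 \<Omega>. weak_gradient \<Omega> u g}"

text \<open>The weak gradient of an \<open>H1\<close> function, which is unique up to null subsets of \<open>\<Omega>\<close>.\<close>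

definition grad :: "(real^'n::finite) set \<Rightarrow> (real^'n \<Rightarrow> real) \<Rightarrow> real^'n \<Rightarrow> real^'n" where
  "grad \<Omega> u = (SOME g. g \<in> L2 \<Omega> \<and> weak_gradient \<Omega> u g)"

definition H1_norm :: "(real^'n::finite) set \<Rightarrow> (real^'n \<Rightarrow> real) \<Rightarrow> real" where
  "H1_norm \<Omega> u =
     sqrt ((LINT x|lebesgue_on \<Omega>. (u x)\<^sup>2) + (LINT x|lebesgue_on \<Omega>. (norm (grad \<Omega> u x))\<^sup>2))"

definition H01 :: "(real^'n::finite) set \<Rightarrow> (real^'n \<Rightarrow> real) set" where
  "H01 \<Omega> = {u \<in> H1 \<Omega>. \<forall>\<epsilon>>0. \<exists>\<phi>\<in>test_functions \<Omega>. H1_norm \<Omega> (\<lambda>x. u x - \<phi> x) < \<epsilon>}"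


section \<open>The operators\<close>

text \<open>The values of both operators are functionals on \<open>H01 \<Omega>\<close>. They are made \<open>undefined\<close> off
  \<open>H01 \<Omega>\<close>, so that equality of functionals means equality on \<open>H01 \<Omega>\<close>.\<close>

definition op_L :: "(real^'n::finite) set \<Rightarrow> (real^'n \<Rightarrow> real) \<Rightarrow> (real^'n \<Rightarrow> real) \<Rightarrow> real" where
  "op_L \<Omega> u = (\<lambda>v\<in>H01 \<Omega>. LINT x|lebesgue_on \<Omega>. grad \<Omega> v x \<bullet> grad \<Omega> u x)"

definition op_A ::
    "(real^'n::finite) set \<Rightarrow> (real^'n \<Rightarrow> real^'n^'n) \<Rightarrow> (real^'n \<Rightarrow> real) \<Rightarrow> (real^'n \<Rightarrow> real) \<Rightarrow> real" where
  "op_A \<Omega> K u = (\<lambda>v\<in>H01 \<Omega>. LINT x|lebesgue_on \<Omega>. grad \<Omega> v x \<bullet> (K x *v grad \<Omega> u x))"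

definition norm_L :: "(real^'n::finite) set \<Rightarrow> (real^'n \<Rightarrow> real) \<Rightarrow> real" where
  "norm_L \<Omega> u = sqrt (op_L \<Omega> u u)"

text \<open>On \<open>H01 \<Omega>\<close>, the operator \<open>op_L \<Omega>\<close> is injective up to a.e. equality; \<open>inv_into\<close> picks one
  representative of the unique preimage.\<close>

definition op_LinvA ::
    "(real^'n::finite) set \<Rightarrow> (real^'n \<Rightarrow> real^'n^'n) \<Rightarrow> (real^'n \<Rightarrow> real) \<Rightarrow> real^'n \<Rightarrow> real" where
  "op_LinvA \<Omega> K u = inv_into (H01 \<Omega>) (op_L \<Omega>) (op_A \<Omega> K u)"


section \<open>Complexification and spectrum\<close>

text \<open>An element \<open>u + \<i> v\<close> of the complexification is represented by a complex-valued function with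
  real part \<open>u\<close> and imaginary part \<open>v\<close>.\<close>

definition H01_complex :: "(real^'n::finite) set \<Rightarrow> (real^'n \<Rightarrow> complex) set" where
  "H01_complex \<Omega> = {f. (\<lambda>x. Re (f x)) \<in> H01 \<Omega> \<and> (\<lambda>x. Im (f x)) \<in> H01 \<Omega>}"

definition norm_L_complex :: "(real^'n::finite) set \<Rightarrow> (real^'n \<Rightarrow> complex) \<Rightarrow> real" where
  "norm_L_complex \<Omega> f =
     sqrt ((norm_L \<Omega> (\<lambda>x. Re (f x)))\<^sup>2 + (norm_L \<Omega> (\<lambda>x. Im (f x)))\<^sup>2)"

definition complexify ::
    "(('a \<Rightarrow> real) \<Rightarrow> 'a \<Rightarrow> real) \<Rightarrow> ('a \<Rightarrow> complex) \<Rightarrow> 'a \<Rightarrow> complex" where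
  "complexify T f = (\<lambda>x. Complex (T (\<lambda>y. Re (f y)) x) (T (\<lambda>y. Im (f y)) x))"

definition bounded_operator ::
    "(real^'n::finite) set \<Rightarrow> ((real^'n \<Rightarrow> complex) \<Rightarrow> real^'n \<Rightarrow> complex) \<Rightarrow> bool" where
  "bounded_operator \<Omega> R \<longleftrightarrow>
     (\<forall>f\<in>H01_complex \<Omega>. R f \<in> H01_complex \<Omega>) \<and>
     (\<forall>f\<in>H01_complex \<Omega>. \<forall>g\<in>H01_complex \<Omega>. ae_eq \<Omega> (R (\<lambda>x. f x + g x)) (\<lambda>x. R f x + R g x)) \<and>
     (\<forall>c. \<forall>f\<in>H01_complex \<Omega>. ae_eq \<Omega> (R (\<lambda>x. c * f x)) (\<lambda>x. c * R f x)) \<and>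
     (\<exists>C. \<forall>f\<in>H01_complex \<Omega>. norm_L_complex \<Omega> (R f) \<le> C * norm_L_complex \<Omega> f)"

definition has_bounded_inverse ::
    "(real^'n::finite) set \<Rightarrow> ((real^'n \<Rightarrow> complex) \<Rightarrow> real^'n \<Rightarrow> complex) \<Rightarrow> bool" where
  "has_bounded_inverse \<Omega> S \<longleftrightarrow>
     (\<exists>R. bounded_operator \<Omega> R \<and>
        (\<forall>f\<in>H01_complex \<Omega>. ae_eq \<Omega> (R (S f)) f \<and> ae_eq \<Omega> (S (R f)) f))"

definition sp :: "(real^'n::finite) set \<Rightarrow> ((real^'n \<Rightarrow> real) \<Rightarrow> real^'n \<Rightarrow> real) \<Rightarrow> complex set" where
  "sp \<Omega> T = {z. \<not> has_bounded_inverse \<Omega> (\<lambda>f x. z * f x - complexify T f x)}"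

end

theory Submission
  imports Defs
begin

text \<open>Write \<open>(u, v)\<close> for the energy product \<open>\<integral> \<nabla>u \<bullet> \<nabla>v\<close> and \<open>T\<close> for the operator, so that
  \<open>(T u, v) = \<integral> \<nabla>v \<bullet> K \<nabla>u\<close>. Let \<open>m\<close> and \<open>M\<close> be the least and the greatest value of the \<open>\<kappa>\<^sub>i\<close> on the
  closure of \<open>\<Omega>\<close>. The convex hull is the interval \<open>[m, M]\<close>.

  \<^bold>\<open>Outside the interval.\<close> \<open>T\<close> is self-adjoint and \<open>m (u, u) \<le> (T u, u) \<le> M (u, u)\<close>. For
  \<open>z = a + \<i> b\<close> outside \<open>[m, M]\<close> the form \<open>((a - T) u, (a - T) v) + b\<^sup>2 (u, v)\<close> is therefore coercive
  (\<open>shifted_coercive\<close>). It is the form of \<open>(z - T) (cnj z - T)\<close>, an operator that preserves real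
  functions, so the representation theorem for the real space (\<open>riesz_representation\<close>) makes
  \<open>z - T\<close> surjective on the complexification. The same coercivity bounds \<open>z - T\<close> from below.
  Both together give the bounded inverse (\<open>in_resolvent_set\<close>). The representation theorem needs
  completeness of the space under the energy norm, which rests on the completeness of \<open>L\<^sup>2\<close>, on
  the uniqueness of weak gradients and on the Poincare inequality (\<open>semi_hilbert_H01\<close>).

  \<^bold>\<open>Inside the interval.\<close> The closure of \<open>\<Omega>\<close> is connected, so for every \<open>a\<close> in \<open>[m, M]\<close> there is a
  single point \<open>x\<^sub>0\<close> of the closure where some \<open>\<kappa>\<^sub>i\<close> is at most \<open>a\<close> and some \<open>\<kappa>\<^sub>j\<close> is at least \<open>a\<close>.
  Hence a unit vector \<open>\<xi>\<close> satisfies \<open>\<xi> \<bullet> (a - K x\<^sub>0) \<xi> = 0\<close>. Take a bump function \<open>\<phi>\<close> supported in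
  \<open>\<Omega>\<close> so close to \<open>x\<^sub>0\<close> that \<open>K\<close> differs from \<open>K x\<^sub>0\<close> by at most \<open>\<epsilon>\<close> there. The oscillating functions
  \<open>\<phi> exp (\<i> n \<xi> \<bullet> x)\<close> have energy norm at least of order \<open>n\<close> (\<open>wave_energy\<close>). By the choice of \<open>\<xi>\<close>,
  the operator \<open>a - T\<close> with coefficients frozen at \<open>x\<^sub>0\<close> maps them to functions whose norm stays
  bounded in \<open>n\<close>, and the variation of \<open>K\<close> contributes at most \<open>\<epsilon>\<close> times their norm
  (\<open>wave_quasimode\<close>). A bounded inverse of \<open>a - T\<close> is impossible (\<open>in_spectrum\<close>).

  Functions that agree almost everywhere are never identified: all spaces consist of
  functions, their inner products are only semidefinite, and equality almost everywhere is
  recovered at the end as equality of the products with all elements (\<open>ae_eq_iff\<close>).\<close>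

section \<open>Smooth functions and bump functions\<close>

lemma partial_deriv_eq:
  "(f has_derivative f') (at x) \<Longrightarrow> partial_deriv i f x = f' (axis i 1)"
  unfolding partial_deriv_def by (metis frechet_derivative_at)

lemma has_derivative_frechet:
  "f differentiable (at x) \<Longrightarrow> (f has_derivative frechet_derivative f (at x)) (at x)"
  by (simp add: frechet_derivative_works)

lemma partial_deriv_const [simp]: "partial_deriv i (\<lambda>x. c) = (\<lambda>x. 0)"
  by (rule ext, subst partial_deriv_eq[where f'="\<lambda>_. 0"]) auto

lemma partial_deriv_coord:
  "partial_deriv i (\<lambda>x. x $ j) = (\<lambda>x. if i = j then 1 else 0)"
  by (rule ext, subst partial_deriv_eq[where f'="\<lambda>h. h $ j"])
    (auto simp: axis_def intro!: bounded_linear_imp_has_derivative bounded_linear_vec_nth)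

lemma partial_deriv_add:
  assumes "f differentiable (at x)" "g differentiable (at x)"
  shows "partial_deriv i (\<lambda>x. f x + g x) x = partial_deriv i f x + partial_deriv i g x"
  by (subst partial_deriv_eq[OF has_derivative_add[OF assms[THEN has_derivative_frechet]]])
    (simp add: partial_deriv_def)

lemma partial_deriv_mult:
  assumes "f differentiable (at x)" "g differentiable (at x)"
  shows "partial_deriv i (\<lambda>x. f x * g x) x = f x * partial_deriv i g x + partial_deriv i f x * g x"
  by (subst partial_deriv_eq[OF has_derivative_mult[OF assms[THEN has_derivative_frechet]]])
    (simp add: partial_deriv_def)

lemma has_derivative_real_compose:
  fixes h :: "real \<Rightarrow> real"
  assumes "f differentiable (at x)" "(h has_real_derivative d) (at (f x))"
  shows "((\<lambda>x. h (f x)) has_derivative (\<lambda>v. d * frechet_derivative f (at x) v)) (at x)"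
  using has_derivative_compose[OF has_derivative_frechet[OF assms(1)], of h "(*) d"] assms(2)
  by (simp add: has_field_derivative_def)

lemma partial_deriv_compose:
  fixes h :: "real \<Rightarrow> real"
  assumes "f differentiable (at x)" "(h has_real_derivative d) (at (f x))"
  shows "partial_deriv i (\<lambda>x. h (f x)) x = d * partial_deriv i f x"
  by (subst partial_deriv_eq[OF has_derivative_real_compose[OF assms]]) (simp add: partial_deriv_def)

lemma C_k_Suc_D: "C_k (Suc k) f \<Longrightarrow> C_k k f"
  by (induction k arbitrary: f) (auto intro: differentiable_imp_continuous_on)

lemma C_k_Suc_differentiable: "C_k (Suc k) f \<Longrightarrow> f differentiable (at x)"
  by (simp add: differentiable_on_def)

lemma C_k_const: "C_k k (\<lambda>x. c)"
  by (induction k arbitrary: c) auto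

lemma C_k_coord: "C_k k (\<lambda>x. x $ j)"
proof (cases k)
  case (Suc m)
  have "(\<lambda>x::real^'a. x $ j) differentiable_on UNIV"
    by (intro linear_imp_differentiable_on) (simp add: linear_iff)
  then show ?thesis using Suc by (simp add: partial_deriv_coord C_k_const)
qed (simp add: continuous_intros)

lemma C_k_add: "C_k k f \<Longrightarrow> C_k k g \<Longrightarrow> C_k k (\<lambda>x. f x + g x)"
proof (induction k arbitrary: f g)
  case (Suc k)
  have "partial_deriv i (\<lambda>x. f x + g x) = (\<lambda>x. partial_deriv i f x + partial_deriv i g x)" for i
    using Suc.prems[THEN C_k_Suc_differentiable] by (intro ext partial_deriv_add)
  then show ?case using Suc by simp
qed (simp add: continuous_on_add)

lemma C_k_mult: "C_k k f \<Longrightarrow> C_k k g \<Longrightarrow> C_k k (\<lambda>x. f x * g x)"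
proof (induction k arbitrary: f g)
  case (Suc k)
  have "partial_deriv i (\<lambda>x. f x * g x)
      = (\<lambda>x. f x * partial_deriv i g x + partial_deriv i f x * g x)" for i
    using Suc.prems[THEN C_k_Suc_differentiable] by (intro ext partial_deriv_mult)
  moreover have "C_k k f" "C_k k g" using Suc.prems by (auto intro: C_k_Suc_D simp del: C_k.simps)
  ultimately show ?case using Suc by (simp add: C_k_add)
qed (simp add: continuous_on_mult)

text \<open>Composition with a function of one real variable is handled for a whole set of functions
  that is closed under differentiation: the chain rule then stays inside the set.\<close>

lemma C_k_compose:
  fixes H :: "(real \<Rightarrow> real) set"
  assumes H: "\<And>h. h \<in> H \<Longrightarrow> \<exists>h'\<in>H. \<forall>t. (h has_real_derivative h' t) (at t)"
  shows "C_k k f \<Longrightarrow> h \<in> H \<Longrightarrow> C_k k (\<lambda>x. h (f x))"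
proof (induction k arbitrary: h)
  case 0
  then have "continuous_on UNIV h"
    using H by (meson DERIV_isCont continuous_at_imp_continuous_on)
  then show ?case using 0 continuous_on_compose2[of UNIV h UNIV f] by auto
next
  case (Suc k)
  obtain h' where h': "h' \<in> H" "\<And>t. (h has_real_derivative h' t) (at t)" using H[OF Suc.prems(2)] by auto
  have "partial_deriv i (\<lambda>x. h (f x)) = (\<lambda>x. h' (f x) * partial_deriv i f x)" for i
    using Suc.prems(1)[THEN C_k_Suc_differentiable] h' by (intro ext partial_deriv_compose)
  moreover have "(\<lambda>x. h (f x)) differentiable_on UNIV"
    unfolding differentiable_on_def differentiable_def
    using has_derivative_real_compose[OF C_k_Suc_differentiable[OF Suc.prems(1)] h'(2)] by blast
  moreover have "C_k k (\<lambda>x. h' (f x))"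
    using Suc.IH[OF C_k_Suc_D[OF Suc.prems(1)] h'(1)] .
  ultimately show ?case using Suc.prems by (simp add: C_k_mult)
qed

definition smooth :: "(real^'n::finite \<Rightarrow> real) \<Rightarrow> bool" where
  "smooth f \<longleftrightarrow> (\<forall>k. C_k k f)"

lemma smooth_const [simp, intro]: "smooth (\<lambda>x. c)"
  and smooth_coord [simp, intro]: "smooth (\<lambda>x. x $ j)"
  and smooth_add [intro]: "smooth f \<Longrightarrow> smooth g \<Longrightarrow> smooth (\<lambda>x. f x + g x)"
  and smooth_mult [intro]: "smooth f \<Longrightarrow> smooth g \<Longrightarrow> smooth (\<lambda>x. f x * g x)"
  by (auto simp: smooth_def C_k_const C_k_coord C_k_add C_k_mult)

lemma smooth_diff [intro]: "smooth f \<Longrightarrow> smooth g \<Longrightarrow> smooth (\<lambda>x. f x - g x)"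
  using smooth_add[of f "\<lambda>x. (-1) * g x"] smooth_mult[of "\<lambda>x. -1" g] by simp

lemma smooth_sum [intro]: "(\<And>i. i \<in> I \<Longrightarrow> smooth (f i)) \<Longrightarrow> smooth (\<lambda>x. \<Sum>i\<in>I. f i x)"
  by (induction I rule: infinite_finite_induct) auto

lemma smooth_prod [intro]: "(\<And>i. i \<in> I \<Longrightarrow> smooth (f i)) \<Longrightarrow> smooth (\<lambda>x. \<Prod>i\<in>I. f i x)"
  by (induction I rule: infinite_finite_induct) auto

lemma smooth_partial_deriv [intro]: "smooth f \<Longrightarrow> smooth (partial_deriv i f)"
  unfolding smooth_def using C_k.simps(2) by blast

lemma smooth_differentiable: "smooth f \<Longrightarrow> f differentiable (at x)"
  unfolding smooth_def by (blast intro: C_k_Suc_differentiable)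

lemma smooth_continuous_on: "smooth f \<Longrightarrow> continuous_on S f"
  by (meson smooth_differentiable continuous_at_imp_continuous_on differentiable_imp_continuous_within)

lemma smooth_compose:
  fixes H :: "(real \<Rightarrow> real) set"
  assumes "\<And>h. h \<in> H \<Longrightarrow> \<exists>h'\<in>H. \<forall>t. (h has_real_derivative h' t) (at t)" "smooth f" "h \<in> H"
  shows "smooth (\<lambda>x. h (f x))"
  using C_k_compose[OF assms(1)] assms(2,3) unfolding smooth_def by blast

lemma smooth_exp: "smooth f \<Longrightarrow> smooth (\<lambda>x. exp (f x))"
  by (rule smooth_compose[where H="{exp}" and h=exp]) (auto intro: DERIV_exp)

lemma smooth_sin_cos:
  assumes "smooth f"
  shows "smooth (\<lambda>x. sin (f x))" "smooth (\<lambda>x. cos (f x))"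
proof -
  define H :: "(real \<Rightarrow> real) set" where "H = {sin, cos, \<lambda>t. - sin t, \<lambda>t. - cos t}"
  have "\<exists>h'\<in>H. \<forall>t. (h has_real_derivative h' t) (at t)" if "h \<in> H" for h
  proof -
    have "((\<lambda>t. - sin t) has_real_derivative - cos t) (at t)"
      "((\<lambda>t. - cos t) has_real_derivative sin t) (at t)" for t :: real
      by (auto intro!: derivative_eq_intros)
    then have "\<exists>h'\<in>H. \<forall>t. (sin has_real_derivative h' t) (at t)"
      "\<exists>h'\<in>H. \<forall>t. (cos has_real_derivative h' t) (at t)"
      "\<exists>h'\<in>H. \<forall>t. ((\<lambda>t. - sin t) has_real_derivative h' t) (at t)"
      "\<exists>h'\<in>H. \<forall>t. ((\<lambda>t. - cos t) has_real_derivative h' t) (at t)"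
      unfolding H_def by (intro bexI[of _ cos] bexI[of _ "\<lambda>t. - sin t"] bexI[of _ "\<lambda>t. - cos t"]
          bexI[of _ sin] allI DERIV_sin DERIV_cos; simp)+
    moreover have "h = sin \<or> h = cos \<or> h = (\<lambda>t. - sin t) \<or> h = (\<lambda>t. - cos t)"
      using that by (simp add: H_def)
    ultimately show ?thesis by (elim disjE) simp_all
  qed
  then show "smooth (\<lambda>x. sin (f x))" "smooth (\<lambda>x. cos (f x))"
    using smooth_compose[of H f sin] smooth_compose[of H f cos] assms by (auto simp: H_def)
qed

definition flat :: "real \<Rightarrow> real" where
  "flat t = (if t > 0 then exp (- (1 / t)) else 0)"

lemma flat_pos_iff: "flat t > 0 \<longleftrightarrow> t > 0" and flat_nonneg: "flat t \<ge> 0"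
  by (auto simp: flat_def)

text \<open>This is what makes all derivatives of \<open>flat\<close> vanish at \<open>0\<close>, after substituting \<open>s = 1 / t\<close>.\<close>

lemma poly_exp_tendsto_0: "((\<lambda>s. poly p s * exp (- s)) \<longlongrightarrow> (0::real)) at_top"
proof -
  have "((\<lambda>s. \<Sum>i\<le>degree p. coeff p i * (s ^ i / exp s)) \<longlongrightarrow> (\<Sum>i\<le>degree p. coeff p i * 0)) at_top"
    by (intro tendsto_intros tendsto_power_div_exp_0)
  moreover have "poly p s * exp (- s) = (\<Sum>i\<le>degree p. coeff p i * (s ^ i / exp s))" for s
    by (simp add: poly_altdef exp_minus divide_inverse sum_distrib_right mult.assoc)
  ultimately show ?thesis by simp
qed

text \<open>All derivatives of \<open>flat\<close> have the form \<open>p (1 / t) * exp (- 1 / t)\<close> for a polynomial \<open>p\<close>, and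
  differentiation turns \<open>p\<close> into \<open>X\<^sup>2 (p - p')\<close>. At \<open>0\<close> the exponential beats every such factor.\<close>

lemma smooth_flat:
  assumes "smooth f"
  shows "smooth (\<lambda>x. flat (f x))"
proof -
  define F where "F p t = (if t > 0 then poly p (1 / t) * exp (- (1 / t)) else 0)" for p :: "real poly" and t
  have der: "(F p has_real_derivative F ([:0,0,1:] * (p - pderiv p)) t) (at t)" for p t
  proof -
    consider "t > 0" | "t < 0" | "t = 0" by linarith
    then show ?thesis
    proof cases
      case 1
      have "((\<lambda>t. poly p (1 / t) * exp (- (1 / t))) has_real_derivative
          F ([:0,0,1:] * (p - pderiv p)) t) (at t)"
      proof -
        have inv: "((\<lambda>t. 1 / t) has_real_derivative - ((1 / t) * (1 / t))) (at t)"
          using 1 by (auto intro!: derivative_eq_intros simp: power2_eq_square)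
        have "F ([:0,0,1:] * (p - pderiv p)) t
            = poly (pderiv p) (1 / t) * - ((1 / t) * (1 / t)) * exp (- (1 / t))
              + exp (- (1 / t)) * - (- ((1 / t) * (1 / t))) * poly p (1 / t)"
          using 1 unfolding F_def by (simp only: poly_mult poly_diff poly_pCons poly_0 if_True)
            (simp add: algebra_simps)
        then show ?thesis
          using DERIV_mult[OF DERIV_chain2[OF poly_DERIV inv] DERIV_chain2[OF DERIV_exp DERIV_minus[OF inv]]]
          by simp
      qed
      moreover have ev: "eventually (\<lambda>s. F p s = poly p (1 / s) * exp (- (1 / s))) (nhds t)"
        using 1 eventually_nhds_in_open[of "{0<..}" t] by (auto elim!: eventually_mono simp: F_def)
      ultimately show ?thesis using DERIV_cong_ev[OF refl ev refl] by blast
    next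
      case 2
      have ev: "eventually (\<lambda>s. F p s = 0) (nhds t)"
        using 2 eventually_nhds_in_open[of "{..<0}" t] by (auto elim!: eventually_mono simp: F_def)
      have "((\<lambda>t. 0) has_real_derivative F ([:0,0,1:] * (p - pderiv p)) t) (at t)"
        using 2 by (simp add: F_def)
      then show ?thesis using DERIV_cong_ev[OF refl ev refl] by blast
    next
      case 3
      have "((\<lambda>t. F p t / t) \<longlongrightarrow> 0) (at_right 0)"
      proof -
        have "((\<lambda>t::real. poly (pCons 0 p) (inverse t) * exp (- inverse t)) \<longlongrightarrow> 0) (at_right 0)"
          by (rule filterlim_compose[OF poly_exp_tendsto_0 filterlim_inverse_at_top_right])
        then show ?thesis
        proof (rule Lim_transform_eventually)
          show "\<forall>\<^sub>F t in at_right 0. poly (pCons 0 p) (inverse t) * exp (- inverse t) = F p t / t"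
            by (rule eventually_at_rightI[of 0 1]) (simp_all add: F_def divide_inverse)
        qed
      qed
      moreover have "((\<lambda>t. F p t / t) \<longlongrightarrow> 0) (at_left 0)"
      proof (rule Lim_transform_eventually[OF tendsto_const])
        show "\<forall>\<^sub>F t in at_left 0. 0 = F p t / t"
          by (rule eventually_at_leftI[of "-1"]) (simp_all add: F_def)
      qed
      ultimately have "((\<lambda>t. F p t / t) \<longlongrightarrow> 0) (at 0)"
        by (intro filterlim_split_at_real)
      then show ?thesis
        using 3 by (simp add: has_field_derivative_iff F_def)
    qed
  qed
  have "\<forall>h\<in>range F. \<exists>h'\<in>range F. \<forall>t. (h has_real_derivative h' t) (at t)"
  proof (intro ballI)
    fix h assume "h \<in> range F"
    then obtain p where "h = F p" by (elim imageE)
    then show "\<exists>h'\<in>range F. \<forall>t. (h has_real_derivative h' t) (at t)"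
      using der by (intro bexI[of _ "F ([:0,0,1:] * (p - pderiv p))"]) simp_all
  qed
  moreover have "F 1 = flat" by (rule ext) (simp add: F_def flat_def)
  then have "flat \<in> range F" by (metis rangeI)
  ultimately show ?thesis using smooth_compose[OF _ assms, of "range F" flat] by blast
qed


text \<open>A product over the coordinates rather than a function of the distance to a centre: the
  means of a function over all small cubes determine it almost everywhere.\<close>

definition box_bump :: "real^'n::finite \<Rightarrow> real^'n \<Rightarrow> real^'n \<Rightarrow> real" where
  "box_bump a b x = (\<Prod>i\<in>UNIV. flat (x $ i - a $ i) * flat (b $ i - x $ i))"

lemma smooth_box_bump: "smooth (box_bump a b)"
  unfolding box_bump_def[abs_def] by (intro smooth_prod smooth_mult smooth_flat smooth_diff) auto

lemma box_bump_nonneg: "box_bump a b x \<ge> 0"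
  unfolding box_bump_def by (intro prod_nonneg mult_nonneg_nonneg flat_nonneg)

lemma box_bump_pos_iff: "box_bump a b x > 0 \<longleftrightarrow> x \<in> box a b"
proof -
  have "flat s * flat t > 0 \<longleftrightarrow> s > 0 \<and> t > 0" for s t
    using flat_nonneg[of s] flat_nonneg[of t] flat_pos_iff[of s] flat_pos_iff[of t]
    by (auto simp: zero_less_mult_iff)
  moreover have "box_bump a b x > 0 \<longleftrightarrow> (\<forall>i. flat (x $ i - a $ i) * flat (b $ i - x $ i) > 0)"
    using box_bump_nonneg[of a b x] flat_nonneg unfolding box_bump_def
    by (auto simp: less_le)
  ultimately show ?thesis by (auto simp: mem_box_cart)
qed

lemma box_bump_eq_0_iff: "box_bump a b x = 0 \<longleftrightarrow> x \<notin> box a b"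
  using box_bump_nonneg[of a b x] box_bump_pos_iff[of a b x] by auto

section \<open>Test functions\<close>

lemma test_functionsI:
  assumes "smooth \<phi>" "compact S" "S \<subseteq> \<Omega>" "\<And>x. \<phi> x \<noteq> 0 \<Longrightarrow> x \<in> S"
  shows "\<phi> \<in> test_functions \<Omega>"
proof -
  have "closure {x. \<phi> x \<noteq> 0} \<subseteq> S"
    using assms by (intro closure_minimal compact_imp_closed) auto
  moreover from this have "compact (closure {x. \<phi> x \<noteq> 0})"
    using assms(2) by (meson closed_closure compact_closure bounded_subset compact_imp_bounded
        closure_subset order_trans)
  ultimately show ?thesis using assms by (auto simp: test_functions_def smooth_def)
qed

lemma test_functionsE:
  assumes "\<phi> \<in> test_functions \<Omega>"
  obtains S where "smooth \<phi>" "compact S" "S \<subseteq> \<Omega>" "\<And>x. \<phi> x \<noteq> 0 \<Longrightarrow> x \<in> S"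
  using assms closure_subset[of "{x. \<phi> x \<noteq> 0}"] unfolding test_functions_def smooth_def by blast

lemma test_smooth: "\<phi> \<in> test_functions \<Omega> \<Longrightarrow> smooth \<phi>"
  by (auto simp: test_functions_def smooth_def)

lemma test_outside: "\<phi> \<in> test_functions \<Omega> \<Longrightarrow> x \<notin> \<Omega> \<Longrightarrow> \<phi> x = 0"
  using test_functionsE by blast

lemma test_zero [simp]: "(\<lambda>x. 0) \<in> test_functions \<Omega>"
  by (rule test_functionsI[of _ "{}"]) auto

lemma test_mult_smooth:
  assumes "\<phi> \<in> test_functions \<Omega>" "smooth f"
  shows "(\<lambda>x. \<phi> x * f x) \<in> test_functions \<Omega>"
  using assms(1)
  by (rule test_functionsE, intro test_functionsI[OF smooth_mult]) (use assms(2) in auto)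

lemma test_scale: "\<phi> \<in> test_functions \<Omega> \<Longrightarrow> (\<lambda>x. c * \<phi> x) \<in> test_functions \<Omega>"
  using test_mult_smooth[of \<phi> \<Omega> "\<lambda>x. c"] by (simp add: mult.commute)

lemma test_add:
  assumes "\<phi> \<in> test_functions \<Omega>" "\<psi> \<in> test_functions \<Omega>"
  shows "(\<lambda>x. \<phi> x + \<psi> x) \<in> test_functions \<Omega>"
proof -
  obtain S where S: "smooth \<phi>" "compact S" "S \<subseteq> \<Omega>" "\<And>x. \<phi> x \<noteq> 0 \<Longrightarrow> x \<in> S"
    using assms(1) by (rule test_functionsE) blast
  obtain T where T: "smooth \<psi>" "compact T" "T \<subseteq> \<Omega>" "\<And>x. \<psi> x \<noteq> 0 \<Longrightarrow> x \<in> T"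
    using assms(2) by (rule test_functionsE) blast
  show ?thesis
    using S T by (intro test_functionsI[of _ "S \<union> T"] smooth_add compact_Un) force+
qed

lemma test_sum:
  "(\<And>i. i \<in> I \<Longrightarrow> \<phi> i \<in> test_functions \<Omega>) \<Longrightarrow> (\<lambda>x. \<Sum>i\<in>I. \<phi> i x) \<in> test_functions \<Omega>"
  by (induction I rule: infinite_finite_induct) (auto intro: test_add)

lemma partial_deriv_outside:
  assumes "closed C" "\<And>x. f x \<noteq> 0 \<Longrightarrow> x \<in> C" "x \<notin> C"
  shows "partial_deriv i f x = 0"
proof -
  have "(f has_derivative (\<lambda>_. 0)) (at x)"
    by (rule has_derivative_transform_within_open[of "\<lambda>_. 0" _ _ _ "- C"])
      (use assms in \<open>auto intro: ccontr\<close>)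
  then show ?thesis by (simp add: partial_deriv_eq)
qed

lemma test_partial_deriv:
  assumes "\<phi> \<in> test_functions \<Omega>"
  shows "partial_deriv i \<phi> \<in> test_functions \<Omega>"
proof -
  obtain S where S: "smooth \<phi>" "compact S" "S \<subseteq> \<Omega>" "\<And>x. \<phi> x \<noteq> 0 \<Longrightarrow> x \<in> S"
    using assms by (rule test_functionsE) blast
  have "partial_deriv i \<phi> x = 0" if "x \<notin> S" for x
    using partial_deriv_outside[OF compact_imp_closed[OF S(2)] S(4) that] .
  then show ?thesis using S by (intro test_functionsI[of _ S] smooth_partial_deriv) auto
qed

lemma test_box_bump:
  "cbox a b \<subseteq> \<Omega> \<Longrightarrow> box_bump a b \<in> test_functions \<Omega>"
  using box_subset_cbox[of a b]
  by (intro test_functionsI[of _ "cbox a b"] smooth_box_bump) (auto simp: box_bump_eq_0_iff)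

text \<open>As \<open>n\<close> grows these test functions increase to the indicator function of the open box, so
  that an identity tested against them holds for integrals over boxes.\<close>

lemma test_box_indicator_approx:
  assumes "cbox a b \<subseteq> \<Omega>"
  shows "(\<lambda>x. 1 - exp (- (real n * box_bump a b x))) \<in> test_functions \<Omega>"
proof (rule test_functionsI[of _ "cbox a b"])
  show "smooth (\<lambda>x. 1 - exp (- (real n * box_bump a b x)))"
    using smooth_mult[OF smooth_const[of "- real n"] smooth_box_bump[of a b]]
    by (intro smooth_diff smooth_exp) auto
qed (use assms box_subset_cbox[of a b] in \<open>auto simp: box_bump_eq_0_iff intro: ccontr\<close>)

section \<open>Semi-inner products on function spaces\<close>

abbreviation sqdist ::
    "(('a \<Rightarrow> 'b::real_vector) \<Rightarrow> ('a \<Rightarrow> 'b) \<Rightarrow> real) \<Rightarrow> ('a \<Rightarrow> 'b) \<Rightarrow> ('a \<Rightarrow> 'b) \<Rightarrow> real" where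
  "sqdist B u v \<equiv> B (\<lambda>x. u x - v x) (\<lambda>x. u x - v x)"

text \<open>The vectors are functions and the form is only required to be semidefinite, so that square
  integrable functions and Sobolev functions are covered without passing to classes of
  functions that agree almost everywhere.\<close>

locale semi_inner =
  fixes V :: "('a \<Rightarrow> 'b::real_vector) set" and B :: "('a \<Rightarrow> 'b) \<Rightarrow> ('a \<Rightarrow> 'b) \<Rightarrow> real"
  assumes nonempty: "V \<noteq> {}"
    and add_closed: "u \<in> V \<Longrightarrow> v \<in> V \<Longrightarrow> (\<lambda>x. u x + v x) \<in> V"
    and scale_closed: "u \<in> V \<Longrightarrow> (\<lambda>x. c *\<^sub>R u x) \<in> V"
    and B_add: "u \<in> V \<Longrightarrow> v \<in> V \<Longrightarrow> w \<in> V \<Longrightarrow> B (\<lambda>x. u x + v x) w = B u w + B v w"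
    and B_scale: "u \<in> V \<Longrightarrow> w \<in> V \<Longrightarrow> B (\<lambda>x. c *\<^sub>R u x) w = c * B u w"
    and B_sym: "u \<in> V \<Longrightarrow> v \<in> V \<Longrightarrow> B u v = B v u"
    and B_nonneg: "u \<in> V \<Longrightarrow> B u u \<ge> 0"
begin

lemma diff_closed: "u \<in> V \<Longrightarrow> v \<in> V \<Longrightarrow> (\<lambda>x. u x - v x) \<in> V"
  using add_closed[of u "\<lambda>x. (-1) *\<^sub>R v x"] scale_closed[of v "-1"] by simp

lemma B_diff:
  assumes "u \<in> V" "v \<in> V" "w \<in> V"
  shows "B (\<lambda>x. u x - v x) w = B u w - B v w"
proof -
  have "B (\<lambda>x. u x + (-1) *\<^sub>R v x) w = B u w + (-1) * B v w"
    using assms by (simp only: B_add scale_closed B_scale)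
  then show ?thesis by simp
qed

lemma B_add_right: "u \<in> V \<Longrightarrow> v \<in> V \<Longrightarrow> w \<in> V \<Longrightarrow> B w (\<lambda>x. u x + v x) = B w u + B w v"
  by (simp only: B_sym[of w] add_closed B_add)

lemma B_scale_right: "u \<in> V \<Longrightarrow> w \<in> V \<Longrightarrow> B w (\<lambda>x. c *\<^sub>R u x) = c * B w u"
  by (simp only: B_sym[of w] scale_closed B_scale)

lemma B_diff_right: "u \<in> V \<Longrightarrow> v \<in> V \<Longrightarrow> w \<in> V \<Longrightarrow> B w (\<lambda>x. u x - v x) = B w u - B w v"
  by (simp only: B_sym[of w] diff_closed B_diff)

lemmas closed = add_closed scale_closed diff_closed
lemmas bilinear = B_add B_scale B_diff B_add_right B_scale_right B_diff_right

lemma zero_closed: "(\<lambda>x. 0) \<in> V"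
  using nonempty diff_closed by fastforce

definition nrm :: "('a \<Rightarrow> 'b) \<Rightarrow> real" where "nrm u = sqrt (B u u)"

lemma nrm_nonneg: "u \<in> V \<Longrightarrow> nrm u \<ge> 0"
  and nrm_sq: "u \<in> V \<Longrightarrow> (nrm u)\<^sup>2 = B u u"
  using B_nonneg by (auto simp: nrm_def)

lemma B_add_sq:
  assumes "u \<in> V" "v \<in> V"
  shows "B (\<lambda>x. u x + v x) (\<lambda>x. u x + v x) = B u u + 2 * B u v + B v v"
  using assms B_sym[of u v] by (simp add: bilinear closed)

lemma B_diff_sq:
  assumes "u \<in> V" "v \<in> V"
  shows "sqdist B u v = B u u - 2 * B u v + B v v"
  using assms B_sym[of u v] by (simp add: bilinear closed)

lemma cauchy_schwarz_sq:
  assumes "u \<in> V" "v \<in> V"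
  shows "(B u v)\<^sup>2 \<le> B u u * B v v"
proof -
  \<comment> \<open>The optimal \<open>t\<close> is \<open>B u v / B v v\<close>. If \<open>B v v = 0\<close>, a large multiple of \<open>B u v\<close> gives a contradiction.\<close>
  have q: "0 \<le> B u u - 2 * (t * B u v) + t * (t * B v v)" for t
    using B_nonneg[OF diff_closed[OF assms(1) scale_closed[OF assms(2), of t]]]
      B_diff_sq[OF assms(1) scale_closed[OF assms(2), of t]] assms by (simp add: bilinear closed)
  show ?thesis
  proof (cases "B v v = 0")
    case True
    have "B u v = 0"
    proof (rule ccontr)
      assume "B u v \<noteq> 0"
      then show False using q[of "(B u u + 1) / (2 * B u v)"] True by simp
    qed
    then show ?thesis using True by simp
  next
    case False
    then have "B v v > 0" using B_nonneg[OF assms(2)] by simp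
    then show ?thesis using q[of "B u v / B v v"] by (simp add: field_simps power2_eq_square)
  qed
qed

lemma cauchy_schwarz: "u \<in> V \<Longrightarrow> v \<in> V \<Longrightarrow> \<bar>B u v\<bar> \<le> nrm u * nrm v"
  using real_sqrt_le_mono[OF cauchy_schwarz_sq[of u v]] by (simp add: nrm_def real_sqrt_mult)

lemma nrm_triangle:
  assumes "u \<in> V" "v \<in> V"
  shows "nrm (\<lambda>x. u x + v x) \<le> nrm u + nrm v"
proof (rule power2_le_imp_le)
  show "(nrm (\<lambda>x. u x + v x))\<^sup>2 \<le> (nrm u + nrm v)\<^sup>2"
    using cauchy_schwarz[OF assms] assms
    by (simp add: nrm_sq add_closed B_add_sq power2_sum)
qed (use assms nrm_nonneg in auto)

lemma nrm_scale: "u \<in> V \<Longrightarrow> nrm (\<lambda>x. c *\<^sub>R u x) = \<bar>c\<bar> * nrm u"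
  by (simp add: nrm_def bilinear closed real_sqrt_mult flip: mult.assoc)

lemma nrm_diff_triangle: "u \<in> V \<Longrightarrow> v \<in> V \<Longrightarrow> nrm (\<lambda>x. u x - v x) \<le> nrm u + nrm v"
  using nrm_triangle[of u "\<lambda>x. (-1) *\<^sub>R v x"] scale_closed[of v "-1"] nrm_scale[of v "-1"] by simp

lemma nrm_minus_commute: "u \<in> V \<Longrightarrow> v \<in> V \<Longrightarrow> nrm (\<lambda>x. u x - v x) = nrm (\<lambda>x. v x - u x)"
  by (simp add: nrm_def B_diff_sq B_sym)

lemma nrm_triangle3:
  "u \<in> V \<Longrightarrow> v \<in> V \<Longrightarrow> w \<in> V \<Longrightarrow>
    nrm (\<lambda>x. u x - w x) \<le> nrm (\<lambda>x. u x - v x) + nrm (\<lambda>x. v x - w x)"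
  using nrm_triangle[of "\<lambda>x. u x - v x" "\<lambda>x. v x - w x"] by (simp add: closed)

lemma nrm_diff_ge: "u \<in> V \<Longrightarrow> v \<in> V \<Longrightarrow> nrm u - nrm v \<le> nrm (\<lambda>x. u x - v x)"
  using nrm_triangle[of "\<lambda>x. u x - v x" v] by (simp add: closed)

lemma tendsto_B:
  assumes s: "\<And>n::nat. s n \<in> V" and w: "w \<in> V" and v: "v \<in> V"
    and lim: "(\<lambda>n. sqdist B (s n) w) \<longlonglongrightarrow> 0"
  shows "(\<lambda>n. B (s n) v) \<longlonglongrightarrow> B w v"
proof -
  have "(\<lambda>n. B (\<lambda>x. s n x - w x) v) \<longlonglongrightarrow> 0"
  proof (rule Lim_null_comparison)
    show "\<forall>\<^sub>F n in sequentially. norm (B (\<lambda>x. s n x - w x) v) \<le> nrm (\<lambda>x. s n x - w x) * nrm v"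
      using cauchy_schwarz[OF diff_closed[OF s w] v] by simp
    show "(\<lambda>n. nrm (\<lambda>x. s n x - w x) * nrm v) \<longlonglongrightarrow> 0"
      using tendsto_mult[OF tendsto_real_sqrt[OF lim] tendsto_const[of "nrm v"]] by (simp add: nrm_def)
  qed
  then have "(\<lambda>n. (B (s n) v - B w v) + B w v) \<longlonglongrightarrow> 0 + B w v"
    by (intro tendsto_add) (simp_all add: B_diff s w v)
  then show ?thesis by simp
qed

end

text \<open>The form may vanish on nonzero functions, so limits, and the vectors delivered by the
  representation theorem, are unique only up to such functions.\<close>

locale semi_hilbert = semi_inner +
  assumes complete: "(\<And>n. s n \<in> V) \<Longrightarrow>
    (\<And>e. e > 0 \<Longrightarrow> \<exists>N::nat. \<forall>m\<ge>N. \<forall>n\<ge>N. sqdist B (s m) (s n) < e) \<Longrightarrow>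
    \<exists>w\<in>V. (\<lambda>n. sqdist B (s n) w) \<longlonglongrightarrow> 0"
begin

text \<open>A minimizing sequence of the quadratic functional \<open>v \<mapsto> B v v - 2 l v\<close> is a Cauchy sequence by
  the parallelogram law. At its limit the first variation of the functional vanishes.\<close>

theorem riesz_representation:
  assumes add: "\<And>u v. u \<in> V \<Longrightarrow> v \<in> V \<Longrightarrow> l (\<lambda>x. u x + v x) = l u + l v"
    and scale: "\<And>c u. u \<in> V \<Longrightarrow> l (\<lambda>x. c *\<^sub>R u x) = c * l u"
    and bound: "\<And>v. v \<in> V \<Longrightarrow> \<bar>l v\<bar> \<le> C * nrm v"
  shows "\<exists>w\<in>V. \<forall>v\<in>V. B w v = l v"
proof -
  define J where "J v = B v v - 2 * l v" for v
  have "J v \<ge> - C\<^sup>2" if "v \<in> V" for v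
  proof -
    have "0 \<le> (nrm v - C)\<^sup>2" by simp
    then show ?thesis using bound[OF that] nrm_sq[OF that] by (simp add: J_def power2_diff mult.commute[of C])
  qed
  then have bdd: "bdd_below (J ` V)" by (intro bdd_belowI2[of V "- C\<^sup>2" J])
  define I where "I = Inf (J ` V)"
  have I: "I \<le> J v" if "v \<in> V" for v using bdd that by (simp add: I_def cINF_lower)
  have "\<exists>v\<in>V. J v < I + inverse (real (Suc n))" for n
    using cInf_lessD[of "J ` V" "I + inverse (real (Suc n))"] nonempty by (auto simp: I_def)
  then obtain s where s: "\<And>n. s n \<in> V" "\<And>n. J (s n) < I + inverse (real (Suc n))" by metis
  have par: "sqdist B u v \<le> 2 * (J u - I) + 2 * (J v - I)"
    if "u \<in> V" "v \<in> V" for u v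
  proof -
    have "I \<le> J (\<lambda>x. (1/2) *\<^sub>R (u x + v x))" using that by (intro I closed)
    also have "\<dots> = (B u u + 2 * B u v + B v v) / 4 - (l u + l v)"
      using that scale[OF add_closed[OF that], of "1/2"]
      by (simp add: J_def B_scale B_scale_right closed B_add_sq add)
    finally show ?thesis unfolding B_diff_sq[OF that] J_def by (simp add: field_simps)
  qed
  have "\<exists>N. \<forall>m\<ge>N. \<forall>n\<ge>N. sqdist B (s m) (s n) < e" if "e > 0" for e
  proof -
    obtain N where N: "inverse (real (Suc N)) < e / 4" using reals_Archimedean[of "e / 4"] \<open>e > 0\<close> by auto
    have small: "J (s k) - I < e / 4" if "k \<ge> N" for k
    proof -
      have "inverse (real (Suc k)) \<le> inverse (real (Suc N))" using that by (simp add: le_imp_inverse_le)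
      then show ?thesis using s(2)[of k] N by linarith
    qed
    have "sqdist B (s m) (s n) < e" if "m \<ge> N" "n \<ge> N" for m n
      using par[OF s(1)[of m] s(1)[of n]] small[OF that(1)] small[OF that(2)] by (simp add: field_simps)
    then show ?thesis by blast
  qed
  then obtain w where w: "w \<in> V" "(\<lambda>n. sqdist B (s n) w) \<longlonglongrightarrow> 0"
    using complete[of s] s(1) by auto
  have Js: "(\<lambda>n. J (s n)) \<longlonglongrightarrow> I"
  proof (rule tendsto_sandwich[of "\<lambda>_. I" _ _ "\<lambda>n. I + inverse (real (Suc n))"])
    show "(\<lambda>n. I + inverse (real (Suc n))) \<longlonglongrightarrow> I"
      using tendsto_add[OF tendsto_const LIMSEQ_inverse_real_of_nat, of I] by simp
  qed (use I s in \<open>simp_all add: less_imp_le del: of_nat_Suc\<close>)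
  have "B w v = l v" if v: "v \<in> V" for v
  proof -
    have Bs: "(\<lambda>n. B (s n) v) \<longlonglongrightarrow> B w v" using s(1) w v by (intro tendsto_B)
    have q: "0 \<le> 2 * (t * (B w v - l v)) + t * (t * B v v)" for t
    proof -
      have "I \<le> J (s n) + 2 * (t * (B (s n) v - l v)) + t * (t * B v v)" for n
      proof -
        have "I \<le> J (\<lambda>x. s n x + t *\<^sub>R v x)" using s(1) v by (intro I closed)
        also have "\<dots> = J (s n) + 2 * (t * (B (s n) v - l v)) + t * (t * B v v)"
          using s(1) v by (simp add: J_def B_add_sq closed add scale bilinear algebra_simps)
        finally show ?thesis .
      qed
      then have "I \<le> I + 2 * (t * (B w v - l v)) + t * (t * B v v)"
        by (intro LIMSEQ_le_const[where X="\<lambda>n. J (s n) + 2 * (t * (B (s n) v - l v)) + t * (t * B v v)"]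
            tendsto_intros Js Bs) auto
      then show ?thesis by simp
    qed
    define c d where "c = B w v - l v" and "d = B v v"
    have d: "d \<ge> 0" using B_nonneg[OF v] by (simp add: d_def)
    \<comment> \<open>Adding \<open>1\<close> to \<open>d\<close> keeps the step \<open>- r\<close> admissible when \<open>B v v = 0\<close>.\<close>
    define r where "r = c / (d + 1)"
    have c: "c = r * (d + 1)" using d by (simp add: r_def)
    have "0 \<le> 2 * (- r * c) + (- r) * (- r * d)" using q[of "- r"] by (simp only: c_def d_def)
    then have "(r * r) * (d + 2) \<le> 0" by (simp add: c algebra_simps)
    then have "r = 0" using d by (auto simp: mult_le_0_iff)
    then have "c = 0" by (simp add: c)
    then show ?thesis by (simp add: c_def)
  qed
  then show ?thesis using w(1) by blast
qed

text \<open>Used twice: to replace the full Sobolev product by the energy product, and to apply the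
  representation theorem to the form of a coercive operator.\<close>

lemma equivalent_form:
  assumes q: "semi_inner V q"
    and lower: "\<And>u. u \<in> V \<Longrightarrow> \<delta> * B u u \<le> q u u" "\<delta> > 0"
    and upper: "\<And>u. u \<in> V \<Longrightarrow> q u u \<le> C * B u u"
  shows "semi_hilbert V q"
proof -
  interpret Q: semi_inner V q by (rule q)
  show ?thesis
  proof
    fix s :: "nat \<Rightarrow> _"
    assume s: "\<And>n. s n \<in> V"
      and c: "\<And>e. e > 0 \<Longrightarrow> \<exists>N::nat. \<forall>m\<ge>N. \<forall>n\<ge>N. sqdist q (s m) (s n) < e"
    have "\<exists>N. \<forall>m\<ge>N. \<forall>n\<ge>N. sqdist B (s m) (s n) < e" if "e > 0" for e
    proof -
      obtain N where N: "\<And>m n. m \<ge> N \<Longrightarrow> n \<ge> N \<Longrightarrow> sqdist q (s m) (s n) < \<delta> * e"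
        using c[of "\<delta> * e"] \<open>e > 0\<close> lower(2) by auto
      have "\<delta> * sqdist B (s m) (s n) < \<delta> * e" if "m \<ge> N" "n \<ge> N" for m n
        using N[OF that] lower(1)[OF diff_closed[OF s s], of m n] by simp
      then show ?thesis using lower(2) by auto
    qed
    then obtain w where w: "w \<in> V" "(\<lambda>n. sqdist B (s n) w) \<longlonglongrightarrow> 0"
      using complete[of s] s by auto
    have "(\<lambda>n. sqdist q (s n) w) \<longlonglongrightarrow> 0"
    proof (rule tendsto_sandwich[of "\<lambda>_. 0"])
      show "(\<lambda>n. C * sqdist B (s n) w) \<longlonglongrightarrow> 0"
        using tendsto_mult[OF tendsto_const w(2)] by simp
      show "\<forall>\<^sub>F n in sequentially. sqdist q (s n) w
          \<le> C * sqdist B (s n) w"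
        using upper[OF diff_closed[OF s w(1)]] by simp
      show "\<forall>\<^sub>F n in sequentially. 0 \<le> sqdist q (s n) w"
        using Q.B_nonneg diff_closed[OF s w(1)] by simp
    qed simp
    then show "\<exists>w\<in>V. (\<lambda>n. sqdist q (s n) w) \<longlonglongrightarrow> 0" using w(1) by blast
  qed
qed

text \<open>The closure of the test functions in the first Sobolev space has exactly this shape.\<close>

lemma closure_semi_hilbert:
  assumes W: "W \<subseteq> V" "W \<noteq> {}"
    and add: "\<And>u v. u \<in> W \<Longrightarrow> v \<in> W \<Longrightarrow> (\<lambda>x. u x + v x) \<in> W"
    and scale: "\<And>c u. u \<in> W \<Longrightarrow> (\<lambda>x. c *\<^sub>R u x) \<in> W"
  shows "semi_hilbert {u\<in>V. \<forall>\<epsilon>>0. \<exists>\<phi>\<in>W. nrm (\<lambda>x. u x - \<phi> x) < \<epsilon>} B" (is "semi_hilbert ?U B")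
proof
  have WU: "W \<subseteq> ?U"
  proof
    fix \<phi> assume "\<phi> \<in> W"
    moreover have "nrm (\<lambda>x. \<phi> x - \<phi> x) = 0"
      using B_scale[OF zero_closed zero_closed, of 0] by (simp add: nrm_def)
    then have "\<forall>\<epsilon>>0. nrm (\<lambda>x. \<phi> x - \<phi> x) < \<epsilon>" by simp
    ultimately show "\<phi> \<in> ?U" using W(1) by blast
  qed
  then show "?U \<noteq> {}" using W(2) by blast
next
  fix u v assume u: "u \<in> ?U" and v: "v \<in> ?U"
  have "\<exists>\<phi>\<in>W. nrm (\<lambda>x. (u x + v x) - \<phi> x) < e" if "e > 0" for e
  proof -
    obtain \<phi> where \<phi>: "\<phi> \<in> W" "nrm (\<lambda>x. u x - \<phi> x) < e / 2" using u \<open>e > 0\<close> half_gt_zero by blast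
    obtain \<psi> where \<psi>: "\<psi> \<in> W" "nrm (\<lambda>x. v x - \<psi> x) < e / 2" using v \<open>e > 0\<close> half_gt_zero by blast
    have "nrm (\<lambda>x. (u x - \<phi> x) + (v x - \<psi> x)) \<le> nrm (\<lambda>x. u x - \<phi> x) + nrm (\<lambda>x. v x - \<psi> x)"
      using u v \<phi> \<psi> W by (intro nrm_triangle diff_closed) auto
    then have "nrm (\<lambda>x. (u x + v x) - (\<phi> x + \<psi> x)) < e"
      using \<phi>(2) \<psi>(2) by (simp add: algebra_simps)
    then show ?thesis using add[OF \<phi>(1) \<psi>(1)] by (intro bexI[of _ "\<lambda>x. \<phi> x + \<psi> x"])
  qed
  then show "(\<lambda>x. u x + v x) \<in> ?U" using u v by (simp add: add_closed)
next
  fix u c assume u: "u \<in> ?U"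
  have "\<exists>\<phi>\<in>W. nrm (\<lambda>x. c *\<^sub>R u x - \<phi> x) < e" if "e > 0" for e
  proof -
    have "e / (\<bar>c\<bar> + 1) > 0" using \<open>e > 0\<close> by simp
    then obtain \<phi> where \<phi>: "\<phi> \<in> W" "nrm (\<lambda>x. u x - \<phi> x) < e / (\<bar>c\<bar> + 1)" using u by blast
    have uV: "(\<lambda>x. u x - \<phi> x) \<in> V" using u \<phi>(1) W by (intro diff_closed) auto
    have "nrm (\<lambda>x. c *\<^sub>R (u x - \<phi> x)) = \<bar>c\<bar> * nrm (\<lambda>x. u x - \<phi> x)"
      by (rule nrm_scale[OF uV])
    also have "\<dots> \<le> (\<bar>c\<bar> + 1) * nrm (\<lambda>x. u x - \<phi> x)"
      using nrm_nonneg[OF uV] by (intro mult_right_mono) auto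
    also have "\<dots> < e" using \<phi>(2) by (simp add: field_simps)
    finally show ?thesis
      using scale[OF \<phi>(1), of c] by (intro bexI[of _ "\<lambda>x. c *\<^sub>R \<phi> x"]) (simp_all add: scaleR_diff_right)
  qed
  then show "(\<lambda>x. c *\<^sub>R u x) \<in> ?U" using u by (simp add: scale_closed)
next
  fix s :: "nat \<Rightarrow> _"
  assume s: "\<And>n. s n \<in> ?U"
    and c: "\<And>e. e > 0 \<Longrightarrow> \<exists>N::nat. \<forall>m\<ge>N. \<forall>n\<ge>N. sqdist B (s m) (s n) < e"
  then obtain w where w: "w \<in> V" "(\<lambda>n. sqdist B (s n) w) \<longlonglongrightarrow> 0"
    using complete[of s] by blast
  have "\<exists>\<phi>\<in>W. nrm (\<lambda>x. w x - \<phi> x) < e" if "e > 0" for e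
  proof -
    have "(\<lambda>n. nrm (\<lambda>x. s n x - w x)) \<longlonglongrightarrow> 0" using tendsto_real_sqrt[OF w(2)] by (simp add: nrm_def)
    then have "\<forall>\<^sub>F n in sequentially. nrm (\<lambda>x. s n x - w x) < e / 2"
      using \<open>e > 0\<close> order_tendstoD(2)[of _ 0 _ "e / 2"] by simp
    then obtain n where n: "nrm (\<lambda>x. s n x - w x) < e / 2" by (auto dest: eventually_happens)
    obtain \<phi> where \<phi>: "\<phi> \<in> W" "nrm (\<lambda>x. s n x - \<phi> x) < e / 2" using s \<open>e > 0\<close> half_gt_zero by blast
    have "s n \<in> V" "\<phi> \<in> V" using s \<phi>(1) W by auto
    then have "nrm (\<lambda>x. w x - \<phi> x) < e"
      using nrm_triangle3[of w "s n" \<phi>] nrm_minus_commute[of "s n" w] w(1) n \<phi>(2) by simp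
    then show ?thesis using \<phi>(1) by blast
  qed
  then show "\<exists>w\<in>?U. (\<lambda>n. sqdist B (s n) w) \<longlonglongrightarrow> 0"
    using w by blast
qed (simp_all add: bilinear B_nonneg B_sym)

text \<open>For a self-adjoint \<open>D\<close> the real operator \<open>D\<^sup>2 + b\<^sup>2\<close> equals \<open>(D + \<i> b) (D - \<i> b)\<close>. Once it is
  coercive, its form is an equivalent inner product, so it is surjective by the representation
  theorem. This avoids a complex version of the theorem.\<close>

lemma coercive_square_surj:
  assumes D: "\<And>u. u \<in> V \<Longrightarrow> D u \<in> V"
    and adj: "\<And>u v. u \<in> V \<Longrightarrow> v \<in> V \<Longrightarrow> B (D u) v = B u (D v)"
    and bound: "\<And>u. u \<in> V \<Longrightarrow> B (D u) (D u) \<le> C * B u u"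
    and coercive: "\<And>u. u \<in> V \<Longrightarrow> \<delta> * B u u \<le> B (D u) (D u) + b\<^sup>2 * B u u" "\<delta> > 0"
    and f: "f \<in> V"
  shows "\<exists>p\<in>V. \<forall>v\<in>V. B (D p) (D v) + b\<^sup>2 * B p v = B f v"
proof -
  define q where "q u v = B (D u) (D v) + b\<^sup>2 * B u v" for u v
  have "semi_inner V q"
  proof
    fix u v w c assume uvw: "u \<in> V" "v \<in> V" "w \<in> V"
    show "q (\<lambda>x. u x + v x) w = q u w + q v w"
      using uvw by (simp add: q_def adj D closed bilinear algebra_simps)
    show "q u v = q v u" using uvw D B_sym by (simp add: q_def)
  next
    fix u w c assume uw: "u \<in> V" "w \<in> V"
    show "q (\<lambda>x. c *\<^sub>R u x) w = c * q u w"
      using uw by (simp add: q_def adj D closed bilinear algebra_simps)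
  qed (use nonempty D B_nonneg in \<open>auto simp: closed q_def\<close>)
  then interpret Q: semi_hilbert V q
    using coercive bound by (intro equivalent_form[of q \<delta> "C + b\<^sup>2"]) (auto simp: q_def algebra_simps)
  have "\<exists>p\<in>V. \<forall>v\<in>V. q p v = B f v"
  proof (rule Q.riesz_representation[where C="nrm f / sqrt \<delta>"])
    fix v assume v: "v \<in> V"
    have "nrm v \<le> Q.nrm v / sqrt \<delta>"
      using real_sqrt_le_mono[OF coercive(1)[OF v]] coercive(2)
      by (simp add: nrm_def Q.nrm_def q_def real_sqrt_mult field_simps)
    then show "\<bar>B f v\<bar> \<le> nrm f / sqrt \<delta> * Q.nrm v"
      using cauchy_schwarz[OF f v] mult_left_mono[OF _ nrm_nonneg[OF f]] by fastforce
  qed (use f in \<open>auto simp: bilinear\<close>)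
  then show ?thesis by (simp add: q_def)
qed

text \<open>The two equations are the real and the imaginary part of \<open>(D + \<i> b) (h + \<i> k) = f + \<i> g\<close>, tested
  against all vectors.\<close>

lemma resolvent_solvable:
  assumes D: "\<And>u. u \<in> V \<Longrightarrow> D u \<in> V"
    and adj: "\<And>u v. u \<in> V \<Longrightarrow> v \<in> V \<Longrightarrow> B (D u) v = B u (D v)"
    and bound: "\<And>u. u \<in> V \<Longrightarrow> B (D u) (D u) \<le> C * B u u"
    and coercive: "\<And>u. u \<in> V \<Longrightarrow> \<delta> * B u u \<le> B (D u) (D u) + b\<^sup>2 * B u u" "\<delta> > 0"
    and f: "f \<in> V" "g \<in> V"
  shows "\<exists>h\<in>V. \<exists>k\<in>V. \<forall>v\<in>V. B (\<lambda>x. D h x - b *\<^sub>R k x) v = B f v \<and> B (\<lambda>x. D k x + b *\<^sub>R h x) v = B g v"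
proof -
  obtain p where p: "p \<in> V" "\<And>v. v \<in> V \<Longrightarrow> B (D p) (D v) + b\<^sup>2 * B p v = B f v"
    using coercive_square_surj[OF D adj bound coercive f(1)] by auto
  obtain r where r: "r \<in> V" "\<And>v. v \<in> V \<Longrightarrow> B (D r) (D v) + b\<^sup>2 * B r v = B g v"
    using coercive_square_surj[OF D adj bound coercive f(2)] by auto
  \<comment> \<open>\<open>h + \<i> k\<close> is \<open>D - \<i> b\<close> applied to \<open>p + \<i> r\<close>.\<close>
  define h where "h x = D p x + b *\<^sub>R r x" for x
  define k where "k x = D r x - b *\<^sub>R p x" for x
  have hk: "h \<in> V" "k \<in> V"
    unfolding h_def[abs_def] k_def[abs_def] using p r D by (auto intro!: closed)
  have Bh: "B h v = B (D p) v + b * B r v" and Bk: "B k v = B (D r) v - b * B p v" if "v \<in> V" for v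
    unfolding h_def[abs_def] k_def[abs_def] using p r D that by (auto simp: closed bilinear)
  have "B (\<lambda>x. D h x - b *\<^sub>R k x) v = B f v \<and> B (\<lambda>x. D k x + b *\<^sub>R h x) v = B g v" if v: "v \<in> V" for v
    using p(2)[OF v, symmetric] r(2)[OF v, symmetric] v hk p(1) r(1)
    by (simp add: bilinear closed D adj Bh Bk algebra_simps power2_eq_square)
  then show ?thesis using hk by blast
qed

end

section \<open>The space of square integrable functions\<close>

definition L2_inner :: "(real^'n::finite) set \<Rightarrow> (real^'n \<Rightarrow> 'b::euclidean_space) \<Rightarrow> (real^'n \<Rightarrow> 'b) \<Rightarrow> real" where
  "L2_inner \<Omega> u v = (LINT x|lebesgue_on \<Omega>. u x \<bullet> v x)"

lemma L2_measurable: "u \<in> L2 \<Omega> \<Longrightarrow> u \<in> borel_measurable (lebesgue_on \<Omega>)"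
  and L2_integrable_sq: "u \<in> L2 \<Omega> \<Longrightarrow> integrable (lebesgue_on \<Omega>) (\<lambda>x. (norm (u x))\<^sup>2)"
  by (auto simp: L2_def)

lemma L2_dominated:
  fixes u :: "real^'n::finite \<Rightarrow> 'b::euclidean_space" and g :: "real^'n \<Rightarrow> real"
  assumes "u \<in> borel_measurable (lebesgue_on \<Omega>)" "integrable (lebesgue_on \<Omega>) g"
    "AE x in lebesgue_on \<Omega>. (norm (u x))\<^sup>2 \<le> g x"
  shows "u \<in> L2 \<Omega>"
proof -
  have [measurable]: "u \<in> borel_measurable (lebesgue_on \<Omega>)" by fact
  have "AE x in lebesgue_on \<Omega>. norm ((norm (u x))\<^sup>2) \<le> norm (g x)"
    using assms(3) by eventually_elim auto
  then have "integrable (lebesgue_on \<Omega>) (\<lambda>x. (norm (u x))\<^sup>2)"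
    by (intro Bochner_Integration.integrable_bound[OF assms(2)]) auto
  then show ?thesis using assms(1) by (simp add: L2_def)
qed

lemma L2_add: "u \<in> L2 \<Omega> \<Longrightarrow> v \<in> L2 \<Omega> \<Longrightarrow> (\<lambda>x. u x + v x) \<in> L2 \<Omega>"
proof (rule L2_dominated[where g="\<lambda>x. 2 * (norm (u x))\<^sup>2 + 2 * (norm (v x))\<^sup>2"])
  have "(norm (a + b))\<^sup>2 \<le> 2 * (norm a)\<^sup>2 + 2 * (norm b)\<^sup>2" for a b :: 'b
  proof -
    have "0 \<le> (a - b) \<bullet> (a - b)" by simp
    then show ?thesis by (simp add: power2_norm_eq_inner inner_simps inner_commute)
  qed
  then show "AE x in lebesgue_on \<Omega>. (norm (u x + v x))\<^sup>2 \<le> 2 * (norm (u x))\<^sup>2 + 2 * (norm (v x))\<^sup>2"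
    by simp
qed (auto simp: L2_def)

lemma L2_scale: "u \<in> L2 \<Omega> \<Longrightarrow> (\<lambda>x. c *\<^sub>R u x) \<in> L2 \<Omega>"
  by (auto simp: L2_def power_mult_distrib)

lemma L2_inner_integrable:
  assumes "u \<in> L2 \<Omega>" "v \<in> L2 \<Omega>"
  shows "integrable (lebesgue_on \<Omega>) (\<lambda>x. u x \<bullet> v x)"
proof (rule Bochner_Integration.integrable_bound[where f="\<lambda>x. (norm (u x))\<^sup>2 + (norm (v x))\<^sup>2"])
  have "\<bar>a \<bullet> b\<bar> \<le> (norm a)\<^sup>2 + (norm b)\<^sup>2" for a b :: 'b
  proof -
    have "\<bar>a \<bullet> b\<bar> \<le> norm a * norm b" by (rule Cauchy_Schwarz_ineq2)
    also have "\<dots> \<le> (norm a)\<^sup>2 + (norm b)\<^sup>2"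
      using sum_squares_bound[of "norm a" "norm b"] mult_nonneg_nonneg[OF norm_ge_zero norm_ge_zero, of a b]
      unfolding mult.assoc by linarith
    finally show ?thesis .
  qed
  then show "AE x in lebesgue_on \<Omega>. norm (u x \<bullet> v x) \<le> norm ((norm (u x))\<^sup>2 + (norm (v x))\<^sup>2)"
    by simp
qed (use assms in \<open>auto simp: L2_def\<close>)

text \<open>Along a subsequence with \<open>\<parallel>s (r (k+1)) - s (r k)\<parallel>\<^sup>2 < 4\<^sup>-\<^sup>k\<close>, the weighted sum
  \<open>\<Sum>k. 2\<^sup>k |s (r (k+1)) x - s (r k) x|\<^sup>2\<close> has a finite integral. By \<open>|d| \<le> 2\<^sup>-\<^sup>k + 2\<^sup>k |d|\<^sup>2\<close> the
  subsequence then converges almost everywhere, and Fatou's lemma bounds the distance to its limit.\<close>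

lemma L2_complete:
  fixes s :: "nat \<Rightarrow> real^'n::finite \<Rightarrow> 'b::euclidean_space"
  assumes s: "\<And>n. s n \<in> L2 \<Omega>"
    and cauchy: "\<And>e. e > 0 \<Longrightarrow>
      \<exists>N::nat. \<forall>m\<ge>N. \<forall>n\<ge>N. sqdist (L2_inner \<Omega>) (s m) (s n) < e"
  shows "\<exists>w\<in>L2 \<Omega>. (\<lambda>n. sqdist (L2_inner \<Omega>) (s n) w) \<longlonglongrightarrow> 0"
proof -
  let ?M = "lebesgue_on \<Omega>"
  have [measurable]: "s n \<in> borel_measurable ?M" for n using s L2_measurable by blast
  have d: "(\<lambda>x. s m x - s n x) \<in> L2 \<Omega>" for m n
    using L2_add[OF s[of m] L2_scale[OF s[of n], of "-1"]] by simp
  have int: "(\<integral>\<^sup>+x. ennreal ((norm (s m x - s n x))\<^sup>2) \<partial>?M)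
      = ennreal (sqdist (L2_inner \<Omega>) (s m) (s n))" for m n
    using nn_integral_eq_integral[OF L2_integrable_sq[OF d[of m n]]]
    by (simp add: L2_inner_def dot_square_norm)
  have "\<exists>N. \<forall>m\<ge>N. \<forall>n\<ge>N. sqdist (L2_inner \<Omega>) (s m) (s n) < (1/4) ^ k" for k
    by (rule cauchy) simp
  then obtain N where N: "\<And>k m n. m \<ge> N k \<Longrightarrow> n \<ge> N k \<Longrightarrow>
      sqdist (L2_inner \<Omega>) (s m) (s n) < (1/4) ^ k" by metis
  define r where "r k = (\<Sum>j\<le>k. N j)" for k
  have rN: "r k \<ge> N j" if "j \<le> k" for j k
    unfolding r_def using that by (intro member_le_sum) auto
  define a where "a k x = 2 ^ k * (norm (s (r (Suc k)) x - s (r k) x))\<^sup>2" for k x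
  have [measurable]: "a k \<in> borel_measurable ?M" for k unfolding a_def by measurable
  have int_a: "(\<integral>\<^sup>+x. ennreal (a k x) \<partial>?M) \<le> ennreal ((1/2) ^ k)" for k
  proof -
    have "(\<integral>\<^sup>+x. ennreal (a k x) \<partial>?M) = ennreal (2 ^ k) * (\<integral>\<^sup>+x. ennreal ((norm (s (r (Suc k)) x - s (r k) x))\<^sup>2) \<partial>?M)"
      by (subst nn_integral_cmult[symmetric]) (auto simp: a_def ennreal_mult)
    also have "\<dots> = ennreal (2 ^ k * sqdist (L2_inner \<Omega>) (s (r (Suc k))) (s (r k)))"
      by (simp add: int ennreal_mult')
    also have "\<dots> \<le> ennreal (2 ^ k * (1/4) ^ k)"
      using N[of k "r (Suc k)" "r k"] rN[of k k] rN[of k "Suc k"]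
      by (intro ennreal_leI mult_left_mono) auto
    also have "2 ^ k * (1/4) ^ k = ((1/2) ^ k :: real)" by (simp flip: power_mult_distrib)
    finally show ?thesis .
  qed
  have "(\<integral>\<^sup>+x. (\<Sum>k. ennreal (a k x)) \<partial>?M) = (\<Sum>k. \<integral>\<^sup>+x. ennreal (a k x) \<partial>?M)"
    by (intro nn_integral_suminf) measurable
  also have "\<dots> \<le> (\<Sum>k. ennreal ((1/2) ^ k))" by (intro suminf_le int_a summableI)
  also have "(\<Sum>k. ennreal ((1/2) ^ k)) \<noteq> top"
    by (intro ennreal_suminf_neq_top summable_geometric) auto
  then have "(\<Sum>k. ennreal ((1/2) ^ k)) < \<infinity>" by (simp flip: less_top)
  finally have "AE x in ?M. (\<Sum>k. ennreal (a k x)) \<noteq> \<infinity>"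
    by (intro nn_integral_PInf_AE) auto
  then have conv: "AE x in ?M. convergent (\<lambda>k. s (r k) x)"
  proof eventually_elim
    case (elim x)
    have "summable (\<lambda>k. a k x)"
      using elim by (intro summable_suminf_not_top) (auto simp: a_def)
    then have "summable (\<lambda>k. (1/2) ^ k + a k x)" by (intro summable_add summable_geometric) auto
    moreover have "norm (s (r (Suc k)) x - s (r k) x) \<le> (1/2) ^ k + a k x" for k
    proof -
      define t y where "t = (2::real) ^ k" and "y = norm (s (r (Suc k)) x - s (r k) x)"
      have t: "t > 0" "(1/2) ^ k = 1 / t" by (auto simp: t_def power_divide)
      have "0 \<le> (1 - t * y)\<^sup>2 + t * y" using t by (simp add: y_def)
      then have "t * y \<le> 1 + t * (t * y\<^sup>2)" by (simp add: power2_eq_square algebra_simps)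
      then have "y \<le> 1 / t + t * y\<^sup>2" using t by (simp add: field_simps)
      then show ?thesis by (simp add: a_def y_def t t_def)
    qed
    ultimately have "summable (\<lambda>k. s (r (Suc k)) x - s (r k) x)"
      by (rule summable_comparison_test'[where N=0])
    then have "convergent (\<lambda>n. \<Sum>k<n. s (r (Suc k)) x - s (r k) x)"
      by (simp add: summable_iff_convergent)
    then have "convergent (\<lambda>n. (\<Sum>k<n. s (r (Suc k)) x - s (r k) x) + s (r 0) x)"
      by (intro convergent_add convergent_const)
    then show ?case 
      using sum_lessThan_telescope[of "\<lambda>k. s (r k) x"] by simp
  qed
  define w where "w x = lim (\<lambda>k. s (r k) x)" for x
  have [measurable]: "w \<in> borel_measurable ?M" unfolding w_def by measurable
  have fatou: "(\<integral>\<^sup>+x. ennreal ((norm (s n x - w x))\<^sup>2) \<partial>?M) \<le> ennreal ((1/4) ^ j)" if n: "n \<ge> N j" for n j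
  proof -
    have "AE x in ?M. ennreal ((norm (s n x - w x))\<^sup>2) = liminf (\<lambda>k. ennreal ((norm (s n x - s (r k) x))\<^sup>2))"
      using conv
    proof eventually_elim
      case (elim x)
      then have "(\<lambda>k. s (r k) x) \<longlonglongrightarrow> w x" by (simp add: w_def convergent_LIMSEQ_iff)
      then have "(\<lambda>k. ennreal ((norm (s n x - s (r k) x))\<^sup>2)) \<longlonglongrightarrow> ennreal ((norm (s n x - w x))\<^sup>2)"
        by (intro tendsto_intros)
      then show ?case by (intro lim_imp_Liminf[symmetric]) auto
    qed
    then have "(\<integral>\<^sup>+x. ennreal ((norm (s n x - w x))\<^sup>2) \<partial>?M)
        = (\<integral>\<^sup>+x. liminf (\<lambda>k. ennreal ((norm (s n x - s (r k) x))\<^sup>2)) \<partial>?M)"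
      by (rule nn_integral_cong_AE)
    also have "\<dots> \<le> liminf (\<lambda>k. \<integral>\<^sup>+x. ennreal ((norm (s n x - s (r k) x))\<^sup>2) \<partial>?M)"
      by (rule nn_integral_liminf) measurable
    also have "\<dots> \<le> ennreal ((1/4) ^ j)"
    proof (rule Liminf_le)
      show "\<forall>\<^sub>F k in sequentially. (\<integral>\<^sup>+x. ennreal ((norm (s n x - s (r k) x))\<^sup>2) \<partial>?M) \<le> ennreal ((1/4) ^ j)"
        unfolding int using eventually_ge_at_top[of j]
        by eventually_elim (use N n rN in \<open>auto intro!: ennreal_leI less_imp_le\<close>)
    qed simp
    finally show ?thesis .
  qed
  have diff: "(\<lambda>x. s n x - w x) \<in> L2 \<Omega>" if "n \<ge> N 0" for n
  proof -
    have "integrable ?M (\<lambda>x. (norm (s n x - w x))\<^sup>2)"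
      using fatou[OF that] by (intro integrableI_nonneg) (auto intro: le_less_trans)
    then show ?thesis by (simp add: L2_def)
  qed
  have wL2: "w \<in> L2 \<Omega>"
    using L2_add[OF s[of "N 0"] L2_scale[OF diff[of "N 0"], of "-1"]] by simp
  have diff: "(\<lambda>x. s n x - w x) \<in> L2 \<Omega>" for n
    using L2_add[OF s[of n] L2_scale[OF wL2, of "-1"]] by simp
  have "(\<lambda>n. sqdist (L2_inner \<Omega>) (s n) w) \<longlonglongrightarrow> 0"
  proof (rule LIMSEQ_I)
    fix e :: real assume "e > 0"
    then obtain j where j: "(1/4) ^ j < e" using real_arch_pow_inv[of e "1/4"] by auto
    have "norm (sqdist (L2_inner \<Omega>) (s n) w - 0) < e" if "n \<ge> N j" for n
    proof -
      have "ennreal (sqdist (L2_inner \<Omega>) (s n) w) \<le> ennreal ((1/4) ^ j)"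
        using fatou[OF that] nn_integral_eq_integral[OF L2_integrable_sq[OF diff[of n]]]
        by (simp add: L2_inner_def dot_square_norm)
      then have "sqdist (L2_inner \<Omega>) (s n) w \<le> (1/4) ^ j" by simp
      moreover have "sqdist (L2_inner \<Omega>) (s n) w \<ge> 0" by (simp add: L2_inner_def)
      ultimately show ?thesis using j by simp
    qed
    then show "\<exists>n0. \<forall>n\<ge>n0. norm (sqdist (L2_inner \<Omega>) (s n) w - 0) < e" by blast
  qed
  then show ?thesis using wL2 by blast
qed

interpretation L2: semi_hilbert "L2 \<Omega>" "L2_inner \<Omega>"
  for \<Omega> :: "(real^'n::finite) set"
proof
  fix u v w :: "real^'n \<Rightarrow> 'b::euclidean_space" and c
  assume u: "u \<in> L2 \<Omega>" and w: "w \<in> L2 \<Omega>"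
  show "(\<lambda>x. c *\<^sub>R u x) \<in> L2 \<Omega>" using u by (rule L2_scale)
  show "L2_inner \<Omega> (\<lambda>x. c *\<^sub>R u x) w = c * L2_inner \<Omega> u w"
    by (simp add: L2_inner_def)
  show "L2_inner \<Omega> u w = L2_inner \<Omega> w u" by (simp add: L2_inner_def inner_commute)
  show "L2_inner \<Omega> u u \<ge> 0" by (simp add: L2_inner_def)
  assume v: "v \<in> L2 \<Omega>"
  show "(\<lambda>x. u x + v x) \<in> L2 \<Omega>" using u v by (rule L2_add)
  show "L2_inner \<Omega> (\<lambda>x. u x + v x) w = L2_inner \<Omega> u w + L2_inner \<Omega> v w"
    using L2_inner_integrable[OF u w] L2_inner_integrable[OF v w]
    by (simp add: L2_inner_def inner_add_left)
next
  have "(\<lambda>x. 0) \<in> L2 \<Omega>" by (simp add: L2_def)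
  then show "L2 \<Omega> \<noteq> ({} :: (real^'n \<Rightarrow> 'b::euclidean_space) set)" by blast
qed (rule L2_complete)

section \<open>Integration by parts and uniqueness of weak gradients\<close>

lemma test_bounded:
  assumes "\<phi> \<in> test_functions \<Omega>"
  shows "\<exists>C>0. \<forall>x. \<bar>\<phi> x\<bar> \<le> C"
proof -
  obtain S where S: "smooth \<phi>" "compact S" "\<And>x. \<phi> x \<noteq> 0 \<Longrightarrow> x \<in> S"
    using assms by (rule test_functionsE) blast
  have "bounded (\<phi> ` S)"
    by (intro compact_imp_bounded compact_continuous_image smooth_continuous_on S)
  then obtain C where "C > 0" "\<And>x. x \<in> S \<Longrightarrow> \<bar>\<phi> x\<bar> \<le> C"
    by (auto simp: bounded_pos)
  then show ?thesis using S(3) by (metis abs_zero less_imp_le)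
qed

lemma test_borel [measurable]: "\<phi> \<in> test_functions \<Omega> \<Longrightarrow> \<phi> \<in> borel_measurable borel"
  by (intro borel_measurable_continuous_onI smooth_continuous_on test_smooth)

lemma test_integrable_lborel:
  assumes "\<phi> \<in> test_functions \<Omega>"
  shows "integrable lborel \<phi>"
proof -
  obtain S where S: "smooth \<phi>" "compact S" "\<And>x. \<phi> x \<noteq> 0 \<Longrightarrow> x \<in> S"
    using assms by (rule test_functionsE) blast
  have "(\<lambda>x. indicator S x *\<^sub>R \<phi> x) = \<phi>"
    using S(3) by (auto simp: fun_eq_iff indicator_def)
  then show ?thesis
    using borel_integrable_compact[OF S(2) smooth_continuous_on[OF S(1)]] by simp
qed

text \<open>Test functions vanish off \<open>\<Omega>\<close>, so their integrals can be computed over the whole space,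
  where translations are available.\<close>

lemma test_integral_lborel:
  assumes "open \<Omega>" "\<phi> \<in> test_functions \<Omega>"
  shows "integrable (lebesgue_on \<Omega>) \<phi>" "(LINT x|lebesgue_on \<Omega>. \<phi> x) = (LINT x|lborel. \<phi> x)"
proof -
  have \<Omega>: "\<Omega> \<in> sets lebesgue" using assms(1) by auto
  have eq: "(\<lambda>x. if x \<in> \<Omega> then \<phi> x else 0) = \<phi>" using test_outside[OF assms(2)] by auto
  have meas: "\<phi> \<in> borel_measurable lborel" using assms(2) by simp
  show "integrable (lebesgue_on \<Omega>) \<phi>"
    using test_integrable_lborel[OF assms(2)] integrable_completion[OF meas]
      Lebesgue_Measure.integrable_restrict_UNIV[OF \<Omega>, of \<phi>] eq by simp
  show "(LINT x|lebesgue_on \<Omega>. \<phi> x) = (LINT x|lborel. \<phi> x)"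
    using Lebesgue_Measure.integral_restrict_UNIV[OF \<Omega>, of \<phi>] eq integral_completion[OF meas] by simp
qed

lemma has_real_derivative_along_axis:
  assumes "smooth f"
  shows "((\<lambda>t. f (x + t *\<^sub>R axis i 1)) has_real_derivative partial_deriv i f (x + t *\<^sub>R axis i 1)) (at t)"
proof -
  define y where "y = x + t *\<^sub>R axis i 1"
  have "((\<lambda>t. x + t *\<^sub>R axis i 1) has_derivative (\<lambda>h. h *\<^sub>R axis i 1)) (at t)"
    by (auto intro!: derivative_eq_intros)
  from has_derivative_compose[OF this, of f "frechet_derivative f (at y)"]
  have "((\<lambda>t. f (x + t *\<^sub>R axis i 1)) has_derivative (\<lambda>h. frechet_derivative f (at y) (h *\<^sub>R axis i 1))) (at t)"
    using has_derivative_frechet[OF smooth_differentiable[OF assms], of y] by (simp add: y_def)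
  moreover have "frechet_derivative f (at y) (h *\<^sub>R axis i 1) = partial_deriv i f y * h" for h
    using linear_cmul[OF has_derivative_linear[OF has_derivative_frechet[OF smooth_differentiable[OF assms], of y]],
        of h "axis i 1"]
    by (simp add: partial_deriv_def mult.commute)
  ultimately show ?thesis by (simp add: has_field_derivative_def y_def mult_commute_abs)
qed

text \<open>The difference quotients in direction \<open>i\<close> have integral zero by translation invariance, and
  they converge boundedly to the partial derivative on a fixed bounded set.\<close>

lemma integral_partial_deriv_test:
  assumes \<phi>: "\<phi> \<in> test_functions \<Omega>"
  shows "(LINT x|lborel. partial_deriv i \<phi> x) = 0"
proof -
  define e :: "real^'a" where "e = axis i 1"
  define D where "D n x = real (Suc n) * (\<phi> (inverse (real (Suc n)) *\<^sub>R e + x) - \<phi> x)" for n x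
  have sm: "smooth \<phi>" using \<phi> by (rule test_smooth)
  have [measurable]: "\<phi> \<in> borel_measurable borel" "partial_deriv i \<phi> \<in> borel_measurable borel"
    using \<phi> test_partial_deriv[OF \<phi>] by auto
  obtain S where S: "compact S" "\<And>x. \<phi> x \<noteq> 0 \<Longrightarrow> x \<in> S" using \<phi> by (rule test_functionsE) blast
  obtain R where R: "R > 0" "\<And>x. x \<in> S \<Longrightarrow> norm x \<le> R"
    using compact_imp_bounded[OF S(1)] by (auto simp: bounded_pos)
  obtain C where C: "C > 0" "\<And>x. \<bar>partial_deriv i \<phi> x\<bar> \<le> C"
    using test_bounded[OF test_partial_deriv[OF \<phi>]] by auto
  have bound: "\<bar>D n x\<bar> \<le> C * indicator (cball 0 (R + 1)) x" for n x
  proof (cases "x \<in> cball 0 (R + 1)")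
    case True
    define h where "h = inverse (real (Suc n))"
    have h: "h > 0" "real (Suc n) * h = 1" by (simp_all add: h_def del: of_nat_Suc)
    obtain z where "\<phi> (x + h *\<^sub>R e) - \<phi> (x + 0 *\<^sub>R e) = (h - 0) * partial_deriv i \<phi> (x + z *\<^sub>R e)"
      using MVT2[OF h(1), of "\<lambda>t. \<phi> (x + t *\<^sub>R e)" "\<lambda>t. partial_deriv i \<phi> (x + t *\<^sub>R e)"]
        has_real_derivative_along_axis[OF sm, of x i] unfolding e_def by blast
    then have "D n x = (real (Suc n) * h) * partial_deriv i \<phi> (x + z *\<^sub>R e)"
      unfolding D_def h_def[symmetric] by (simp add: add.commute del: of_nat_Suc)
    then show ?thesis using C(2) True h(2) by simp
  next
    case False
    have "norm (inverse (real (Suc n)) *\<^sub>R e) \<le> 1"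
      by (simp add: e_def norm_axis_1 inverse_le_1_iff)
    then have "norm x \<le> norm (inverse (real (Suc n)) *\<^sub>R e + x) + 1"
      using norm_triangle_ineq4[of "inverse (real (Suc n)) *\<^sub>R e + x" "inverse (real (Suc n)) *\<^sub>R e"] by simp
    then have "\<phi> x = 0" "\<phi> (inverse (real (Suc n)) *\<^sub>R e + x) = 0"
      using False R S(2) by (force simp del: of_nat_Suc)+
    then show ?thesis using C(1) by (simp add: D_def)
  qed
  have "(\<lambda>n. LINT x|lborel. D n x) \<longlonglongrightarrow> (LINT x|lborel. partial_deriv i \<phi> x)"
  proof (rule integral_dominated_convergence[where w="\<lambda>x. C * indicator (cball 0 (R + 1)) x"])
    have "integrable lborel (indicator (cball 0 (R + 1)) :: real^'a \<Rightarrow> real)"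
      using emeasure_bounded_finite[of "cball 0 (R + 1)"] by (intro integrable_real_indicator) auto
    then show "integrable lborel (\<lambda>x::real^'a. C * indicator (cball 0 (R + 1)) x)" by simp
    show "D n \<in> borel_measurable lborel" for n unfolding D_def by measurable
    show "AE x in lborel. (\<lambda>n. D n x) \<longlonglongrightarrow> partial_deriv i \<phi> x"
    proof (rule AE_I2)
      fix x
      have "((\<lambda>h. (\<phi> (x + (0 + h) *\<^sub>R e) - \<phi> (x + 0 *\<^sub>R e)) / h) \<longlongrightarrow> partial_deriv i \<phi> (x + 0 *\<^sub>R e)) (at 0)"
        using has_real_derivative_along_axis[OF sm, of x i 0] unfolding DERIV_def e_def .
      moreover have "filterlim (\<lambda>n. inverse (real (Suc n))) (at 0) sequentially"
        unfolding filterlim_at using LIMSEQ_inverse_real_of_nat by simp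
      ultimately have "(\<lambda>n. (\<phi> (x + (0 + inverse (real (Suc n))) *\<^sub>R e) - \<phi> (x + 0 *\<^sub>R e)) / inverse (real (Suc n)))
          \<longlonglongrightarrow> partial_deriv i \<phi> (x + 0 *\<^sub>R e)"
        by (rule filterlim_compose)
      then show "(\<lambda>n. D n x) \<longlonglongrightarrow> partial_deriv i \<phi> x"
        by (simp add: D_def divide_inverse mult.commute add.commute del: of_nat_Suc)
    qed
  qed (use bound in auto)
  moreover have "(LINT x|lborel. D n x) = 0" for n
  proof -
    have "(LINT x|lborel. \<phi> (c + x)) = (LINT x|lborel. \<phi> x)" and "integrable lborel (\<lambda>x. \<phi> (c + x))" for c
    proof -
      show "(LINT x|lborel. \<phi> (c + x)) = (LINT x|lborel. \<phi> x)"
        by (subst (2) lborel_distr_plus[of c, symmetric], subst integral_distr) auto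
      have "integrable (distr lborel borel ((+) c)) \<phi>"
        using test_integrable_lborel[OF \<phi>] by (simp add: lborel_distr_plus)
      then show "integrable lborel (\<lambda>x. \<phi> (c + x))" by (subst (asm) integrable_distr_eq) auto
    qed
    then show ?thesis using test_integrable_lborel[OF \<phi>] by (simp add: D_def)
  qed
  ultimately show ?thesis by (simp add: LIMSEQ_const_iff)
qed

lemma integral_partial_deriv_test_on:
  "open \<Omega> \<Longrightarrow> \<phi> \<in> test_functions \<Omega> \<Longrightarrow> (LINT x|lebesgue_on \<Omega>. partial_deriv i \<phi> x) = 0"
  by (simp add: test_integral_lborel(2) test_partial_deriv integral_partial_deriv_test)

lemma test_L2: "open \<Omega> \<Longrightarrow> \<phi> \<in> test_functions \<Omega> \<Longrightarrow> \<phi> \<in> L2 \<Omega>"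
  using test_integral_lborel(1)[of \<Omega> "\<lambda>x. \<phi> x * \<phi> x"] test_integral_lborel(1)[of \<Omega> \<phi>]
    test_mult_smooth[OF _ test_smooth]
  by (auto simp: L2_def power2_eq_square)

text \<open>At almost every point of an open set, the function is the limit of its means over small
  cubes, and the indicator function of a cube is a bounded limit of test functions.\<close>

lemma fundamental_lemma:
  fixes g :: "real^'n::finite \<Rightarrow> real"
  assumes \<Omega>: "open \<Omega>" and g: "g \<in> L2 \<Omega>"
    and zero: "\<And>\<phi>. \<phi> \<in> test_functions \<Omega> \<Longrightarrow> (LINT x|lebesgue_on \<Omega>. g x * \<phi> x) = 0"
  shows "AE x in lebesgue_on \<Omega>. g x = 0"
proof -
  have \<Omega>s: "\<Omega> \<in> sets lebesgue" using \<Omega> by auto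
  define h where "h x = (if x \<in> \<Omega> then g x else 0)" for x
  have hm: "h \<in> borel_measurable lebesgue"
    unfolding h_def using L2_measurable[OF g] \<Omega>s by (rule borel_measurable_if_I)
  have h2: "integrable lebesgue (\<lambda>x. (h x)\<^sup>2)"
  proof -
    have "(\<lambda>x. (h x)\<^sup>2) = (\<lambda>x. if x \<in> \<Omega> then (g x)\<^sup>2 else 0)" by (auto simp: h_def)
    then show ?thesis
      using Lebesgue_Measure.integrable_restrict_UNIV[OF \<Omega>s, of "\<lambda>x. (g x)\<^sup>2"] L2_integrable_sq[OF g]
      by simp
  qed
  have int_box: "integrable (lebesgue_on (cbox a b)) h" for a b
  proof (rule Bochner_Integration.integrable_bound[where f="\<lambda>x. 1 + (h x)\<^sup>2"])
    have "integrable (lebesgue_on (cbox a b)) (\<lambda>x. (h x)\<^sup>2)"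
      using h2 by (intro integrable_restrict_space[THEN iffD2] integrable_mult_indicator[of _ _ "\<lambda>x. (h x)\<^sup>2"]) auto
    moreover have "integrable (lebesgue_on (cbox a b)) (\<lambda>x. 1::real)"
      using finite_measure.integrable_const[OF finite_measure_lebesgue_on[OF lmeasurable_cbox]] .
    ultimately show "integrable (lebesgue_on (cbox a b)) (\<lambda>x. 1 + (h x)\<^sup>2)" by simp
    show "h \<in> borel_measurable (lebesgue_on (cbox a b))" using hm by (simp add: measurable_restrict_space1)
    have "\<bar>t\<bar> \<le> 1 + t\<^sup>2" for t :: real
      using zero_le_power2[of "\<bar>t\<bar> - 1"] by (simp add: power2_diff)
    then show "AE x in lebesgue_on (cbox a b). norm (h x) \<le> norm (1 + (h x)\<^sup>2)" by simp
  qed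
  have zero_box: "integral (cbox a b) h = 0" if sub: "cbox a b \<subseteq> \<Omega>" for a b
  proof -
    define \<phi> where "\<phi> n x = 1 - exp (- (real n * box_bump a b x))" for n x
    have range: "0 \<le> \<phi> n x \<and> \<phi> n x \<le> indicator (cbox a b) x" for n x
      using box_bump_nonneg[of a b x] box_bump_eq_0_iff[of a b x] box_subset_cbox[of a b]
      by (cases "x \<in> cbox a b") (auto simp: \<phi>_def)
    have [measurable]: "g \<in> borel_measurable (lebesgue_on \<Omega>)" using g by (rule L2_measurable)
    have \<phi>t: "\<phi> n \<in> test_functions \<Omega>" for n unfolding \<phi>_def using sub by (rule test_box_indicator_approx)
    have "(\<lambda>n. LINT x|lebesgue_on \<Omega>. g x * \<phi> n x) \<longlonglongrightarrow> (LINT x|lebesgue_on \<Omega>. g x * indicator (box a b) x)"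
    proof (rule integral_dominated_convergence[where w="\<lambda>x. \<bar>h x * indicator (cbox a b) x\<bar>"])
      show "(\<lambda>x. g x * indicator (box a b) x) \<in> borel_measurable (lebesgue_on \<Omega>)"
        using sub box_subset_cbox[of a b] \<Omega>s
        by (intro borel_measurable_times borel_measurable_indicator) (auto simp: sets_restrict_space_iff)
      show "(\<lambda>x. g x * \<phi> n x) \<in> borel_measurable (lebesgue_on \<Omega>)" for n
        using test_integral_lborel(1)[OF \<Omega> \<phi>t, of n] by (intro borel_measurable_times) auto
      have "integrable lebesgue (\<lambda>x. h x * indicator (cbox a b) x)"
        using int_box[of a b] by (simp add: integrable_restrict_space mult.commute)
      then show "integrable (lebesgue_on \<Omega>) (\<lambda>x. \<bar>h x * indicator (cbox a b) x\<bar>)"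
        using \<Omega>s integrable_mult_indicator[OF \<Omega>s, of "\<lambda>x. h x * indicator (cbox a b) x"]
        by (intro integrable_abs) (simp add: integrable_restrict_space)
      show "AE x in lebesgue_on \<Omega>. (\<lambda>n. g x * \<phi> n x) \<longlonglongrightarrow> g x * indicator (box a b) x"
      proof (intro AE_I2 tendsto_intros)
        fix x
        show "(\<lambda>n. \<phi> n x) \<longlonglongrightarrow> indicator (box a b) x"
        proof (cases "x \<in> box a b")
          case True
          then have "box_bump a b x > 0" by (simp add: box_bump_pos_iff)
          then have "filterlim (\<lambda>n. - (real n * box_bump a b x)) at_bot sequentially"
            by (intro filterlim_uminus_at_bot_at_top[THEN filterlim_compose]
                filterlim_at_top_mult_tendsto_pos[OF tendsto_const] filterlim_real_sequentially)
          then have "(\<lambda>n. exp (- (real n * box_bump a b x))) \<longlonglongrightarrow> 0"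
            by (rule filterlim_compose[OF exp_at_bot])
          then have "(\<lambda>n. \<phi> n x) \<longlonglongrightarrow> 1 - 0" unfolding \<phi>_def by (intro tendsto_intros)
          then show ?thesis using True by simp
        next
          case False
          then show ?thesis by (simp add: \<phi>_def box_bump_eq_0_iff[THEN iffD2])
        qed
      qed
      show "AE x in lebesgue_on \<Omega>. norm (g x * \<phi> n x) \<le> \<bar>h x * indicator (cbox a b) x\<bar>" for n
      proof (rule AE_I2)
        fix x assume "x \<in> space (lebesgue_on \<Omega>)"
        then have "h x = g x" by (simp add: h_def)
        then show "norm (g x * \<phi> n x) \<le> \<bar>h x * indicator (cbox a b) x\<bar>"
          using range[of n x] by (simp add: abs_mult mult_left_mono)
      qed
    qed
    then have "(LINT x|lebesgue_on \<Omega>. g x * indicator (box a b) x) = 0"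
      using zero[OF \<phi>t] by (simp add: LIMSEQ_const_iff)
    moreover have "(\<lambda>x. if x \<in> \<Omega> then g x * indicator (box a b) x else 0)
        = (\<lambda>x. if x \<in> cbox a b then h x * indicator (box a b) x else 0)"
      using sub box_subset_cbox[of a b] by (auto simp: h_def fun_eq_iff indicator_def)
    ultimately have "(LINT x|lebesgue_on (cbox a b). h x * indicator (box a b) x) = 0"
      using Lebesgue_Measure.integral_restrict_UNIV[OF \<Omega>s, of "\<lambda>x. g x * indicator (box a b) x"]
        Lebesgue_Measure.integral_restrict_UNIV[of "cbox a b" "\<lambda>x. h x * indicator (box a b) x"] by simp
    moreover have "(LINT x|lebesgue_on (cbox a b). h x * indicator (box a b) x) = integral (cbox a b) (\<lambda>x. h x * indicator (box a b) x)"
      using int_box[of a b] box_subset_cbox[of a b]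
      by (intro lebesgue_integral_eq_integral integrable_real_mult_indicator) (simp_all add: sets_restrict_space_iff)
    moreover have "integral (cbox a b) (\<lambda>x. h x * indicator (box a b) x) = integral (cbox a b) h"
      unfolding integral_open_interval[symmetric, of a b] by (rule Henstock_Kurzweil_Integration.integral_cong) simp
    ultimately show ?thesis by simp
  qed
  have "h integrable_on cbox a b" for a b using int_box by (rule integrable_on_lebesgue_on) simp
  then obtain N where N: "negligible N" "\<And>x e. x \<notin> N \<Longrightarrow> 0 < e \<Longrightarrow> \<exists>d>0. \<forall>t. 0 < t \<and> t < d \<longrightarrow>
      norm (integral (cbox x (x + t *\<^sub>R One)) h /\<^sub>R t ^ DIM(real^'n) - h x) < e"
    by (rule integrable_ccontinuous_explicit) blast
  have "g x = 0" if x: "x \<in> \<Omega>" "x \<notin> N" for x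
  proof (rule ccontr)
    assume "g x \<noteq> 0"
    then obtain d where d: "d > 0" "\<And>t. 0 < t \<Longrightarrow> t < d \<Longrightarrow>
        norm (integral (cbox x (x + t *\<^sub>R One)) h /\<^sub>R t ^ DIM(real^'n) - h x) < \<bar>g x\<bar>"
      using N(2)[OF x(2), of "\<bar>g x\<bar>"] by auto
    obtain r where r: "r > 0" "ball x r \<subseteq> \<Omega>" using \<Omega> x(1) openE by blast
    define t where "t = min (d / 2) (r / (2 * DIM(real^'n)))"
    have t: "0 < t" "t < d" "t * DIM(real^'n) < r" using d(1) r(1) by (auto simp: t_def min_def field_simps)
    have "cbox x (x + t *\<^sub>R One) \<subseteq> \<Omega>"
    proof
      fix y assume y: "y \<in> cbox x (x + t *\<^sub>R One)"
      have "norm (y - x) \<le> (\<Sum>b\<in>Basis. \<bar>(y - x) \<bullet> b\<bar>)" by (rule norm_le_l1)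
      also have "\<dots> \<le> (\<Sum>b\<in>(Basis :: (real^'n) set). t)"
        using y by (intro sum_mono) (auto simp: mem_box inner_simps abs_le_iff)
      also have "\<dots> < r" using t(3) by (simp add: mult.commute)
      finally show "y \<in> \<Omega>" using r(2) by (auto simp: dist_norm norm_minus_commute)
    qed
    then show False using d(2)[OF t(1,2)] zero_box x(1) by (simp add: h_def)
  qed
  moreover have "AE x in lebesgue. x \<notin> N"
    using N(1) by (simp add: negligible_iff_null_sets AE_not_in)
  ultimately show ?thesis
    using \<Omega>s by (subst AE_restrict_space_iff) (auto elim: eventually_mono)
qed

section \<open>The Sobolev spaces as Hilbert spaces\<close>

lemma L2_component:
  fixes g :: "real^'n::finite \<Rightarrow> real^'m::finite"
  shows "g \<in> L2 \<Omega> \<Longrightarrow> (\<lambda>x. g x $ i) \<in> L2 \<Omega>"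
proof (rule L2_dominated[OF _ L2_integrable_sq])
  assume g: "g \<in> L2 \<Omega>"
  have "(\<lambda>x. g x \<bullet> axis i 1) \<in> borel_measurable (lebesgue_on \<Omega>)"
    using L2_measurable[OF g] by simp
  then show "(\<lambda>x. g x $ i) \<in> borel_measurable (lebesgue_on \<Omega>)" by (simp add: inner_axis)
  show "AE x in lebesgue_on \<Omega>. (norm (g x $ i))\<^sup>2 \<le> (norm (g x))\<^sup>2"
    by (intro AE_I2 power_mono) (simp_all add: component_le_norm_cart)
qed

lemma L2_inner_cong_AE:
  "\<lbrakk>u \<in> L2 \<Omega>; u' \<in> L2 \<Omega>; v \<in> L2 \<Omega>; v' \<in> L2 \<Omega>; AE x in lebesgue_on \<Omega>. u x = u' x;
    AE x in lebesgue_on \<Omega>. v x = v' x\<rbrakk> \<Longrightarrow> L2_inner \<Omega> u v = L2_inner \<Omega> u' v'"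
  unfolding L2_inner_def
  using L2_inner_integrable[of u \<Omega> v] L2_inner_integrable[of u' \<Omega> v']
  by (intro integral_cong_AE) (auto elim: eventually_elim2 dest: borel_measurable_integrable)

lemma L2_null_AE:
  assumes "u \<in> L2 \<Omega>" "L2_inner \<Omega> u u = 0"
  shows "AE x in lebesgue_on \<Omega>. u x = 0"
  using integral_nonneg_eq_0_iff_AE[OF L2_integrable_sq[OF assms(1)]] assms(2)
  by (simp add: L2_inner_def dot_square_norm)

definition classical_grad :: "(real^'n::finite \<Rightarrow> real) \<Rightarrow> real^'n \<Rightarrow> real^'n" where
  "classical_grad \<phi> x = (\<chi> i. partial_deriv i \<phi> x)"

lemma weak_gradient_iff:
  "weak_gradient \<Omega> u g \<longleftrightarrow> (\<forall>\<phi>\<in>test_functions \<Omega>. \<forall>i.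
      L2_inner \<Omega> u (partial_deriv i \<phi>) = - L2_inner \<Omega> (\<lambda>x. g x $ i) \<phi>)"
  by (simp add: weak_gradient_def L2_inner_def)

context
  fixes \<Omega> :: "(real^'n::finite) set"
  assumes \<Omega>: "open \<Omega>"
begin

lemma classical_grad_L2:
  assumes "\<phi> \<in> test_functions \<Omega>"
  shows "classical_grad \<phi> \<in> L2 \<Omega>"
proof -
  have [measurable]: "partial_deriv i \<phi> \<in> borel_measurable (lebesgue_on \<Omega>)" for i
    using L2_measurable[OF test_L2[OF \<Omega> test_partial_deriv[OF assms]]] .
  have "classical_grad \<phi> = (\<lambda>x. \<Sum>i\<in>UNIV. partial_deriv i \<phi> x *\<^sub>R axis i 1)"
    by (simp add: fun_eq_iff classical_grad_def vec_eq_iff axis_def if_distrib cong: if_cong)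
  then have meas: "classical_grad \<phi> \<in> borel_measurable (lebesgue_on \<Omega>)" by simp
  have "(norm (classical_grad \<phi> x))\<^sup>2 = (\<Sum>i\<in>UNIV. (partial_deriv i \<phi> x)\<^sup>2)" for x
    unfolding power2_norm_eq_inner inner_vec_def classical_grad_def by (simp add: power2_eq_square)
  moreover have "integrable (lebesgue_on \<Omega>) (\<lambda>x. \<Sum>i\<in>UNIV. (partial_deriv i \<phi> x)\<^sup>2)"
    using L2_integrable_sq[OF test_L2[OF \<Omega> test_partial_deriv[OF assms]]] by simp
  ultimately show ?thesis using meas by (simp add: L2_def)
qed

lemma weak_gradient_test:
  assumes \<phi>: "\<phi> \<in> test_functions \<Omega>"
  shows "weak_gradient \<Omega> \<phi> (classical_grad \<phi>)"
  unfolding weak_gradient_iff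
proof (intro ballI allI)
  fix \<psi> i assume \<psi>: "\<psi> \<in> test_functions \<Omega>"
  have "(LINT x|lebesgue_on \<Omega>. \<phi> x * partial_deriv i \<psi> x + partial_deriv i \<phi> x * \<psi> x) = 0"
    using integral_partial_deriv_test_on[OF \<Omega> test_mult_smooth[OF \<phi> test_smooth[OF \<psi>]], of i]
      partial_deriv_mult[OF smooth_differentiable[OF test_smooth[OF \<phi>]] smooth_differentiable[OF test_smooth[OF \<psi>]]]
    by simp
  moreover have "integrable (lebesgue_on \<Omega>) (\<lambda>x. \<phi> x * partial_deriv i \<psi> x)"
    "integrable (lebesgue_on \<Omega>) (\<lambda>x. partial_deriv i \<phi> x * \<psi> x)"
    using L2_inner_integrable[OF test_L2[OF \<Omega> \<phi>] test_L2[OF \<Omega> test_partial_deriv[OF \<psi>]]]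
      L2_inner_integrable[OF test_L2[OF \<Omega> test_partial_deriv[OF \<phi>]] test_L2[OF \<Omega> \<psi>]] by simp_all
  ultimately show "L2_inner \<Omega> \<phi> (partial_deriv i \<psi>) = - L2_inner \<Omega> (\<lambda>x. classical_grad \<phi> x $ i) \<psi>"
    by (simp add: L2_inner_def classical_grad_def)
qed

text \<open>The function \<open>grad\<close> chooses one weak gradient. Uniqueness makes this choice additive and
  homogeneous up to null sets.\<close>

lemma weak_gradient_unique:
  assumes g: "g \<in> L2 \<Omega>" "weak_gradient \<Omega> u g" and h: "h \<in> L2 \<Omega>" "weak_gradient \<Omega> u h"
  shows "AE x in lebesgue_on \<Omega>. g x = h x"
proof -
  have "AE x in lebesgue_on \<Omega>. g x $ i - h x $ i = 0" for i
  proof (rule fundamental_lemma[OF \<Omega>])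
    show "(\<lambda>x. g x $ i - h x $ i) \<in> L2 \<Omega>"
      by (intro L2.diff_closed L2_component g h)
    fix \<phi> assume \<phi>: "\<phi> \<in> test_functions \<Omega>"
    have "L2_inner \<Omega> (\<lambda>x. g x $ i - h x $ i) \<phi> = 0"
      using g(2) h(2) \<phi> by (simp add: weak_gradient_iff L2.B_diff L2_component g(1) h(1) test_L2 \<Omega>)
    then show "(LINT x|lebesgue_on \<Omega>. (g x $ i - h x $ i) * \<phi> x) = 0" by (simp add: L2_inner_def)
  qed
  then have "AE x in lebesgue_on \<Omega>. \<forall>i. g x $ i - h x $ i = 0" by (simp add: AE_all_countable)
  then show ?thesis by eventually_elim (simp add: vec_eq_iff)
qed

lemma weak_gradient_add:
  assumes "u \<in> L2 \<Omega>" "v \<in> L2 \<Omega>" "g \<in> L2 \<Omega>" "h \<in> L2 \<Omega>" "weak_gradient \<Omega> u g" "weak_gradient \<Omega> v h"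
  shows "weak_gradient \<Omega> (\<lambda>x. u x + v x) (\<lambda>x. g x + h x)"
  using assms by (simp add: weak_gradient_iff L2.B_add L2_component test_L2[OF \<Omega>] test_partial_deriv)

lemma weak_gradient_scale:
  assumes "u \<in> L2 \<Omega>" "g \<in> L2 \<Omega>" "weak_gradient \<Omega> u g"
  shows "weak_gradient \<Omega> (\<lambda>x. c *\<^sub>R u x) (\<lambda>x. c *\<^sub>R g x)"
  using assms by (simp add: weak_gradient_iff L2_inner_def mult.assoc)

lemma H1_L2: "u \<in> H1 \<Omega> \<Longrightarrow> u \<in> L2 \<Omega>"
  by (simp add: H1_def)

lemma grad_L2: "u \<in> H1 \<Omega> \<Longrightarrow> grad \<Omega> u \<in> L2 \<Omega>"
  and weak_gradient_grad: "u \<in> H1 \<Omega> \<Longrightarrow> weak_gradient \<Omega> u (grad \<Omega> u)"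
proof -
  assume "u \<in> H1 \<Omega>"
  then have "\<exists>g. g \<in> L2 \<Omega> \<and> weak_gradient \<Omega> u g" by (auto simp: H1_def)
  from someI_ex[OF this] show "grad \<Omega> u \<in> L2 \<Omega>" "weak_gradient \<Omega> u (grad \<Omega> u)"
    by (simp_all add: grad_def)
qed

lemma H1I: "u \<in> L2 \<Omega> \<Longrightarrow> g \<in> L2 \<Omega> \<Longrightarrow> weak_gradient \<Omega> u g \<Longrightarrow> u \<in> H1 \<Omega>"
  by (auto simp: H1_def)

lemma grad_AE_eq:
  "u \<in> L2 \<Omega> \<Longrightarrow> g \<in> L2 \<Omega> \<Longrightarrow> weak_gradient \<Omega> u g \<Longrightarrow> AE x in lebesgue_on \<Omega>. grad \<Omega> u x = g x"
  using weak_gradient_unique[OF grad_L2 weak_gradient_grad] H1I by blast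

lemma H1_add:
  assumes "u \<in> H1 \<Omega>" "v \<in> H1 \<Omega>"
  shows "(\<lambda>x. u x + v x) \<in> H1 \<Omega>"
    and "AE x in lebesgue_on \<Omega>. grad \<Omega> (\<lambda>x. u x + v x) x = grad \<Omega> u x + grad \<Omega> v x"
proof -
  have "(\<lambda>x. u x + v x) \<in> L2 \<Omega>" "(\<lambda>x. grad \<Omega> u x + grad \<Omega> v x) \<in> L2 \<Omega>"
    "weak_gradient \<Omega> (\<lambda>x. u x + v x) (\<lambda>x. grad \<Omega> u x + grad \<Omega> v x)"
    by (intro weak_gradient_add L2_add H1_L2 grad_L2 weak_gradient_grad assms)+
  then show "(\<lambda>x. u x + v x) \<in> H1 \<Omega>"
    "AE x in lebesgue_on \<Omega>. grad \<Omega> (\<lambda>x. u x + v x) x = grad \<Omega> u x + grad \<Omega> v x"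
    using H1I grad_AE_eq by blast+
qed

lemma H1_scale:
  assumes "u \<in> H1 \<Omega>"
  shows "(\<lambda>x. c *\<^sub>R u x) \<in> H1 \<Omega>"
    and "AE x in lebesgue_on \<Omega>. grad \<Omega> (\<lambda>x. c *\<^sub>R u x) x = c *\<^sub>R grad \<Omega> u x"
proof -
  have "(\<lambda>x. c *\<^sub>R u x) \<in> L2 \<Omega>" "(\<lambda>x. c *\<^sub>R grad \<Omega> u x) \<in> L2 \<Omega>"
    "weak_gradient \<Omega> (\<lambda>x. c *\<^sub>R u x) (\<lambda>x. c *\<^sub>R grad \<Omega> u x)"
    by (intro weak_gradient_scale L2_scale H1_L2 grad_L2 weak_gradient_grad assms)+
  then show "(\<lambda>x. c *\<^sub>R u x) \<in> H1 \<Omega>"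
    "AE x in lebesgue_on \<Omega>. grad \<Omega> (\<lambda>x. c *\<^sub>R u x) x = c *\<^sub>R grad \<Omega> u x"
    using H1I grad_AE_eq by blast+
qed

lemma H1_test:
  assumes "\<phi> \<in> test_functions \<Omega>"
  shows "\<phi> \<in> H1 \<Omega>" "AE x in lebesgue_on \<Omega>. grad \<Omega> \<phi> x = classical_grad \<phi> x"
  using H1I grad_AE_eq test_L2[OF \<Omega> assms] classical_grad_L2[OF assms] weak_gradient_test[OF assms] by blast+

text \<open>The value is the same for every choice of weak gradients, and bilinear for that reason.\<close>

definition grad_inner :: "(real^'n \<Rightarrow> real) \<Rightarrow> (real^'n \<Rightarrow> real) \<Rightarrow> real" where
  "grad_inner u v = L2_inner \<Omega> (grad \<Omega> u) (grad \<Omega> v)"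

definition H1_inner :: "(real^'n \<Rightarrow> real) \<Rightarrow> (real^'n \<Rightarrow> real) \<Rightarrow> real" where
  "H1_inner u v = L2_inner \<Omega> u v + grad_inner u v"

lemma semi_inner_grad: "semi_inner (H1 \<Omega>) grad_inner"
proof
  show "H1 \<Omega> \<noteq> {}" using H1_test(1)[OF test_zero] by blast
  fix u v w :: "real^'n \<Rightarrow> real" and c
  assume u: "u \<in> H1 \<Omega>" and w: "w \<in> H1 \<Omega>"
  show "(\<lambda>x. c *\<^sub>R u x) \<in> H1 \<Omega>" using u by (rule H1_scale)
  have "grad_inner (\<lambda>x. c *\<^sub>R u x) w = L2_inner \<Omega> (\<lambda>x. c *\<^sub>R grad \<Omega> u x) (grad \<Omega> w)"
    unfolding grad_inner_def
    by (intro L2_inner_cong_AE H1_scale grad_L2 u w L2_scale) simp_all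
  then show "grad_inner (\<lambda>x. c *\<^sub>R u x) w = c * grad_inner u w"
    by (simp add: grad_inner_def L2.B_scale grad_L2 u w)
  show "grad_inner u w = grad_inner w u" and "grad_inner u u \<ge> 0"
    unfolding grad_inner_def using u w by (auto intro: L2.B_sym L2.B_nonneg grad_L2)
  assume v: "v \<in> H1 \<Omega>"
  show "(\<lambda>x. u x + v x) \<in> H1 \<Omega>" using u v by (rule H1_add)
  have "grad_inner (\<lambda>x. u x + v x) w = L2_inner \<Omega> (\<lambda>x. grad \<Omega> u x + grad \<Omega> v x) (grad \<Omega> w)"
    unfolding grad_inner_def
    by (intro L2_inner_cong_AE H1_add grad_L2 u v w L2_add) simp_all
  then show "grad_inner (\<lambda>x. u x + v x) w = grad_inner u w + grad_inner v w"
    by (simp add: grad_inner_def L2.B_add grad_L2 u v w)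
qed

interpretation G: semi_inner "H1 \<Omega>" grad_inner by (rule semi_inner_grad)

text \<open>A Cauchy sequence and the sequence of its gradients both converge in \<open>L\<^sup>2\<close>. The defining
  identity of weak gradients only involves products with fixed test functions, so it passes to
  the limits.\<close>

lemma semi_hilbert_H1: "semi_hilbert (H1 \<Omega>) H1_inner"
proof
  show "H1 \<Omega> \<noteq> {}" by (rule G.nonempty)
next
  fix s :: "nat \<Rightarrow> real^'n \<Rightarrow> real"
  assume s: "\<And>n. s n \<in> H1 \<Omega>"
    and c: "\<And>e. e > 0 \<Longrightarrow> \<exists>N::nat. \<forall>m\<ge>N. \<forall>n\<ge>N. sqdist H1_inner (s m) (s n) < e"
  have d: "(\<lambda>x. s m x - s n x) \<in> H1 \<Omega>" for m n by (intro G.diff_closed s)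
  have g_eq: "sqdist grad_inner (s m) (s n)
      = sqdist (L2_inner \<Omega>) (grad \<Omega> (s m)) (grad \<Omega> (s n))" for m n
    unfolding G.B_diff_sq[OF s s] by (simp add: L2.B_diff_sq grad_L2 s grad_inner_def)
  have "sqdist (L2_inner \<Omega>) (s m) (s n) \<ge> 0" "sqdist grad_inner (s m) (s n) \<ge> 0" for m n
    using d[of m n] by (auto intro: L2.B_nonneg H1_L2 G.B_nonneg)
  then have le: "sqdist (L2_inner \<Omega>) (s m) (s n) \<le> sqdist H1_inner (s m) (s n)"
    "sqdist grad_inner (s m) (s n) \<le> sqdist H1_inner (s m) (s n)" for m n
    by (auto simp: H1_inner_def)
  obtain w where w: "w \<in> L2 \<Omega>" "(\<lambda>n. sqdist (L2_inner \<Omega>) (s n) w) \<longlonglongrightarrow> 0"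
    using L2.complete[of s \<Omega>] H1_L2[OF s] c le(1) by (meson le_less_trans)
  obtain g where g: "g \<in> L2 \<Omega>"
    "(\<lambda>n. sqdist (L2_inner \<Omega>) (grad \<Omega> (s n)) g) \<longlonglongrightarrow> 0"
    using L2.complete[of "\<lambda>n. grad \<Omega> (s n)" \<Omega>] grad_L2[OF s] c le(2)[unfolded g_eq] by (meson le_less_trans)
  have wg: "weak_gradient \<Omega> w g"
    unfolding weak_gradient_iff
  proof (intro ballI allI)
    fix \<phi> i assume \<phi>: "\<phi> \<in> test_functions \<Omega>"
    have conv: "(\<lambda>n. L2_inner \<Omega> (t n) \<psi>) \<longlonglongrightarrow> L2_inner \<Omega> z \<psi>"
      if t: "\<And>n. t n \<in> L2 \<Omega>" "z \<in> L2 \<Omega>" "\<psi> \<in> L2 \<Omega>" 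
        and lim: "(\<lambda>n. sqdist (L2_inner \<Omega>) (t n) z) \<longlonglongrightarrow> 0"
      for t :: "nat \<Rightarrow> real^'n \<Rightarrow> real" and z \<psi>
      by (rule L2.tendsto_B) (use that in auto)
    have "(\<lambda>n. L2_inner \<Omega> (\<lambda>x. grad \<Omega> (s n) x $ i - g x $ i) (\<lambda>x. grad \<Omega> (s n) x $ i - g x $ i)) \<longlonglongrightarrow> 0"
    proof (rule tendsto_sandwich[OF _ _ tendsto_const g(2)])
      have dL: "(\<lambda>x. grad \<Omega> (s n) x - g x) \<in> L2 \<Omega>" for n by (intro L2.diff_closed grad_L2 s g)
      have "(a $ i - b $ i) * (a $ i - b $ i) \<le> (a - b) \<bullet> (a - b)" for a b :: "real^'n"
        using power_mono[OF component_le_norm_cart[of "a - b" i], of 2]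
        by (simp add: dot_square_norm power2_eq_square[symmetric])
      then show "\<forall>\<^sub>F n in sequentially. L2_inner \<Omega> (\<lambda>x. grad \<Omega> (s n) x $ i - g x $ i) (\<lambda>x. grad \<Omega> (s n) x $ i - g x $ i)
          \<le> sqdist (L2_inner \<Omega>) (grad \<Omega> (s n)) g"
        unfolding L2_inner_def using L2_inner_integrable[OF dL dL] L2_inner_integrable[OF L2_component[OF dL] L2_component[OF dL]]
        by (intro always_eventually allI integral_mono) simp_all
    qed (auto simp: L2_inner_def)
    then have "(\<lambda>n. - L2_inner \<Omega> (\<lambda>x. grad \<Omega> (s n) x $ i) \<phi>) \<longlonglongrightarrow> - L2_inner \<Omega> (\<lambda>x. g x $ i) \<phi>"
      by (intro tendsto_minus conv L2_component grad_L2 s g test_L2 \<Omega> \<phi>)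
    moreover have "(\<lambda>n. L2_inner \<Omega> (s n) (partial_deriv i \<phi>)) \<longlonglongrightarrow> L2_inner \<Omega> w (partial_deriv i \<phi>)"
      by (intro conv H1_L2 s w test_L2 test_partial_deriv \<Omega> \<phi>)
    moreover have "L2_inner \<Omega> (s n) (partial_deriv i \<phi>) = - L2_inner \<Omega> (\<lambda>x. grad \<Omega> (s n) x $ i) \<phi>" for n
      using weak_gradient_grad[OF s, of n] \<phi> by (simp add: weak_gradient_iff)
    ultimately show "L2_inner \<Omega> w (partial_deriv i \<phi>) = - L2_inner \<Omega> (\<lambda>x. g x $ i) \<phi>"
      using LIMSEQ_unique by simp
  qed
  have wH: "w \<in> H1 \<Omega>" using w(1) g(1) wg by (rule H1I)
  have "sqdist grad_inner (s n) w
      = sqdist (L2_inner \<Omega>) (grad \<Omega> (s n)) g" for n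
  proof -
    have "sqdist grad_inner (s n) w
        = sqdist (L2_inner \<Omega>) (grad \<Omega> (s n)) (grad \<Omega> w)"
      unfolding G.B_diff_sq[OF s wH] by (simp add: L2.B_diff_sq grad_L2 s wH grad_inner_def)
    also have "\<dots> = sqdist (L2_inner \<Omega>) (grad \<Omega> (s n)) g"
      using grad_AE_eq[OF w(1) g(1) wg]
      by (intro L2_inner_cong_AE L2.diff_closed grad_L2 s wH g) (auto elim: eventually_mono)
    finally show ?thesis .
  qed
  then have "(\<lambda>n. sqdist H1_inner (s n) w) \<longlonglongrightarrow> 0"
    using tendsto_add[OF w(2) g(2)] by (simp add: H1_inner_def)
  then show "\<exists>w\<in>H1 \<Omega>. (\<lambda>n. sqdist H1_inner (s n) w) \<longlonglongrightarrow> 0" using wH by blast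
qed (auto simp: H1_inner_def G.closed G.bilinear L2.bilinear H1_L2 distrib_left simp del: real_scaleR_def
    intro: L2.B_sym G.B_sym L2.B_nonneg G.B_nonneg intro!: arg_cong2[of _ _ _ _ "(+)"] add_nonneg_nonneg)

end

text \<open>The integral of \<open>\<partial>\<^sub>i (x\<^sub>i \<phi>\<^sup>2) = \<phi>\<^sup>2 + 2 x\<^sub>i \<phi> \<partial>\<^sub>i \<phi>\<close> is zero, and the second term is absorbed by
  completing a square.\<close>

lemma poincare_test:
  fixes \<Omega> :: "(real^'n::finite) set"
  assumes \<Omega>: "open \<Omega>" and R: "\<And>x. x \<in> \<Omega> \<Longrightarrow> \<bar>x $ i\<bar> \<le> R" and \<phi>: "\<phi> \<in> test_functions \<Omega>"
  shows "L2_inner \<Omega> \<phi> \<phi> \<le> 4 * R\<^sup>2 * grad_inner \<Omega> \<phi> \<phi>"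
proof -
  define \<psi> where "\<psi> x = \<phi> x * (\<phi> x * x $ i)" for x
  have sm: "smooth \<phi>" using \<phi> by (rule test_smooth)
  have \<psi>: "\<psi> \<in> test_functions \<Omega>"
    unfolding \<psi>_def using \<phi> sm by (intro test_mult_smooth smooth_mult smooth_coord)
  have d\<psi>: "partial_deriv i \<psi> x = (\<phi> x)\<^sup>2 + 2 * (x $ i) * \<phi> x * partial_deriv i \<phi> x" for x
  proof -
    have "partial_deriv i (\<lambda>x. \<phi> x * x $ i) x = \<phi> x + partial_deriv i \<phi> x * x $ i"
      using partial_deriv_mult[of \<phi> x "\<lambda>x. x $ i" i] smooth_differentiable[OF sm] smooth_differentiable[OF smooth_coord, of i x]
      by (simp add: partial_deriv_coord)
    then show ?thesis
      using partial_deriv_mult[of \<phi> x "\<lambda>x. \<phi> x * x $ i" i] smooth_differentiable[OF sm]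
        smooth_differentiable[OF smooth_mult[OF sm smooth_coord]]
      by (simp add: \<psi>_def[abs_def] power2_eq_square algebra_simps)
  qed
  let ?g = "\<lambda>x. classical_grad \<phi> x \<bullet> classical_grad \<phi> x"
  have "L2_inner \<Omega> \<phi> \<phi> \<le> (LINT x|lebesgue_on \<Omega>. 2 * partial_deriv i \<psi> x + 4 * R\<^sup>2 * ?g x)"
    unfolding L2_inner_def
  proof (rule integral_mono)
    show "integrable (lebesgue_on \<Omega>) (\<lambda>x. \<phi> x \<bullet> \<phi> x)"
      by (intro L2_inner_integrable test_L2 \<Omega> \<phi>)
    show "integrable (lebesgue_on \<Omega>) (\<lambda>x. 2 * partial_deriv i \<psi> x + 4 * R\<^sup>2 * ?g x)"
      using test_integral_lborel(1)[OF \<Omega> test_partial_deriv[OF \<psi>]]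
        L2_inner_integrable[OF classical_grad_L2[OF \<Omega> \<phi>] classical_grad_L2[OF \<Omega> \<phi>]] by simp
    fix x assume "x \<in> space (lebesgue_on \<Omega>)"
    then have x: "\<bar>x $ i\<bar> \<le> R" using R by simp
    let ?d = "partial_deriv i \<phi> x"
    have "?d\<^sup>2 \<le> ?g x"
      using power_mono[OF component_le_norm_cart[of "classical_grad \<phi> x" i], of 2]
      by (simp add: dot_square_norm classical_grad_def)
    moreover have "(x $ i)\<^sup>2 \<le> R\<^sup>2" using power_mono[OF x, of 2] by simp
    ultimately have "(x $ i)\<^sup>2 * ?d\<^sup>2 \<le> R\<^sup>2 * ?g x" by (intro mult_mono) auto
    moreover have "0 \<le> (\<phi> x + 2 * (x $ i) * ?d)\<^sup>2" by simp
    ultimately show "\<phi> x \<bullet> \<phi> x \<le> 2 * partial_deriv i \<psi> x + 4 * R\<^sup>2 * ?g x"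
      by (simp add: d\<psi> power2_eq_square algebra_simps)
  qed
  also have "\<dots> = 4 * R\<^sup>2 * L2_inner \<Omega> (classical_grad \<phi>) (classical_grad \<phi>)"
    using integral_partial_deriv_test_on[OF \<Omega> \<psi>, of i] test_integral_lborel(1)[OF \<Omega> test_partial_deriv[OF \<psi>]]
      L2_inner_integrable[OF classical_grad_L2[OF \<Omega> \<phi>] classical_grad_L2[OF \<Omega> \<phi>]]
    by (simp add: L2_inner_def)
  also have "L2_inner \<Omega> (classical_grad \<phi>) (classical_grad \<phi>) = grad_inner \<Omega> \<phi> \<phi>"
    unfolding grad_inner_def[OF \<Omega>] using H1_test[OF \<Omega> \<phi>]
    by (intro L2_inner_cong_AE classical_grad_L2 grad_L2 \<Omega> \<phi>) (auto elim: eventually_mono)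
  finally show ?thesis .
qed

lemma semi_hilbert_H01_H1_inner:
  assumes "open \<Omega>"
  shows "semi_hilbert (H01 \<Omega>) (H1_inner \<Omega>)"
    and H1_norm_eq: "H1_norm \<Omega> u = sqrt (H1_inner \<Omega> u u)"
proof -
  interpret H: semi_hilbert "H1 \<Omega>" "H1_inner \<Omega>" using assms by (rule semi_hilbert_H1)
  show eq: "H1_norm \<Omega> u = sqrt (H1_inner \<Omega> u u)" for u
    using assms by (simp add: H1_norm_def H1_inner_def grad_inner_def L2_inner_def power2_eq_square dot_square_norm)
  have "test_functions \<Omega> \<noteq> {}" using test_zero by blast
  then show "semi_hilbert (H01 \<Omega>) (H1_inner \<Omega>)"
    unfolding H01_def eq H.nrm_def[symmetric] using assms
    by (intro H.closure_semi_hilbert) (auto intro: H1_test test_add test_scale)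
qed

lemma H01_H1: "u \<in> H01 \<Omega> \<Longrightarrow> u \<in> H1 \<Omega>"
  by (simp add: H01_def)

lemma test_H01: "open \<Omega> \<Longrightarrow> \<phi> \<in> test_functions \<Omega> \<Longrightarrow> \<phi> \<in> H01 \<Omega>"
proof -
  assume \<Omega>: "open \<Omega>" and \<phi>: "\<phi> \<in> test_functions \<Omega>"
  interpret H: semi_hilbert "H1 \<Omega>" "H1_inner \<Omega>" using \<Omega> by (rule semi_hilbert_H1)
  have "H1_norm \<Omega> (\<lambda>x. \<phi> x - \<phi> x) = 0"
    using H.B_scale[OF H.zero_closed H.zero_closed, of 0] by (simp add: H1_norm_eq[OF \<Omega>])
  then have "\<forall>\<epsilon>>0. H1_norm \<Omega> (\<lambda>x. \<phi> x - \<phi> x) < \<epsilon>" by simp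
  then show "\<phi> \<in> H01 \<Omega>" using \<phi> H1_test(1)[OF \<Omega> \<phi>] unfolding H01_def by blast
qed

text \<open>Both sides are continuous in the Sobolev norm, so the inequality extends from test functions
  to their closure.\<close>

lemma poincare:
  fixes \<Omega> :: "(real^'n::finite) set"
  assumes \<Omega>: "open \<Omega>" "bounded \<Omega>"
  shows "\<exists>P>0. \<forall>u\<in>H01 \<Omega>. L2_inner \<Omega> u u \<le> P * grad_inner \<Omega> u u"
proof -
  obtain R where R: "R > 0" "\<And>x. x \<in> \<Omega> \<Longrightarrow> norm x \<le> R" using \<Omega>(2) by (auto simp: bounded_pos)
  obtain i :: 'n where True by blast
  have Ri: "\<bar>x $ i\<bar> \<le> R" if "x \<in> \<Omega>" for x
    using R(2)[OF that] component_le_norm_cart[of x i] by linarith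
  interpret H: semi_hilbert "H1 \<Omega>" "H1_inner \<Omega>" using \<Omega>(1) by (rule semi_hilbert_H1)
  interpret G: semi_inner "H1 \<Omega>" "grad_inner \<Omega>" using \<Omega>(1) by (rule semi_inner_grad)
  have le: "L2.nrm \<Omega> u \<le> H.nrm u" "G.nrm u \<le> H.nrm u" if "u \<in> H1 \<Omega>" for u
    using that L2.B_nonneg[OF H1_L2[OF \<Omega>(1) that]] G.B_nonneg[OF that]
    by (simp_all add: L2.nrm_def H.nrm_def G.nrm_def H1_inner_def[OF \<Omega>(1)])
  have main: "L2.nrm \<Omega> u \<le> 2 * R * G.nrm u" if u: "u \<in> H01 \<Omega>" for u
  proof (rule field_le_epsilon)
    fix e :: real assume e: "e > 0"
    define d where "d = e / (1 + 2 * R)"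
    have d: "d > 0" using e R(1) by (simp add: d_def)
    obtain \<phi> where \<phi>: "\<phi> \<in> test_functions \<Omega>" "H.nrm (\<lambda>x. u x - \<phi> x) < d"
      using u d by (auto simp: H01_def H1_norm_eq[OF \<Omega>(1)] H.nrm_def)
    have uH: "u \<in> H1 \<Omega>" "\<phi> \<in> H1 \<Omega>" using u \<phi> H1_test \<Omega>(1) H01_H1 by auto
    have L: "u \<in> L2 \<Omega>" "\<phi> \<in> L2 \<Omega>" using uH H1_L2 \<Omega>(1) by auto
    have diff: "L2.nrm \<Omega> (\<lambda>x. u x - \<phi> x) \<le> d" "G.nrm (\<lambda>x. u x - \<phi> x) \<le> d"
      using le[OF H.diff_closed[OF uH]] \<phi>(2) by auto
    have "L2.nrm \<Omega> \<phi> \<le> 2 * R * G.nrm \<phi>"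
      using real_sqrt_le_mono[OF poincare_test[OF \<Omega>(1) Ri \<phi>(1)]] R(1)
      by (simp add: L2.nrm_def G.nrm_def real_sqrt_mult)
    also have "\<dots> \<le> 2 * R * (G.nrm u + d)"
      using G.nrm_diff_ge[OF uH(2) uH(1)] G.nrm_minus_commute[OF uH] diff(2) R(1)
      by (intro mult_left_mono) auto
    finally have "L2.nrm \<Omega> u \<le> d + 2 * R * (G.nrm u + d)"
      using L2.nrm_diff_ge[OF L] diff(1) by linarith
    also have "\<dots> = 2 * R * G.nrm u + (1 + 2 * R) * d" by (simp add: algebra_simps)
    also have "(1 + 2 * R) * d = e" using R(1) by (simp add: d_def)
    finally show "L2.nrm \<Omega> u \<le> 2 * R * G.nrm u + e" .
  qed
  have "L2_inner \<Omega> u u \<le> (2 * R)\<^sup>2 * grad_inner \<Omega> u u" if u: "u \<in> H01 \<Omega>" for u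
  proof -
    have uH: "u \<in> H1 \<Omega>" "u \<in> L2 \<Omega>" using u H01_H1 H1_L2 \<Omega>(1) by auto
    have "(L2.nrm \<Omega> u)\<^sup>2 \<le> (2 * R * G.nrm u)\<^sup>2" using main[OF u] L2.nrm_nonneg[OF uH(2)] by (rule power_mono)
    then show ?thesis using L2.nrm_sq[OF uH(2)] G.nrm_sq[OF uH(1)] by (simp add: power_mult_distrib)
  qed
  then show ?thesis using R(1) by (intro exI[of _ "(2 * R)\<^sup>2"]) simp
qed

theorem semi_hilbert_H01:
  assumes \<Omega>: "open \<Omega>" "bounded \<Omega>"
  shows "semi_hilbert (H01 \<Omega>) (grad_inner \<Omega>)"
proof -
  interpret H: semi_hilbert "H01 \<Omega>" "H1_inner \<Omega>" using \<Omega>(1) by (rule semi_hilbert_H01_H1_inner)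
  interpret G: semi_inner "H1 \<Omega>" "grad_inner \<Omega>" using \<Omega>(1) by (rule semi_inner_grad)
  obtain P where P: "P > 0" "\<And>u. u \<in> H01 \<Omega> \<Longrightarrow> L2_inner \<Omega> u u \<le> P * grad_inner \<Omega> u u"
    using poincare[OF \<Omega>] by blast
  show ?thesis
  proof (rule H.equivalent_form[where \<delta>="1 / (1 + P)" and C=1])
    show "semi_inner (H01 \<Omega>) (grad_inner \<Omega>)"
      by unfold_locales (use H.nonempty in \<open>auto simp: H.closed G.bilinear H01_H1 G.B_nonneg
          intro: G.B_sym simp del: real_scaleR_def\<close>)
    fix u assume u: "u \<in> H01 \<Omega>"
    have "H1_inner \<Omega> u u \<le> (1 + P) * grad_inner \<Omega> u u"
      using P(2)[OF u] by (simp add: H1_inner_def[OF \<Omega>(1)] algebra_simps)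
    then show "1 / (1 + P) * H1_inner \<Omega> u u \<le> grad_inner \<Omega> u u" using P(1) by (simp add: field_simps)
    show "grad_inner \<Omega> u u \<le> 1 * H1_inner \<Omega> u u"
      using L2.B_nonneg[OF H1_L2[OF \<Omega>(1) H01_H1[OF u]]] by (simp add: H1_inner_def[OF \<Omega>(1)])
  qed (use P(1) in simp)
qed

text \<open>The difference of the two functions has zero energy, hence zero \<open>L\<^sup>2\<close> norm by the Poincare
  inequality.\<close>

lemma grad_inner_null_ae_eq:
  assumes \<Omega>: "open \<Omega>" "bounded \<Omega>" and u: "u \<in> H01 \<Omega>" "v \<in> H01 \<Omega>"
    and null: "\<And>w. w \<in> H01 \<Omega> \<Longrightarrow> grad_inner \<Omega> u w = grad_inner \<Omega> v w"
  shows "ae_eq \<Omega> u v"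
proof -
  interpret H: semi_hilbert "H01 \<Omega>" "grad_inner \<Omega>" using \<Omega> by (rule semi_hilbert_H01)
  have d: "(\<lambda>x. u x - v x) \<in> H01 \<Omega>" by (intro H.diff_closed u)
  have "sqdist (grad_inner \<Omega>) u v = 0"
    using null[OF d] by (simp add: H.B_diff u d)
  moreover obtain P where "sqdist (L2_inner \<Omega>) u v
      \<le> P * sqdist (grad_inner \<Omega>) u v" using poincare[OF \<Omega>] d by blast
  ultimately have "sqdist (L2_inner \<Omega>) u v = 0"
    using L2.B_nonneg[OF H1_L2[OF \<Omega>(1) H01_H1[OF d]]] by simp
  then have "AE x in lebesgue_on \<Omega>. u x - v x = 0"
    by (intro L2_null_AE H1_L2 \<Omega>(1) H01_H1 d)
  then show ?thesis unfolding ae_eq_def by eventually_elim simp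
qed

lemma ae_eq_grad_inner:
  assumes \<Omega>: "open \<Omega>" and u: "u \<in> H1 \<Omega>" "v \<in> H1 \<Omega>" "ae_eq \<Omega> u v" and w: "w \<in> H1 \<Omega>"
  shows "grad_inner \<Omega> u w = grad_inner \<Omega> v w"
proof -
  have "weak_gradient \<Omega> v (grad \<Omega> u)"
    unfolding weak_gradient_iff
  proof (intro ballI allI)
    fix \<phi> i assume \<phi>: "\<phi> \<in> test_functions \<Omega>"
    have "L2_inner \<Omega> v (partial_deriv i \<phi>) = L2_inner \<Omega> u (partial_deriv i \<phi>)"
      using u(3) unfolding ae_eq_def
      by (intro L2_inner_cong_AE H1_L2 test_L2 test_partial_deriv u \<Omega> \<phi>) (auto elim: eventually_mono)
    then show "L2_inner \<Omega> v (partial_deriv i \<phi>) = - L2_inner \<Omega> (\<lambda>x. grad \<Omega> u x $ i) \<phi>"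
      using weak_gradient_grad[OF \<Omega> u(1)] \<phi> by (simp add: weak_gradient_iff)
  qed
  then have "AE x in lebesgue_on \<Omega>. grad \<Omega> v x = grad \<Omega> u x"
    by (intro grad_AE_eq H1_L2 grad_L2 \<Omega> u)
  then show ?thesis
    unfolding grad_inner_def[OF \<Omega>]
    by (intro L2_inner_cong_AE grad_L2 \<Omega> u w) (auto elim: eventually_mono)
qed

section \<open>The operator and its energy form\<close>

text \<open>The operators see the coefficients only inside \<open>\<Omega>\<close>. The bounds \<open>m\<close> and \<open>M\<close> may be attained on the
  boundary alone.\<close>

locale diffusion =
  fixes \<Omega> :: "(real^'n::finite) set" and \<kappa> :: "'n \<Rightarrow> real^'n \<Rightarrow> real" and K :: "real^'n \<Rightarrow> real^'n^'n"
    and m M :: real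
  assumes \<Omega>: "open \<Omega>" "bounded \<Omega>"
    and diag: "\<And>x. x \<in> \<Omega> \<Longrightarrow> K x = (\<chi> i j. if i = j then \<kappa> i x else 0)"
    and cont: "continuous_on \<Omega> K"
    and bounds: "\<And>x i. x \<in> \<Omega> \<Longrightarrow> m \<le> \<kappa> i x \<and> \<kappa> i x \<le> M"
begin

sublocale H: semi_hilbert "H01 \<Omega>" "grad_inner \<Omega>"
  using \<Omega> by (rule semi_hilbert_H01)

abbreviation V where "V \<equiv> H01 \<Omega>"
abbreviation energy where "energy \<equiv> grad_inner \<Omega>"
abbreviation V_complex ("V\<^sub>C") where "V\<^sub>C \<equiv> H01_complex \<Omega>"
abbreviation norm_complex ("norm\<^sub>C") where "norm\<^sub>C \<equiv> norm_L_complex \<Omega>"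

lemma grad_L2_H01: "u \<in> V \<Longrightarrow> grad \<Omega> u \<in> L2 \<Omega>"
  by (intro grad_L2 H01_H1 \<Omega>)

lemma K_apply: "x \<in> \<Omega> \<Longrightarrow> K x *v g = (\<chi> i. \<kappa> i x * g $ i)"
  by (simp add: diag matrix_vector_mult_def vec_eq_iff if_distrib[of "\<lambda>c. c * _"] cong: if_cong)

lemma \<kappa>_eq: "x \<in> \<Omega> \<Longrightarrow> \<kappa> i x = K x $ i $ i"
  by (simp add: diag)

text \<open>The bound is imposed on the products, so that it holds trivially where \<open>g\<close> vanishes: the
  factors \<open>f i\<close> need to be small only on the support of \<open>g\<close>.\<close>

lemma L2_diag_mult:
  assumes g: "g \<in> L2 \<Omega>" and "c \<ge> 0"
    and f: "\<And>i. (\<lambda>x. f i x) \<in> borel_measurable (lebesgue_on \<Omega>)"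
    and bound: "\<And>x i. x \<in> \<Omega> \<Longrightarrow> \<bar>f i x * g x $ i\<bar> \<le> c * \<bar>g x $ i\<bar>"
  shows "(\<lambda>x. \<chi> i. f i x * g x $ i) \<in> L2 \<Omega>"
    and "L2.nrm \<Omega> (\<lambda>x. \<chi> i. f i x * g x $ i) \<le> c * L2.nrm \<Omega> g"
proof -
  let ?h = "\<lambda>x. \<chi> i. f i x * g x $ i"
  have [measurable]: "f i \<in> borel_measurable (lebesgue_on \<Omega>)" "(\<lambda>x. g x $ i) \<in> borel_measurable (lebesgue_on \<Omega>)" for i
    using f L2_measurable[OF L2_component[OF g]] by auto
  have "?h = (\<lambda>x. \<Sum>i\<in>UNIV. (f i x * g x $ i) *\<^sub>R axis i 1)"
    by (simp add: fun_eq_iff vec_eq_iff axis_def if_distrib cong: if_cong)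
  then have meas: "?h \<in> borel_measurable (lebesgue_on \<Omega>)" by simp
  have le: "(norm (?h x))\<^sup>2 \<le> c\<^sup>2 * (norm (g x))\<^sup>2" if "x \<in> \<Omega>" for x
  proof -
    have "(f i x * g x $ i)\<^sup>2 \<le> c\<^sup>2 * (g x $ i)\<^sup>2" for i
      using power_mono[OF bound[OF that, of i], of 2] by (simp add: power_mult_distrib)
    then have "(\<Sum>i\<in>UNIV. (f i x * g x $ i)\<^sup>2) \<le> (\<Sum>i\<in>UNIV. c\<^sup>2 * (g x $ i)\<^sup>2)" by (intro sum_mono)
    then show ?thesis unfolding power2_norm_eq_inner inner_vec_def
      by (simp add: sum_distrib_left power2_eq_square)
  qed
  have int: "integrable (lebesgue_on \<Omega>) (\<lambda>x. c\<^sup>2 * (norm (g x))\<^sup>2)" using L2_integrable_sq[OF g] by simp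
  then show h: "?h \<in> L2 \<Omega>" by (intro L2_dominated[OF meas int] AE_I2) (simp add: le)
  have "(LINT x|lebesgue_on \<Omega>. (norm (?h x))\<^sup>2) \<le> (LINT x|lebesgue_on \<Omega>. c\<^sup>2 * (norm (g x))\<^sup>2)"
    using L2_integrable_sq[OF h] int le by (intro integral_mono) auto
  then have "L2_inner \<Omega> ?h ?h \<le> c\<^sup>2 * L2_inner \<Omega> g g" by (simp add: L2_inner_def dot_square_norm)
  then show "L2.nrm \<Omega> ?h \<le> c * L2.nrm \<Omega> g"
    using real_sqrt_le_mono[of "L2_inner \<Omega> ?h ?h" "c\<^sup>2 * L2_inner \<Omega> g g"] \<open>c \<ge> 0\<close>
    by (simp add: L2.nrm_def real_sqrt_mult)
qed

lemma \<kappa>_measurable: "(\<lambda>x. \<kappa> i x) \<in> borel_measurable (lebesgue_on \<Omega>)"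
proof -
  have "continuous_on \<Omega> (\<lambda>x. K x $ i $ i)" using cont by (intro continuous_intros)
  then have "continuous_on \<Omega> (\<kappa> i)" using continuous_on_cong[OF refl, of \<Omega> "\<kappa> i" "\<lambda>x. K x $ i $ i"] \<kappa>_eq by simp
  then show ?thesis using \<Omega> by (intro continuous_imp_measurable_on_sets_lebesgue) auto
qed

definition \<Lambda> where "\<Lambda> = max \<bar>m\<bar> \<bar>M\<bar>"

lemma \<kappa>_abs: "x \<in> \<Omega> \<Longrightarrow> \<bar>\<kappa> i x\<bar> \<le> \<Lambda>"
  using bounds[of x i] by (auto simp: \<Lambda>_def abs_if max_def)

lemma K_mult_L2:
  assumes "g \<in> L2 \<Omega>"
  shows "(\<lambda>x. \<chi> i. \<kappa> i x * g x $ i) \<in> L2 \<Omega>"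
    and "L2.nrm \<Omega> (\<lambda>x. \<chi> i. \<kappa> i x * g x $ i) \<le> \<Lambda> * L2.nrm \<Omega> g"
proof -
  have "0 \<le> \<Lambda>" by (simp add: \<Lambda>_def le_max_iff_disj)
  moreover have "\<bar>\<kappa> i x * g x $ i\<bar> \<le> \<Lambda> * \<bar>g x $ i\<bar>" if "x \<in> \<Omega>" for x i
    using \<kappa>_abs[OF that] by (simp add: abs_mult mult_right_mono)
  ultimately show "(\<lambda>x. \<chi> i. \<kappa> i x * g x $ i) \<in> L2 \<Omega>"
    "L2.nrm \<Omega> (\<lambda>x. \<chi> i. \<kappa> i x * g x $ i) \<le> \<Lambda> * L2.nrm \<Omega> g"
    using L2_diag_mult[of g \<Lambda> \<kappa>, OF assms _ \<kappa>_measurable] by blast+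
qed

definition A_form :: "(real^'n \<Rightarrow> real) \<Rightarrow> (real^'n \<Rightarrow> real) \<Rightarrow> real" where
  "A_form u v = L2_inner \<Omega> (grad \<Omega> v) (\<lambda>x. \<chi> i. \<kappa> i x * grad \<Omega> u x $ i)"

lemma op_A_eq: "v \<in> V \<Longrightarrow> op_A \<Omega> K u v = A_form u v"
  unfolding op_A_def A_form_def L2_inner_def
  by (simp, rule Bochner_Integration.integral_cong) (simp_all add: K_apply)

lemma op_L_eq: "v \<in> V \<Longrightarrow> op_L \<Omega> u v = energy u v"
  by (simp add: op_L_def grad_inner_def[OF \<Omega>(1)] L2_inner_def inner_commute)

lemma norm_L_eq: "u \<in> V \<Longrightarrow> norm_L \<Omega> u = H.nrm u"
  by (simp add: norm_L_def op_L_eq H.nrm_def)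

lemma A_form_integrable:
  assumes "u \<in> V" "v \<in> V"
  shows "integrable (lebesgue_on \<Omega>) (\<lambda>x. grad \<Omega> v x \<bullet> (\<chi> i. \<kappa> i x * grad \<Omega> u x $ i))"
  by (intro L2_inner_integrable K_mult_L2 grad_L2_H01 assms)

lemma A_form_sym: "A_form u v = A_form v u"
  unfolding A_form_def L2_inner_def by (simp add: inner_vec_def mult_ac)

lemma A_form_bound:
  assumes "u \<in> V" "v \<in> V"
  shows "\<bar>A_form u v\<bar> \<le> \<Lambda> * H.nrm u * H.nrm v"
proof -
  have n: "L2.nrm \<Omega> (grad \<Omega> w) = H.nrm w" for w
    by (simp add: L2.nrm_def H.nrm_def grad_inner_def[OF \<Omega>(1)])
  have "\<bar>A_form u v\<bar> \<le> H.nrm v * L2.nrm \<Omega> (\<lambda>x. \<chi> i. \<kappa> i x * grad \<Omega> u x $ i)"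
    unfolding A_form_def n[of v, symmetric] by (intro L2.cauchy_schwarz K_mult_L2 grad_L2_H01 assms)
  also have "\<dots> \<le> H.nrm v * (\<Lambda> * H.nrm u)"
    using K_mult_L2(2)[OF grad_L2_H01[OF assms(1)]] H.nrm_nonneg[OF assms(2)] n[of u]
    by (intro mult_left_mono) auto
  finally show ?thesis by (simp add: mult_ac)
qed

lemma A_form_add_right:
  assumes "u \<in> V" "v \<in> V" "w \<in> V"
  shows "A_form w (\<lambda>x. u x + v x) = A_form w u + A_form w v"
proof -
  have "A_form w (\<lambda>x. u x + v x)
      = L2_inner \<Omega> (\<lambda>x. grad \<Omega> u x + grad \<Omega> v x) (\<lambda>x. \<chi> i. \<kappa> i x * grad \<Omega> w x $ i)"
    unfolding A_form_def
    by (intro L2_inner_cong_AE L2_add K_mult_L2 grad_L2_H01 H1_add \<Omega> H01_H1 H.closed assms) auto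
  then show ?thesis by (simp add: A_form_def L2.B_add K_mult_L2 grad_L2_H01 assms)
qed

lemma A_form_scale_right:
  assumes "u \<in> V" "w \<in> V"
  shows "A_form w (\<lambda>x. c *\<^sub>R u x) = c * A_form w u"
proof -
  have "A_form w (\<lambda>x. c *\<^sub>R u x) = L2_inner \<Omega> (\<lambda>x. c *\<^sub>R grad \<Omega> u x) (\<lambda>x. \<chi> i. \<kappa> i x * grad \<Omega> w x $ i)"
    unfolding A_form_def
    by (intro L2_inner_cong_AE L2_scale K_mult_L2 grad_L2_H01 H1_scale \<Omega> H01_H1 H.closed assms) auto
  then show ?thesis by (simp only: A_form_def L2.B_scale K_mult_L2 grad_L2_H01 assms)
qed

lemma A_form_between:
  assumes "u \<in> V"
  shows "m * energy u u \<le> A_form u u" "A_form u u \<le> M * energy u u"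
proof -
  let ?g = "grad \<Omega> u"
  have int: "integrable (lebesgue_on \<Omega>) (\<lambda>x. ?g x \<bullet> ?g x)"
    by (intro L2_inner_integrable grad_L2_H01 assms)
  have "c * (?g x \<bullet> ?g x) = (\<Sum>i\<in>UNIV. c * (?g x $ i)\<^sup>2)" for c x
    by (simp add: inner_vec_def sum_distrib_left power2_eq_square)
  moreover have "?g x \<bullet> (\<chi> i. \<kappa> i x * ?g x $ i) = (\<Sum>i\<in>UNIV. \<kappa> i x * (?g x $ i)\<^sup>2)" for x
    by (simp add: inner_vec_def power2_eq_square mult_ac)
  ultimately have le: "m * (?g x \<bullet> ?g x) \<le> ?g x \<bullet> (\<chi> i. \<kappa> i x * ?g x $ i)"
    "?g x \<bullet> (\<chi> i. \<kappa> i x * ?g x $ i) \<le> M * (?g x \<bullet> ?g x)" if "x \<in> \<Omega>" for x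
    using bounds[OF that] by (auto intro!: sum_mono mult_right_mono)
  have "(LINT x|lebesgue_on \<Omega>. m * (?g x \<bullet> ?g x)) \<le> A_form u u"
    unfolding A_form_def L2_inner_def
    by (rule integral_mono) (use A_form_integrable[OF assms assms] int le in simp_all)
  moreover have "A_form u u \<le> (LINT x|lebesgue_on \<Omega>. M * (?g x \<bullet> ?g x))"
    unfolding A_form_def L2_inner_def
    by (rule integral_mono) (use A_form_integrable[OF assms assms] int le in simp_all)
  ultimately show "m * energy u u \<le> A_form u u" "A_form u u \<le> M * energy u u"
    by (simp_all add: grad_inner_def[OF \<Omega>(1)] L2_inner_def)
qed

text \<open>The representation theorem puts the functional \<open>op_A \<Omega> K u\<close> into the range of \<open>op_L \<Omega>\<close>. The
  \<open>inv_into\<close> in the definition of the operator therefore yields a genuine preimage.\<close>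

abbreviation T where "T \<equiv> op_LinvA \<Omega> K"

lemma T_closed: "u \<in> V \<Longrightarrow> T u \<in> V"
  and T_eq: "u \<in> V \<Longrightarrow> v \<in> V \<Longrightarrow> energy (T u) v = A_form u v"
proof -
  assume u: "u \<in> V"
  obtain w where w: "w \<in> V" "\<And>v. v \<in> V \<Longrightarrow> energy w v = A_form u v"
    using H.riesz_representation[of "A_form u" "\<Lambda> * H.nrm u"] A_form_add_right A_form_scale_right A_form_bound u
    by blast
  have "op_L \<Omega> w = op_A \<Omega> K u"
  proof
    fix v show "op_L \<Omega> w v = op_A \<Omega> K u v"
      by (cases "v \<in> V") (simp add: op_L_eq op_A_eq w, simp add: op_L_def op_A_def)
  qed
  then have im: "op_A \<Omega> K u \<in> op_L \<Omega> ` V" using w(1) by force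
  then show "T u \<in> V" unfolding op_LinvA_def by (rule inv_into_into)
  have "op_L \<Omega> (T u) = op_A \<Omega> K u" unfolding op_LinvA_def using im by (rule f_inv_into_f)
  then show "energy (T u) v = A_form u v" if "v \<in> V"
    using that op_L_eq op_A_eq by metis
qed

lemma T_bound: "u \<in> V \<Longrightarrow> H.nrm (T u) \<le> \<Lambda> * H.nrm u"
proof -
  assume u: "u \<in> V"
  have "H.nrm (T u) * H.nrm (T u) \<le> (\<Lambda> * H.nrm u) * H.nrm (T u)"
    using H.nrm_sq[OF T_closed[OF u]] T_eq[OF u T_closed[OF u]] A_form_bound[OF u T_closed[OF u]]
    by (simp add: power2_eq_square)
  moreover have "0 \<le> \<Lambda> * H.nrm u" using H.nrm_nonneg[OF u] by (simp add: \<Lambda>_def)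
  ultimately show ?thesis using H.nrm_nonneg[OF T_closed[OF u]]
    by (cases "H.nrm (T u) = 0") (auto dest: mult_right_le_imp_le)
qed

definition shifted :: "real \<Rightarrow> (real^'n \<Rightarrow> real) \<Rightarrow> real^'n \<Rightarrow> real" where
  "shifted a u x = a *\<^sub>R u x - T u x"

lemma shifted_closed: "u \<in> V \<Longrightarrow> shifted a u \<in> V"
  unfolding shifted_def[abs_def] by (intro H.closed T_closed)

lemma shifted_eq:
  assumes "u \<in> V" "v \<in> V"
  shows "energy (shifted a u) v = a * energy u v - A_form u v"
  using assms T_closed by (simp only: shifted_def[abs_def] H.B_diff H.B_scale H.closed T_eq)

lemma shifted_adj:
  assumes "u \<in> V" "v \<in> V"
  shows "energy (shifted a u) v = energy u (shifted a v)"
  using assms shifted_closed by (simp add: shifted_eq H.B_sym[of u] A_form_sym)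

lemma shifted_bound:
  assumes "u \<in> V"
  shows "energy (shifted a u) (shifted a u) \<le> (\<bar>a\<bar> + \<Lambda>)\<^sup>2 * energy u u"
proof -
  have "H.nrm (shifted a u) \<le> H.nrm (\<lambda>x. a *\<^sub>R u x) + H.nrm (T u)"
    unfolding shifted_def[abs_def] by (intro H.nrm_diff_triangle H.closed T_closed assms)
  then have "H.nrm (shifted a u) \<le> (\<bar>a\<bar> + \<Lambda>) * H.nrm u"
    using H.nrm_scale[OF assms, of a] T_bound[OF assms] by (simp add: algebra_simps)
  from power_mono[OF this H.nrm_nonneg[OF shifted_closed[OF assms]], of 2] show ?thesis
    by (simp add: H.nrm_sq shifted_closed assms power_mult_distrib)
qed

text \<open>For \<open>b = 0\<close> the number \<open>a\<close> has positive distance \<open>r\<close> to \<open>[m, M]\<close>. Then \<open>a - T\<close> or its negative is at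
  least \<open>r\<close> as a form, and the Cauchy-Schwarz inequality turns this into a lower bound for the
  norm of \<open>(a - T) u\<close>.\<close>

lemma shifted_coercive:
  assumes "b \<noteq> 0 \<or> a < m \<or> M < a"
  shows "\<exists>\<delta>>0. \<forall>u\<in>V. \<delta> * energy u u \<le> energy (shifted a u) (shifted a u) + b\<^sup>2 * energy u u"
proof (cases "b = 0")
  case False
  then show ?thesis by (intro exI[of _ "b\<^sup>2"]) (auto intro: H.B_nonneg shifted_closed)
next
  case True
  define r where "r = max (m - a) (a - M)"
  have r: "r > 0" using assms True by (auto simp: r_def)
  have "r\<^sup>2 * energy u u \<le> energy (shifted a u) (shifted a u)" if u: "u \<in> V" for u
  proof -
    have "r * energy u u \<le> \<bar>energy (shifted a u) u\<bar>"
      using A_form_between[OF u] shifted_eq[OF u u, of a] by (auto simp: r_def max_def algebra_simps)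
    also have "\<dots> \<le> H.nrm (shifted a u) * H.nrm u" by (intro H.cauchy_schwarz shifted_closed u)
    finally have "(r * H.nrm u) * H.nrm u \<le> H.nrm (shifted a u) * H.nrm u"
      using H.nrm_sq[OF u] by (simp add: power2_eq_square mult.assoc)
    then have "r * H.nrm u \<le> H.nrm (shifted a u)"
      using H.nrm_nonneg[OF u] H.nrm_nonneg[OF shifted_closed[OF u]]
      by (cases "H.nrm u = 0") (auto dest: mult_right_le_imp_le)
    from power_mono[OF this, of 2] show ?thesis
      using r H.nrm_nonneg[OF u] by (simp add: H.nrm_sq shifted_closed u power_mult_distrib)
  qed
  then show ?thesis using r True by (intro exI[of _ "r\<^sup>2"]) simp
qed

lemma ae_eq_iff:
  assumes "u \<in> V" "v \<in> V"
  shows "ae_eq \<Omega> u v \<longleftrightarrow> (\<forall>w\<in>V. energy u w = energy v w)"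
  using ae_eq_grad_inner[OF \<Omega>(1) H01_H1 H01_H1 _ H01_H1] grad_inner_null_ae_eq[OF \<Omega>] assms by blast

lemma ae_eq_complex_iff:
  "ae_eq \<Omega> f g \<longleftrightarrow> ae_eq \<Omega> (\<lambda>x. Re (f x)) (\<lambda>x. Re (g x)) \<and> ae_eq \<Omega> (\<lambda>x. Im (f x)) (\<lambda>x. Im (g x))"
  unfolding ae_eq_def by (simp add: complex_eq_iff AE_conj_iff)

lemma norm_L_complex_eq:
  assumes "f \<in> V\<^sub>C"
  shows "norm\<^sub>C f = sqrt (energy (\<lambda>x. Re (f x)) (\<lambda>x. Re (f x)) + energy (\<lambda>x. Im (f x)) (\<lambda>x. Im (f x)))"
  using assms by (simp add: norm_L_complex_def H01_complex_def norm_L_eq H.nrm_sq)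

lemma norm_L_complex_cong:
  assumes "f \<in> V\<^sub>C" "g \<in> V\<^sub>C" "ae_eq \<Omega> f g"
  shows "norm\<^sub>C f = norm\<^sub>C g"
proof -
  have eq: "energy u u = energy v v" if "u \<in> V" "v \<in> V" "ae_eq \<Omega> u v" for u v
    using that ae_eq_iff[OF that(1,2)] H.B_sym[OF that(1,2)] by metis
  have "ae_eq \<Omega> (\<lambda>x. Re (f x)) (\<lambda>x. Re (g x))" "ae_eq \<Omega> (\<lambda>x. Im (f x)) (\<lambda>x. Im (g x))"
    using assms(3) ae_eq_complex_iff by blast+
  then have "energy (\<lambda>x. Re (f x)) (\<lambda>x. Re (f x)) = energy (\<lambda>x. Re (g x)) (\<lambda>x. Re (g x))"
    "energy (\<lambda>x. Im (f x)) (\<lambda>x. Im (f x)) = energy (\<lambda>x. Im (g x)) (\<lambda>x. Im (g x))"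
    using assms(1,2) by (intro eq; simp add: H01_complex_def)+
  then show ?thesis by (simp only: norm_L_complex_eq assms)
qed

definition shifted_complex :: "complex \<Rightarrow> (real^'n \<Rightarrow> complex) \<Rightarrow> real^'n \<Rightarrow> complex" where
  "shifted_complex z f x = z * f x - complexify T f x"

lemma Re_shifted_complex: "(\<lambda>x. Re (shifted_complex z f x)) = (\<lambda>x. shifted (Re z) (\<lambda>y. Re (f y)) x - Im z *\<^sub>R Im (f x))"
  and Im_shifted_complex: "(\<lambda>x. Im (shifted_complex z f x)) = (\<lambda>x. shifted (Re z) (\<lambda>y. Im (f y)) x + Im z *\<^sub>R Re (f x))"
  by (auto simp: shifted_complex_def complexify_def shifted_def)

lemma shifted_complex_closed: "f \<in> V\<^sub>C \<Longrightarrow> shifted_complex z f \<in> V\<^sub>C"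
  unfolding H01_complex_def mem_Collect_eq Re_shifted_complex Im_shifted_complex by (auto intro!: H.closed shifted_closed simp del: real_scaleR_def)

lemma shifted_complex_weak:
  assumes "f \<in> V\<^sub>C" "w \<in> V"
  shows "energy (\<lambda>x. Re (shifted_complex z f x)) w
      = energy (\<lambda>x. Re (f x)) (shifted (Re z) w) - Im z * energy (\<lambda>x. Im (f x)) w"
    "energy (\<lambda>x. Im (shifted_complex z f x)) w
      = energy (\<lambda>x. Im (f x)) (shifted (Re z) w) + Im z * energy (\<lambda>x. Re (f x)) w"
proof -
  have f: "(\<lambda>x. Re (f x)) \<in> V" "(\<lambda>x. Im (f x)) \<in> V" using assms(1) by (auto simp: H01_complex_def)
  note rules = H.B_diff H.B_add H.B_scale shifted_closed H.scale_closed f assms(2) shifted_adj[OF f(1) assms(2)] shifted_adj[OF f(2) assms(2)]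
  show "energy (\<lambda>x. Re (shifted_complex z f x)) w
      = energy (\<lambda>x. Re (f x)) (shifted (Re z) w) - Im z * energy (\<lambda>x. Im (f x)) w"
    unfolding Re_shifted_complex by (simp only: rules)
  show "energy (\<lambda>x. Im (shifted_complex z f x)) w
      = energy (\<lambda>x. Im (f x)) (shifted (Re z) w) + Im z * energy (\<lambda>x. Re (f x)) w"
    unfolding Im_shifted_complex by (simp only: rules)
qed

section \<open>Points outside the hull\<close>

text \<open>Equality almost everywhere, expressed by products. In this form the linearity of \<open>z - T\<close>, which
  holds only up to null sets, becomes an identity between real numbers.\<close>

definition weak_eq :: "(real^'n \<Rightarrow> complex) \<Rightarrow> (real^'n \<Rightarrow> complex) \<Rightarrow> bool" where
  "weak_eq f g \<longleftrightarrow> (\<forall>w\<in>V.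
     energy (\<lambda>x. Re (f x)) w = energy (\<lambda>x. Re (g x)) w \<and>
     energy (\<lambda>x. Im (f x)) w = energy (\<lambda>x. Im (g x)) w)"

lemma weak_eqI:
  assumes "\<And>w. w \<in> V \<Longrightarrow> energy (\<lambda>x. Re (f x)) w = energy (\<lambda>x. Re (g x)) w"
    "\<And>w. w \<in> V \<Longrightarrow> energy (\<lambda>x. Im (f x)) w = energy (\<lambda>x. Im (g x)) w"
  shows "weak_eq f g"
  using assms by (simp add: weak_eq_def)

lemma weak_eqD:
  assumes "weak_eq f g" "w \<in> V"
  shows "energy (\<lambda>x. Re (f x)) w = energy (\<lambda>x. Re (g x)) w"
    "energy (\<lambda>x. Im (f x)) w = energy (\<lambda>x. Im (g x)) w"
  using assms by (auto simp: weak_eq_def)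

lemma ae_eq_complex_weak:
  "f \<in> V\<^sub>C \<Longrightarrow> g \<in> V\<^sub>C \<Longrightarrow> ae_eq \<Omega> f g \<longleftrightarrow> weak_eq f g"
  by (auto simp: ae_eq_complex_iff H01_complex_def weak_eq_def ae_eq_iff)

lemma H01_complex_parts:
  "f \<in> V\<^sub>C \<Longrightarrow> (\<lambda>x. Re (f x)) \<in> V"
  "f \<in> V\<^sub>C \<Longrightarrow> (\<lambda>x. Im (f x)) \<in> V"
  by (auto simp: H01_complex_def)

lemma H01_complex_add: "f \<in> V\<^sub>C \<Longrightarrow> g \<in> V\<^sub>C \<Longrightarrow> (\<lambda>x. f x + g x) \<in> V\<^sub>C"
  and H01_complex_diff: "f \<in> V\<^sub>C \<Longrightarrow> g \<in> V\<^sub>C \<Longrightarrow> (\<lambda>x. f x - g x) \<in> V\<^sub>C"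
  by (auto simp: H01_complex_def intro: H.closed)

lemma H01_complex_scale: "f \<in> V\<^sub>C \<Longrightarrow> (\<lambda>x. c * f x) \<in> V\<^sub>C"
  using H.diff_closed[OF H.scale_closed[of _ "Re c"] H.scale_closed[of _ "Im c"]]
    H.add_closed[OF H.scale_closed[of _ "Re c"] H.scale_closed[of _ "Im c"]]
  by (auto simp: H01_complex_def)

lemma weak_parts_add:
  assumes "f \<in> V\<^sub>C" "g \<in> V\<^sub>C" "w \<in> V"
  shows "energy (\<lambda>x. Re (f x + g x)) w = energy (\<lambda>x. Re (f x)) w + energy (\<lambda>x. Re (g x)) w"
    "energy (\<lambda>x. Im (f x + g x)) w = energy (\<lambda>x. Im (f x)) w + energy (\<lambda>x. Im (g x)) w"
  using assms by (simp_all add: H01_complex_parts H.B_add)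

lemma weak_parts_diff:
  assumes "f \<in> V\<^sub>C" "g \<in> V\<^sub>C" "w \<in> V"
  shows "energy (\<lambda>x. Re (f x - g x)) w = energy (\<lambda>x. Re (f x)) w - energy (\<lambda>x. Re (g x)) w"
    "energy (\<lambda>x. Im (f x - g x)) w = energy (\<lambda>x. Im (f x)) w - energy (\<lambda>x. Im (g x)) w"
  using assms by (simp_all add: H01_complex_parts H.B_diff)

lemma weak_parts_scale:
  assumes f: "f \<in> V\<^sub>C" and w: "w \<in> V"
  shows "energy (\<lambda>x. Re (c * f x)) w
      = Re c * energy (\<lambda>x. Re (f x)) w - Im c * energy (\<lambda>x. Im (f x)) w"
    "energy (\<lambda>x. Im (c * f x)) w
      = Re c * energy (\<lambda>x. Im (f x)) w + Im c * energy (\<lambda>x. Re (f x)) w"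
proof -
  note rules = H.B_diff H.B_add H.B_scale H.scale_closed H01_complex_parts[OF f] w
  have "energy (\<lambda>x. Re c *\<^sub>R Re (f x) - Im c *\<^sub>R Im (f x)) w
      = Re c * energy (\<lambda>x. Re (f x)) w - Im c * energy (\<lambda>x. Im (f x)) w"
    by (simp only: rules)
  then show "energy (\<lambda>x. Re (c * f x)) w
      = Re c * energy (\<lambda>x. Re (f x)) w - Im c * energy (\<lambda>x. Im (f x)) w" by simp
  have "energy (\<lambda>x. Re c *\<^sub>R Im (f x) + Im c *\<^sub>R Re (f x)) w
      = Re c * energy (\<lambda>x. Im (f x)) w + Im c * energy (\<lambda>x. Re (f x)) w"
    by (simp only: rules)
  then show "energy (\<lambda>x. Im (c * f x)) w
      = Re c * energy (\<lambda>x. Im (f x)) w + Im c * energy (\<lambda>x. Re (f x)) w" by simp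
qed

text \<open>With \<open>D = Re z - T\<close> and \<open>b = Im z\<close>, the mixed terms of the real and of the imaginary part are
  \<open>- 2 b (D u, v)\<close> and \<open>2 b (D v, u)\<close>. They cancel because \<open>D\<close> is self-adjoint.\<close>

lemma shifted_complex_norm:
  assumes f: "f \<in> V\<^sub>C"
  defines "u \<equiv> \<lambda>x. Re (f x)" and "v \<equiv> \<lambda>x. Im (f x)"
  shows "(norm\<^sub>C (shifted_complex z f))\<^sup>2
    = (energy (shifted (Re z) u) (shifted (Re z) u) + (Im z)\<^sup>2 * energy u u)
    + (energy (shifted (Re z) v) (shifted (Re z) v) + (Im z)\<^sup>2 * energy v v)"
proof -
  have uv: "u \<in> V" "v \<in> V" using H01_complex_parts[OF f] by (simp_all add: u_def v_def)
  note cl = uv shifted_closed H.scale_closed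
  have parts: "(\<lambda>x. Re (shifted_complex z f x)) = (\<lambda>x. shifted (Re z) u x - Im z *\<^sub>R v x)"
    "(\<lambda>x. Im (shifted_complex z f x)) = (\<lambda>x. shifted (Re z) v x + Im z *\<^sub>R u x)"
    unfolding u_def v_def by (rule Re_shifted_complex, rule Im_shifted_complex)
  have 1: "energy (\<lambda>x. Re (shifted_complex z f x)) (\<lambda>x. Re (shifted_complex z f x))
      = energy (shifted (Re z) u) (shifted (Re z) u) - 2 * (Im z * energy (shifted (Re z) u) v)
        + Im z * (Im z * energy v v)"
    unfolding parts using H.B_diff_sq[of "shifted (Re z) u" "\<lambda>x. Im z *\<^sub>R v x"] cl
    by (simp only: H.B_scale H.B_scale_right)
  have 2: "energy (\<lambda>x. Im (shifted_complex z f x)) (\<lambda>x. Im (shifted_complex z f x))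
      = energy (shifted (Re z) v) (shifted (Re z) v) + 2 * (Im z * energy (shifted (Re z) v) u)
        + Im z * (Im z * energy u u)"
    unfolding parts using H.B_add_sq[of "shifted (Re z) v" "\<lambda>x. Im z *\<^sub>R u x"] cl
    by (simp only: H.B_scale H.B_scale_right)
  have 3: "energy (shifted (Re z) v) u = energy (shifted (Re z) u) v"
    using shifted_adj[OF uv(2,1)] H.B_sym[OF uv(2) shifted_closed[OF uv(1)]] by (rule trans)
  have "(norm\<^sub>C (shifted_complex z f))\<^sup>2 = energy (\<lambda>x. Re (shifted_complex z f x)) (\<lambda>x. Re (shifted_complex z f x))
      + energy (\<lambda>x. Im (shifted_complex z f x)) (\<lambda>x. Im (shifted_complex z f x))"
    using H01_complex_parts[OF shifted_complex_closed[OF f]]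
    by (simp add: norm_L_complex_eq[OF shifted_complex_closed[OF f]] H.B_nonneg)
  then show ?thesis unfolding 1 2 3 by (simp add: power2_eq_square)
qed

lemma norm_L_complex_nonneg: "f \<in> V\<^sub>C \<Longrightarrow> norm\<^sub>C f \<ge> 0"
  and norm_L_complex_sq: "f \<in> V\<^sub>C \<Longrightarrow> (norm\<^sub>C f)\<^sup>2
    = energy (\<lambda>x. Re (f x)) (\<lambda>x. Re (f x)) + energy (\<lambda>x. Im (f x)) (\<lambda>x. Im (f x))"
  by (simp_all add: norm_L_complex_eq H01_complex_parts H.B_nonneg)

text \<open>Coercivity makes \<open>z - T\<close> both surjective and bounded below.\<close>

theorem in_resolvent_set:
  assumes z: "Im z \<noteq> 0 \<or> Re z < m \<or> M < Re z"
  shows "z \<notin> sp \<Omega> T"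
proof -
  obtain \<delta> where \<delta>: "\<delta> > 0" "\<And>u. u \<in> V \<Longrightarrow>
      \<delta> * energy u u \<le> energy (shifted (Re z) u) (shifted (Re z) u) + (Im z)\<^sup>2 * energy u u"
    using shifted_coercive[OF z] by blast
  have below: "\<delta> * (norm\<^sub>C f)\<^sup>2 \<le> (norm\<^sub>C (shifted_complex z f))\<^sup>2" if "f \<in> V\<^sub>C" for f
    using \<delta>(2)[OF H01_complex_parts(1)[OF that]] \<delta>(2)[OF H01_complex_parts(2)[OF that]]
    unfolding shifted_complex_norm[OF that] norm_L_complex_sq[OF that] by (simp add: algebra_simps)
  have surj: "\<exists>h\<in>V\<^sub>C. weak_eq (shifted_complex z h) f" if f: "f \<in> V\<^sub>C" for f
  proof -
    have "\<exists>h\<in>V. \<exists>k\<in>V. \<forall>v\<in>V.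
        energy (\<lambda>x. shifted (Re z) h x - Im z *\<^sub>R k x) v = energy (\<lambda>x. Re (f x)) v \<and>
        energy (\<lambda>x. shifted (Re z) k x + Im z *\<^sub>R h x) v = energy (\<lambda>x. Im (f x)) v"
      by (rule H.resolvent_solvable[OF shifted_closed shifted_adj shifted_bound \<delta>(2,1) H01_complex_parts[OF f]])
    then obtain h k where hk: "h \<in> V" "k \<in> V" "\<forall>v\<in>V.
        energy (\<lambda>x. shifted (Re z) h x - Im z *\<^sub>R k x) v = energy (\<lambda>x. Re (f x)) v \<and>
        energy (\<lambda>x. shifted (Re z) k x + Im z *\<^sub>R h x) v = energy (\<lambda>x. Im (f x)) v"
      by (elim bexE)
    have "(\<lambda>x. Complex (h x) (k x)) \<in> V\<^sub>C" using hk by (simp add: H01_complex_def)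
    moreover have "weak_eq (shifted_complex z (\<lambda>x. Complex (h x) (k x))) f"
      unfolding weak_eq_def Re_shifted_complex Im_shifted_complex using hk(3) by (simp del: real_scaleR_def)
    ultimately show ?thesis by blast
  qed
  have inj: "ae_eq \<Omega> h k" if hk: "h \<in> V\<^sub>C" "k \<in> V\<^sub>C" and eq: "weak_eq (shifted_complex z h) (shifted_complex z k)" for h k
  proof -
    let ?d = "\<lambda>x. h x - k x"
    have d: "?d \<in> V\<^sub>C" using hk by (rule H01_complex_diff)
    have "energy (\<lambda>x. Re (shifted_complex z ?d x)) w = 0 \<and> energy (\<lambda>x. Im (shifted_complex z ?d x)) w = 0" if w: "w \<in> V" for w
      using weak_eqD[OF eq w]
      unfolding shifted_complex_weak[OF d w] shifted_complex_weak[OF hk(1) w] shifted_complex_weak[OF hk(2) w]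
        weak_parts_diff[OF hk w] weak_parts_diff[OF hk shifted_closed[OF w]]
      by (simp add: algebra_simps)
    then have "(norm\<^sub>C (shifted_complex z ?d))\<^sup>2 = 0"
      using H01_complex_parts[OF shifted_complex_closed[OF d]] by (simp add: norm_L_complex_sq shifted_complex_closed d)
    then have "(norm\<^sub>C ?d)\<^sup>2 \<le> 0" using below[OF d] \<delta>(1) by (simp add: mult_le_0_iff)
    then have "energy (\<lambda>x. Re (?d x)) (\<lambda>x. Re (?d x)) = 0" "energy (\<lambda>x. Im (?d x)) (\<lambda>x. Im (?d x)) = 0"
      using H.B_nonneg[OF H01_complex_parts(1)[OF d]] H.B_nonneg[OF H01_complex_parts(2)[OF d]]
      unfolding norm_L_complex_sq[OF d] by linarith+
    then have "energy (\<lambda>x. Re (?d x)) w = 0 \<and> energy (\<lambda>x. Im (?d x)) w = 0" if w: "w \<in> V" for w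
      using H.cauchy_schwarz_sq[OF H01_complex_parts(1)[OF d] w] H.cauchy_schwarz_sq[OF H01_complex_parts(2)[OF d] w] by simp
    then have "weak_eq h k" by (intro weak_eqI) (simp_all add: weak_parts_diff hk del: minus_complex.sel)
    then show ?thesis using ae_eq_complex_weak hk by blast
  qed
  \<comment> \<open>An arbitrary choice of preimages is linear and bounded by \<open>inj\<close> and \<open>below\<close>.\<close>
  define R where "R f = (SOME h. h \<in> V\<^sub>C \<and> weak_eq (shifted_complex z h) f)" for f
  have R: "R f \<in> V\<^sub>C" "weak_eq (shifted_complex z (R f)) f" if "f \<in> V\<^sub>C" for f
    using someI_ex[of "\<lambda>h. h \<in> V\<^sub>C \<and> weak_eq (shifted_complex z h) f"] surj[OF that] unfolding R_def by blast+
  have "bounded_operator \<Omega> R"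
    unfolding bounded_operator_def
  proof (intro conjI ballI allI)
    fix f g assume f: "f \<in> V\<^sub>C" and g: "g \<in> V\<^sub>C"
    have fg: "(\<lambda>x. f x + g x) \<in> V\<^sub>C" using f g by (rule H01_complex_add)
    have RR: "(\<lambda>x. R f x + R g x) \<in> V\<^sub>C" using R(1)[OF f] R(1)[OF g] by (rule H01_complex_add)
    have "weak_eq (shifted_complex z (R (\<lambda>x. f x + g x))) (shifted_complex z (\<lambda>x. R f x + R g x))"
    proof (rule weak_eqI)
      fix w assume w: "w \<in> V"
      note rules = weak_eqD[OF R(2)[OF fg] w] weak_eqD[OF R(2)[OF f] w, symmetric] weak_eqD[OF R(2)[OF g] w, symmetric]
        weak_parts_add[OF f g w] shifted_complex_weak[OF R(1)[OF f] w] shifted_complex_weak[OF R(1)[OF g] w]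
        shifted_complex_weak[OF RR w] weak_parts_add[OF R(1)[OF f] R(1)[OF g] w]
        weak_parts_add[OF R(1)[OF f] R(1)[OF g] shifted_closed[OF w]]
      show "energy (\<lambda>x. Re (shifted_complex z (R (\<lambda>x. f x + g x)) x)) w
          = energy (\<lambda>x. Re (shifted_complex z (\<lambda>x. R f x + R g x) x)) w"
        unfolding rules by (simp add: algebra_simps)
      show "energy (\<lambda>x. Im (shifted_complex z (R (\<lambda>x. f x + g x)) x)) w
          = energy (\<lambda>x. Im (shifted_complex z (\<lambda>x. R f x + R g x) x)) w"
        unfolding rules by (simp add: algebra_simps)
    qed
    then show "ae_eq \<Omega> (R (\<lambda>x. f x + g x)) (\<lambda>x. R f x + R g x)"
      by (intro inj R(1)[OF fg] RR)
  next
    fix c f assume f: "f \<in> V\<^sub>C"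
    have cf: "(\<lambda>x. c * f x) \<in> V\<^sub>C" using f by (rule H01_complex_scale)
    have cR: "(\<lambda>x. c * R f x) \<in> V\<^sub>C" using R(1)[OF f] by (rule H01_complex_scale)
    have "weak_eq (shifted_complex z (R (\<lambda>x. c * f x))) (shifted_complex z (\<lambda>x. c * R f x))"
    proof (rule weak_eqI)
      fix w assume w: "w \<in> V"
      note rules = weak_eqD[OF R(2)[OF cf] w] weak_parts_scale[OF f w]
        weak_eqD[OF R(2)[OF f] w, symmetric] shifted_complex_weak[OF R(1)[OF f] w]
        shifted_complex_weak[OF cR w] weak_parts_scale[OF R(1)[OF f] w] weak_parts_scale[OF R(1)[OF f] shifted_closed[OF w]]
      show "energy (\<lambda>x. Re (shifted_complex z (R (\<lambda>x. c * f x)) x)) w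
          = energy (\<lambda>x. Re (shifted_complex z (\<lambda>x. c * R f x) x)) w"
        unfolding rules by (simp add: algebra_simps)
      show "energy (\<lambda>x. Im (shifted_complex z (R (\<lambda>x. c * f x)) x)) w
          = energy (\<lambda>x. Im (shifted_complex z (\<lambda>x. c * R f x) x)) w"
        unfolding rules by (simp add: algebra_simps)
    qed
    then show "ae_eq \<Omega> (R (\<lambda>x. c * f x)) (\<lambda>x. c * R f x)"
      by (intro inj R(1)[OF cf] cR)
  next
    have "norm\<^sub>C (R f) \<le> 1 / sqrt \<delta> * norm\<^sub>C f" if f: "f \<in> V\<^sub>C" for f
    proof -
      have "norm\<^sub>C (shifted_complex z (R f)) = norm\<^sub>C f"
        using ae_eq_complex_weak R f shifted_complex_closed by (intro norm_L_complex_cong) auto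
      then have "sqrt \<delta> * norm\<^sub>C (R f) \<le> norm\<^sub>C f"
        using real_sqrt_le_mono[OF below[OF R(1)[OF f]]] norm_L_complex_nonneg R(1)[OF f] f
        by (simp add: real_sqrt_mult)
      then show ?thesis using \<delta>(1) by (simp add: field_simps)
    qed
    then show "\<exists>C. \<forall>f\<in>V\<^sub>C. norm\<^sub>C (R f) \<le> C * norm\<^sub>C f" by blast
  qed (rule R(1))
  moreover have "ae_eq \<Omega> (R (shifted_complex z f)) f \<and> ae_eq \<Omega> (shifted_complex z (R f)) f" if f: "f \<in> V\<^sub>C" for f
    using inj[OF R(1) f R(2)] ae_eq_complex_weak R shifted_complex_closed f by blast
  ultimately have "has_bounded_inverse \<Omega> (shifted_complex z)" unfolding has_bounded_inverse_def by blast
  moreover have "shifted_complex z = (\<lambda>f x. z * f x - complexify T f x)" by (intro ext) (simp add: shifted_complex_def)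
  ultimately show ?thesis by (simp add: sp_def)
qed

end

section \<open>Oscillating quasimodes\<close>

lemma L2_nrm_mono:
  fixes f :: "real^'n::finite \<Rightarrow> 'b::euclidean_space" and g :: "real^'n \<Rightarrow> 'c::euclidean_space"
  assumes g: "g \<in> L2 \<Omega>" and f: "f \<in> borel_measurable (lebesgue_on \<Omega>)"
    and le: "\<And>x. x \<in> \<Omega> \<Longrightarrow> norm (f x) \<le> norm (g x)"
  shows "f \<in> L2 \<Omega>" "L2.nrm \<Omega> f \<le> L2.nrm \<Omega> g"
proof -
  have le2: "(norm (f x))\<^sup>2 \<le> (norm (g x))\<^sup>2" if "x \<in> \<Omega>" for x using le[OF that] by (simp add: power_mono)
  show fL: "f \<in> L2 \<Omega>" using le2 by (intro L2_dominated[OF f L2_integrable_sq[OF g]] AE_I2) simp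
  have "(LINT x|lebesgue_on \<Omega>. (norm (f x))\<^sup>2) \<le> (LINT x|lebesgue_on \<Omega>. (norm (g x))\<^sup>2)"
    using L2_integrable_sq[OF g] L2_integrable_sq[OF fL] le2 by (intro integral_mono) auto
  then show "L2.nrm \<Omega> f \<le> L2.nrm \<Omega> g" by (simp add: L2.nrm_def L2_inner_def dot_square_norm)
qed

lemma classical_grad_mult:
  assumes "smooth f" "smooth g"
  shows "classical_grad (\<lambda>x. f x * g x) x = f x *\<^sub>R classical_grad g x + g x *\<^sub>R classical_grad f x"
  using partial_deriv_mult[OF assms[THEN smooth_differentiable]]
  by (simp add: classical_grad_def vec_eq_iff mult.commute)

lemma smooth_inner: "smooth (\<lambda>x. \<xi> \<bullet> x)"
  unfolding inner_vec_def by (auto intro!: smooth_sum smooth_mult)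

lemma smooth_phase: "smooth (\<lambda>x. n * (\<xi> \<bullet> x) + \<alpha>)"
  by (intro smooth_add smooth_mult smooth_inner smooth_const)

lemma classical_grad_compose_phase:
  fixes h :: "real \<Rightarrow> real"
  assumes "(h has_real_derivative d) (at (n * (\<xi> \<bullet> x) + \<alpha>))"
  shows "classical_grad (\<lambda>x. h (n * (\<xi> \<bullet> x) + \<alpha>)) x = (n * d) *\<^sub>R \<xi>"
proof -
  have "partial_deriv i (\<lambda>x. n * (\<xi> \<bullet> x) + \<alpha>) x = n * \<xi> $ i" for i
  proof -
    have "((\<lambda>x. n * (\<xi> \<bullet> x) + \<alpha>) has_derivative (\<lambda>h. n * (\<xi> \<bullet> h))) (at x)"
      by (auto intro!: derivative_eq_intros)
    then show ?thesis by (simp add: partial_deriv_eq inner_axis)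
  qed
  then show ?thesis
    using partial_deriv_compose[OF smooth_differentiable[OF smooth_phase] assms]
    by (simp add: classical_grad_def vec_eq_iff mult_ac)
qed

lemmas classical_grad_cos_phase = classical_grad_compose_phase[OF DERIV_cos]
  and classical_grad_sin_phase = classical_grad_compose_phase[OF DERIV_sin]

lemma classical_grad_outside:
  assumes "closed C" "\<And>x. f x \<noteq> 0 \<Longrightarrow> x \<in> C" "x \<notin> C"
  shows "classical_grad f x = 0"
  using partial_deriv_outside[OF assms] by (simp add: classical_grad_def vec_eq_iff)

lemma test_directional:
  assumes "\<phi> \<in> test_functions \<Omega>"
  shows "(\<lambda>x. \<zeta> \<bullet> classical_grad \<phi> x) \<in> test_functions \<Omega>"
  unfolding inner_vec_def classical_grad_def
  using test_sum[of UNIV "\<lambda>i x. \<zeta> $ i * partial_deriv i \<phi> x"] test_scale[OF test_partial_deriv[OF assms]] by simp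

text \<open>The definition of the weak gradient, contracted with a constant vector \<open>\<zeta>\<close>.\<close>

lemma weak_directional:
  assumes \<Omega>: "open \<Omega>" and w: "w \<in> H1 \<Omega>" and \<psi>: "\<psi> \<in> test_functions \<Omega>"
  shows "L2_inner \<Omega> (grad \<Omega> w) (\<lambda>x. \<psi> x *\<^sub>R \<zeta>) = - L2_inner \<Omega> w (\<lambda>x. \<zeta> \<bullet> classical_grad \<psi> x)"
proof -
  have 1: "integrable (lebesgue_on \<Omega>) (\<lambda>x. grad \<Omega> w x $ i * \<psi> x)" for i
    using L2_inner_integrable[OF L2_component[OF grad_L2[OF \<Omega> w]] test_L2[OF \<Omega> \<psi>]] by simp
  have 2: "integrable (lebesgue_on \<Omega>) (\<lambda>x. w x * partial_deriv i \<psi> x)" for i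
    using L2_inner_integrable[OF H1_L2[OF \<Omega> w] test_L2[OF \<Omega> test_partial_deriv[OF \<psi>]]] by simp
  have "L2_inner \<Omega> (grad \<Omega> w) (\<lambda>x. \<psi> x *\<^sub>R \<zeta>)
      = (LINT x|lebesgue_on \<Omega>. (\<Sum>i\<in>UNIV. \<zeta> $ i * (grad \<Omega> w x $ i * \<psi> x)))"
    unfolding L2_inner_def inner_vec_def by (simp add: mult_ac)
  also have "\<dots> = (\<Sum>i\<in>UNIV. \<zeta> $ i * (LINT x|lebesgue_on \<Omega>. grad \<Omega> w x $ i * \<psi> x))"
    using 1 by simp
  also have "\<dots> = (\<Sum>i\<in>UNIV. \<zeta> $ i * - (LINT x|lebesgue_on \<Omega>. w x * partial_deriv i \<psi> x))"
    using weak_gradient_grad[OF \<Omega> w] \<psi> by (simp add: weak_gradient_def)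
  also have "\<dots> = - (LINT x|lebesgue_on \<Omega>. (\<Sum>i\<in>UNIV. \<zeta> $ i * (w x * partial_deriv i \<psi> x)))"
    using 2 by (simp add: sum_negf)
  also have "\<dots> = - L2_inner \<Omega> w (\<lambda>x. \<zeta> \<bullet> classical_grad \<psi> x)"
    unfolding L2_inner_def inner_vec_def classical_grad_def by (simp add: sum_distrib_left mult_ac)
  finally show ?thesis .
qed

text \<open>The phases \<open>\<alpha> = 0\<close> and \<open>\<alpha> = - \<pi> / 2\<close> give the real and the imaginary part of \<open>\<phi> exp (\<i> n \<xi> \<bullet> x)\<close>.\<close>

definition wave :: "(real^'n::finite \<Rightarrow> real) \<Rightarrow> real^'n \<Rightarrow> real \<Rightarrow> real \<Rightarrow> real^'n \<Rightarrow> real" where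
  "wave \<phi> \<xi> n \<alpha> x = \<phi> x * cos (n * (\<xi> \<bullet> x) + \<alpha>)"

lemma wave_test: "\<phi> \<in> test_functions \<Omega> \<Longrightarrow> wave \<phi> \<xi> n \<alpha> \<in> test_functions \<Omega>"
  unfolding wave_def[abs_def] by (intro test_mult_smooth smooth_sin_cos smooth_phase)

lemma classical_grad_wave:
  assumes "smooth \<phi>"
  shows "classical_grad (wave \<phi> \<xi> n \<alpha>) x
    = cos (n * (\<xi> \<bullet> x) + \<alpha>) *\<^sub>R classical_grad \<phi> x - (n * \<phi> x * sin (n * (\<xi> \<bullet> x) + \<alpha>)) *\<^sub>R \<xi>"
  unfolding wave_def[abs_def]
  using classical_grad_mult[OF assms smooth_sin_cos(2)[OF smooth_phase], of n \<xi> \<alpha> x]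
  by (simp add: classical_grad_cos_phase mult_ac)

context diffusion
begin

lemma grad_inner_test_left:
  assumes u: "u \<in> test_functions \<Omega>" and w: "w \<in> V"
  shows "energy u w = L2_inner \<Omega> (grad \<Omega> w) (classical_grad u)"
    and "A_form u w = L2_inner \<Omega> (grad \<Omega> w) (\<lambda>x. \<chi> i. \<kappa> i x * classical_grad u x $ i)"
proof -
  have AE: "AE x in lebesgue_on \<Omega>. grad \<Omega> u x = classical_grad u x" using H1_test[OF \<Omega>(1) u] by simp
  have uH: "u \<in> V" using \<Omega>(1) u by (rule test_H01)
  have "energy u w = L2_inner \<Omega> (grad \<Omega> w) (grad \<Omega> u)"
    using L2.B_sym[OF grad_L2_H01[OF uH] grad_L2_H01[OF w]] by (simp add: grad_inner_def[OF \<Omega>(1)])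
  also have "\<dots> = L2_inner \<Omega> (grad \<Omega> w) (classical_grad u)"
    using AE by (intro L2_inner_cong_AE grad_L2_H01 uH w classical_grad_L2 \<Omega> u) auto
  finally show "energy u w = L2_inner \<Omega> (grad \<Omega> w) (classical_grad u)" .
  show "A_form u w = L2_inner \<Omega> (grad \<Omega> w) (\<lambda>x. \<chi> i. \<kappa> i x * classical_grad u x $ i)"
    unfolding A_form_def using AE
    by (intro L2_inner_cong_AE K_mult_L2 grad_L2_H01 uH w classical_grad_L2 \<Omega> u) (auto elim: eventually_mono)
qed

lemma nrm_grad: "L2.nrm \<Omega> (grad \<Omega> w) = H.nrm w"
  by (simp add: L2.nrm_def H.nrm_def grad_inner_def[OF \<Omega>(1)])

lemma nrm_classical_grad:
  assumes u: "u \<in> test_functions \<Omega>"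
  shows "L2.nrm \<Omega> (classical_grad u) = H.nrm u"
proof -
  have "L2_inner \<Omega> (classical_grad u) (classical_grad u) = energy u u"
    unfolding grad_inner_def[OF \<Omega>(1)] using H1_test[OF \<Omega>(1) u]
    by (intro L2_inner_cong_AE grad_L2_H01 test_H01 classical_grad_L2 \<Omega> u) (auto elim: eventually_mono)
  then show ?thesis by (simp add: L2.nrm_def H.nrm_def)
qed

text \<open>Let \<open>\<eta> = diag d \<xi>\<close> and \<open>\<theta> = n \<xi> \<bullet> x + \<alpha>\<close>. In \<open>diag d \<nabla>(\<phi> cos \<theta>)\<close> the only term that grows with \<open>n\<close>
  is \<open>- n \<phi> sin \<theta> \<eta>\<close>. Because \<open>\<eta>\<close> is orthogonal to \<open>\<xi>\<close>, the divergence of that term is just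
  \<open>- n \<psi> sin \<theta>\<close> with \<open>\<psi> = \<eta> \<bullet> \<nabla>\<phi>\<close>, with no term of order \<open>n\<^sup>2\<close>. Since \<open>n sin \<theta> = - \<xi> \<bullet> \<nabla>(cos \<theta>)\<close> for a unit
  vector \<open>\<xi>\<close>, a second integration by parts removes the remaining factor \<open>n\<close>.\<close>

lemma wave_frozen_bound:
  assumes \<phi>: "\<phi> \<in> test_functions \<Omega>" and \<xi>: "norm \<xi> = 1" and null: "(\<Sum>i\<in>UNIV. d i * (\<xi> $ i)\<^sup>2) = 0"
  shows "\<exists>C\<ge>0. \<forall>n \<alpha>. \<forall>w\<in>V.
    \<bar>L2_inner \<Omega> (grad \<Omega> w) (\<lambda>x. \<chi> i. d i * classical_grad (wave \<phi> \<xi> n \<alpha>) x $ i)\<bar> \<le> C * H.nrm w"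
proof -
  define \<eta> where "\<eta> = (\<chi> i. d i * \<xi> $ i)"
  have \<eta>: "\<eta> \<bullet> \<xi> = 0" using null by (simp add: \<eta>_def inner_vec_def power2_eq_square mult.assoc)
  define \<psi> where "\<psi> x = \<eta> \<bullet> classical_grad \<phi> x" for x
  define \<chi>' where "\<chi>' x = \<xi> \<bullet> classical_grad \<psi> x" for x
  have \<psi>: "\<psi> \<in> test_functions \<Omega>" unfolding \<psi>_def[abs_def] using \<phi> by (rule test_directional)
  have \<chi>': "\<chi>' \<in> test_functions \<Omega>" unfolding \<chi>'_def[abs_def] using \<psi> by (rule test_directional)
  define G where "G x = (\<chi> i. d i * classical_grad \<phi> x $ i)" for x
  have G: "G \<in> L2 \<Omega>"
  proof -
    have "\<bar>d i * t\<bar> \<le> (\<Sum>j\<in>UNIV. \<bar>d j\<bar>) * \<bar>t\<bar>" for i t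
      using member_le_sum[of i UNIV "\<lambda>j. \<bar>d j\<bar>"] by (simp add: abs_mult mult_right_mono)
    then show ?thesis unfolding G_def[abs_def]
      by (intro L2_diag_mult(1)[OF classical_grad_L2[OF \<Omega>(1) \<phi>], where c="\<Sum>j\<in>UNIV. \<bar>d j\<bar>"]) (auto intro: sum_nonneg)
  qed
  obtain P where P: "P > 0" "\<And>u. u \<in> V \<Longrightarrow> L2_inner \<Omega> u u \<le> P * energy u u"
    using poincare[OF \<Omega>] by blast
  define C where "C = L2.nrm \<Omega> G + sqrt P * L2.nrm \<Omega> \<chi>' + L2.nrm \<Omega> \<psi>"
  have "\<bar>L2_inner \<Omega> (grad \<Omega> w) (\<lambda>x. \<chi> i. d i * classical_grad (wave \<phi> \<xi> n \<alpha>) x $ i)\<bar> \<le> C * H.nrm w"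
    if w: "w \<in> V" for n \<alpha> w
  proof -
    define s c where "s x = sin (n * (\<xi> \<bullet> x) + \<alpha>)" and "c x = cos (n * (\<xi> \<bullet> x) + \<alpha>)" for x
    have sm: "smooth s" "smooth c" unfolding s_def[abs_def] c_def[abs_def]
      by (intro smooth_sin_cos smooth_phase)+
    have gs: "classical_grad s x = (n * c x) *\<^sub>R \<xi>" and gc: "classical_grad c x = (n * - s x) *\<^sub>R \<xi>" for x
      unfolding s_def[abs_def] c_def[abs_def] by (rule classical_grad_sin_phase classical_grad_cos_phase)+
    have c1: "\<bar>c x\<bar> \<le> 1" for x by (simp add: c_def)
    have cm [measurable]: "c \<in> borel_measurable (lebesgue_on \<Omega>)"
      using \<Omega>(1) by (intro continuous_imp_measurable_on_sets_lebesgue smooth_continuous_on sm) auto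
    have wH: "w \<in> H1 \<Omega>" "w \<in> L2 \<Omega>" using w H01_H1 H1_L2 \<Omega>(1) by auto
    have [measurable]: "G \<in> borel_measurable (lebesgue_on \<Omega>)" "\<psi> \<in> borel_measurable (lebesgue_on \<Omega>)"
      "\<chi>' \<in> borel_measurable (lebesgue_on \<Omega>)"
      using G test_L2[OF \<Omega>(1)] \<psi> \<chi>' by (auto dest: L2_measurable)
    have "norm (c x *\<^sub>R G x) \<le> norm (G x)" for x using c1[of x] by (simp add: mult_left_le_one_le)
    then have cG: "(\<lambda>x. c x *\<^sub>R G x) \<in> L2 \<Omega>" "L2.nrm \<Omega> (\<lambda>x. c x *\<^sub>R G x) \<le> L2.nrm \<Omega> G"
      by (intro L2_nrm_mono[OF G]; simp)+
    have "norm (\<chi>' x * c x) \<le> norm (\<chi>' x)" for x using c1[of x] by (simp add: abs_mult mult_left_le)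
    then have c\<chi>: "L2.nrm \<Omega> (\<lambda>x. \<chi>' x * c x) \<le> L2.nrm \<Omega> \<chi>'"
      by (intro L2_nrm_mono[OF test_L2[OF \<Omega>(1) \<chi>']]) simp_all
    have "norm ((\<psi> x * c x) *\<^sub>R \<xi>) \<le> norm (\<psi> x)" for x
      using c1[of x] \<xi> by (simp add: abs_mult mult_left_le)
    then have c\<psi>: "(\<lambda>x. (\<psi> x * c x) *\<^sub>R \<xi>) \<in> L2 \<Omega>" "L2.nrm \<Omega> (\<lambda>x. (\<psi> x * c x) *\<^sub>R \<xi>) \<le> L2.nrm \<Omega> \<psi>"
      by (intro L2_nrm_mono[OF test_L2[OF \<Omega>(1) \<psi>]]; simp)+
    have t\<chi>: "(\<lambda>x. \<chi>' x * c x) \<in> test_functions \<Omega>" and t\<psi>: "(\<lambda>x. \<psi> x * c x) \<in> test_functions \<Omega>"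
      using \<chi>' \<psi> sm by (auto intro: test_mult_smooth)
    have \<rho>: "(\<lambda>x. n * (\<phi> x * s x)) \<in> test_functions \<Omega>"
      using \<phi> sm by (intro test_scale test_mult_smooth)
    have split: "(\<lambda>x. \<chi> i. d i * classical_grad (wave \<phi> \<xi> n \<alpha>) x $ i)
        = (\<lambda>x. c x *\<^sub>R G x - (n * (\<phi> x * s x)) *\<^sub>R \<eta>)"
      unfolding classical_grad_wave[OF test_smooth[OF \<phi>]]
      by (simp add: fun_eq_iff vec_eq_iff G_def \<eta>_def s_def c_def algebra_simps)
    have \<rho>L: "(\<lambda>x. (n * (\<phi> x * s x)) *\<^sub>R \<eta>) \<in> L2 \<Omega>"
    proof -
      have \<rho>0: "(\<lambda>x. n * (\<phi> x * s x)) \<in> L2 \<Omega>" using \<Omega>(1) \<rho> by (rule test_L2)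
      note L = L2.scale_closed[OF \<rho>0, of "norm \<eta>"]
      show ?thesis
        by (rule L2_nrm_mono(1)[OF L]) (use L2_measurable[OF \<rho>0] in \<open>simp_all add: abs_mult\<close>)
    qed
    have "\<eta> \<bullet> classical_grad (\<lambda>x. n * (\<phi> x * s x)) x = n * s x * \<psi> x" for x
    proof -
      have "classical_grad (\<lambda>x. n * (\<phi> x * s x)) x = n *\<^sub>R classical_grad (\<lambda>x. \<phi> x * s x) x"
        using classical_grad_mult[of "\<lambda>_. n" "\<lambda>x. \<phi> x * s x" x] sm test_smooth[OF \<phi>] 
        by (simp add: smooth_mult, simp add: classical_grad_def vec_eq_iff)
      then show ?thesis
        by (simp add: classical_grad_mult[OF test_smooth[OF \<phi>] sm(1)] gs inner_add_right \<eta> \<psi>_def)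
    qed
    then have 1: "L2_inner \<Omega> (grad \<Omega> w) (\<lambda>x. (n * (\<phi> x * s x)) *\<^sub>R \<eta>) = - L2_inner \<Omega> w (\<lambda>x. n * s x * \<psi> x)"
      using weak_directional[OF \<Omega>(1) wH(1) \<rho>, of \<eta>] by simp
    have d\<psi>c: "(\<lambda>x. \<xi> \<bullet> classical_grad (\<lambda>x. \<psi> x * c x) x) \<in> test_functions \<Omega>"
      using t\<psi> by (rule test_directional)
    have "n * s x * \<psi> x = \<chi>' x * c x - \<xi> \<bullet> classical_grad (\<lambda>x. \<psi> x * c x) x" for x
      using \<xi> by (simp add: classical_grad_mult[OF test_smooth[OF \<psi>] sm(2)] gc inner_diff_right inner_add_right \<chi>'_def
          dot_square_norm algebra_simps)
    then have 2: "L2_inner \<Omega> w (\<lambda>x. n * s x * \<psi> x)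
        = L2_inner \<Omega> w (\<lambda>x. \<chi>' x * c x) + L2_inner \<Omega> (grad \<Omega> w) (\<lambda>x. (\<psi> x * c x) *\<^sub>R \<xi>)"
      using weak_directional[OF \<Omega>(1) wH(1) t\<psi>, of \<xi>]
      by (simp add: L2.B_diff_right test_L2[OF \<Omega>(1)] t\<chi> d\<psi>c wH)
    have b1: "\<bar>L2_inner \<Omega> (grad \<Omega> w) (\<lambda>x. c x *\<^sub>R G x)\<bar> \<le> H.nrm w * L2.nrm \<Omega> G"
      using L2.cauchy_schwarz[OF grad_L2_H01[OF w] cG(1)] mult_left_mono[OF cG(2) H.nrm_nonneg[OF w]]
      by (simp add: nrm_grad)
    have b2: "\<bar>L2_inner \<Omega> (grad \<Omega> w) (\<lambda>x. (\<psi> x * c x) *\<^sub>R \<xi>)\<bar> \<le> H.nrm w * L2.nrm \<Omega> \<psi>"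
      using L2.cauchy_schwarz[OF grad_L2_H01[OF w] c\<psi>(1)] mult_left_mono[OF c\<psi>(2) H.nrm_nonneg[OF w]]
      by (simp add: nrm_grad)
    have b3: "\<bar>L2_inner \<Omega> w (\<lambda>x. \<chi>' x * c x)\<bar> \<le> (sqrt P * H.nrm w) * L2.nrm \<Omega> \<chi>'"
    proof -
      have "L2.nrm \<Omega> w \<le> sqrt P * H.nrm w"
        using real_sqrt_le_mono[OF P(2)[OF w]] by (simp add: L2.nrm_def H.nrm_def real_sqrt_mult)
      then have "L2.nrm \<Omega> w * L2.nrm \<Omega> (\<lambda>x. \<chi>' x * c x) \<le> (sqrt P * H.nrm w) * L2.nrm \<Omega> \<chi>'"
        using c\<chi> L2.nrm_nonneg[OF test_L2[OF \<Omega>(1) t\<chi>]] H.nrm_nonneg[OF w] P(1) by (intro mult_mono) auto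
      then show ?thesis using L2.cauchy_schwarz[OF wH(2) test_L2[OF \<Omega>(1) t\<chi>]] by linarith
    qed
    have "L2_inner \<Omega> (grad \<Omega> w) (\<lambda>x. \<chi> i. d i * classical_grad (wave \<phi> \<xi> n \<alpha>) x $ i)
        = L2_inner \<Omega> (grad \<Omega> w) (\<lambda>x. c x *\<^sub>R G x)
          + (L2_inner \<Omega> w (\<lambda>x. \<chi>' x * c x) + L2_inner \<Omega> (grad \<Omega> w) (\<lambda>x. (\<psi> x * c x) *\<^sub>R \<xi>))"
      unfolding split by (simp only: L2.B_diff_right cG \<rho>L grad_L2_H01 w 1 2 diff_minus_eq_add)
    then show ?thesis using b1 b2 b3 by (simp add: C_def algebra_simps)
  qed
  moreover have "C \<ge> 0"
    unfolding C_def using L2.nrm_nonneg[OF G] L2.nrm_nonneg[OF test_L2[OF \<Omega>(1) \<chi>']] L2.nrm_nonneg[OF test_L2[OF \<Omega>(1) \<psi>]] P(1)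
    by simp
  ultimately show ?thesis by blast
qed

text \<open>The numbers \<open>k i\<close> are the coefficients frozen at one point. The bound \<open>\<epsilon>\<close> on the variation of
  the coefficients over the support of \<open>\<phi>\<close> enters as a factor of the norm, all other terms go into
  the constant \<open>C\<close>, which does not depend on \<open>n\<close> and \<open>\<alpha>\<close>.\<close>

lemma wave_quasimode:
  assumes \<phi>: "\<phi> \<in> test_functions \<Omega>" and F: "closed F" "\<And>x. \<phi> x \<noteq> 0 \<Longrightarrow> x \<in> F"
    and near: "\<And>x i. x \<in> \<Omega> \<inter> F \<Longrightarrow> \<bar>k i - \<kappa> i x\<bar> \<le> \<epsilon>" and "\<epsilon> \<ge> 0"
    and \<xi>: "norm \<xi> = 1" and null: "(\<Sum>i\<in>UNIV. (a - k i) * (\<xi> $ i)\<^sup>2) = 0"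
  shows "\<exists>C\<ge>0. \<forall>n \<alpha>. H.nrm (shifted a (wave \<phi> \<xi> n \<alpha>)) \<le> \<epsilon> * H.nrm (wave \<phi> \<xi> n \<alpha>) + C"
proof -
  obtain C where C: "C \<ge> 0" "\<And>n \<alpha> w. w \<in> V \<Longrightarrow>
      \<bar>L2_inner \<Omega> (grad \<Omega> w) (\<lambda>x. \<chi> i. (a - k i) * classical_grad (wave \<phi> \<xi> n \<alpha>) x $ i)\<bar> \<le> C * H.nrm w"
    using wave_frozen_bound[OF \<phi> \<xi> null] by blast
  have "H.nrm (shifted a (wave \<phi> \<xi> n \<alpha>)) \<le> \<epsilon> * H.nrm (wave \<phi> \<xi> n \<alpha>) + C" for n \<alpha>
  proof -
    define u where "u = wave \<phi> \<xi> n \<alpha>"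
    have u: "u \<in> test_functions \<Omega>" unfolding u_def using \<phi> by (rule wave_test)
    have uH: "u \<in> V" using \<Omega>(1) u by (rule test_H01)
    define w where "w = shifted a u"
    have w: "w \<in> V" unfolding w_def using uH by (rule shifted_closed)
    have gu: "classical_grad u \<in> L2 \<Omega>" using \<Omega>(1) u by (rule classical_grad_L2)
    have out: "classical_grad u x = 0" if "x \<notin> F" for x
      using F that by (intro classical_grad_outside[of F]) (auto simp: u_def wave_def)
    define E where "E x = (\<chi> i. (k i - \<kappa> i x) * classical_grad u x $ i)" for x
    have E: "E \<in> L2 \<Omega>" "L2.nrm \<Omega> E \<le> \<epsilon> * L2.nrm \<Omega> (classical_grad u)"
    proof -
      have "\<bar>(k i - \<kappa> i x) * classical_grad u x $ i\<bar> \<le> \<epsilon> * \<bar>classical_grad u x $ i\<bar>" if "x \<in> \<Omega>" for x i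
        using near[of x i] out[of x] that by (cases "x \<in> F") (auto simp: abs_mult mult_right_mono)
      moreover have "(\<lambda>x. k i - \<kappa> i x) \<in> borel_measurable (lebesgue_on \<Omega>)" for i
        using \<kappa>_measurable by (intro borel_measurable_diff) auto
      ultimately show "E \<in> L2 \<Omega>" "L2.nrm \<Omega> E \<le> \<epsilon> * L2.nrm \<Omega> (classical_grad u)"
        using L2_diag_mult[OF gu \<open>\<epsilon> \<ge> 0\<close>, of "\<lambda>i x. k i - \<kappa> i x"] unfolding E_def[abs_def] by blast+
    qed
    let ?Kg = "\<lambda>x. \<chi> i. \<kappa> i x * classical_grad u x $ i"
    have Kg: "?Kg \<in> L2 \<Omega>" using gu by (rule K_mult_L2)
    have ag: "(\<lambda>x. a *\<^sub>R classical_grad u x) \<in> L2 \<Omega>" using gu by (rule L2_scale)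
    have "energy (shifted a u) w = L2_inner \<Omega> (grad \<Omega> w) (\<lambda>x. a *\<^sub>R classical_grad u x - ?Kg x)"
      unfolding shifted_eq[OF uH w] grad_inner_test_left[OF u w]
      by (simp only: L2.B_diff_right L2.B_scale_right Kg ag gu grad_L2_H01 w)
    also have "(\<lambda>x. a *\<^sub>R classical_grad u x - ?Kg x) = (\<lambda>x. (\<lambda>x. \<chi> i. (a - k i) * classical_grad u x $ i) x + E x)"
      by (simp add: fun_eq_iff vec_eq_iff E_def algebra_simps)
    also have "L2_inner \<Omega> (grad \<Omega> w) (\<lambda>x. (\<lambda>x. \<chi> i. (a - k i) * classical_grad u x $ i) x + E x)
        = L2_inner \<Omega> (grad \<Omega> w) (\<lambda>x. \<chi> i. (a - k i) * classical_grad u x $ i) + L2_inner \<Omega> (grad \<Omega> w) E"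
    proof (rule L2.B_add_right)
      have "(\<lambda>x. a *\<^sub>R classical_grad u x - ?Kg x - E x) \<in> L2 \<Omega>" by (intro L2.diff_closed ag Kg E)
      moreover have "(\<lambda>x. a *\<^sub>R classical_grad u x - ?Kg x - E x) = (\<lambda>x. \<chi> i. (a - k i) * classical_grad u x $ i)"
        by (simp add: fun_eq_iff vec_eq_iff E_def algebra_simps)
      ultimately show "(\<lambda>x. \<chi> i. (a - k i) * classical_grad u x $ i) \<in> L2 \<Omega>" by simp
    qed (intro E grad_L2_H01 w)+
    finally have "\<bar>energy (shifted a u) w\<bar> \<le> C * H.nrm w + \<bar>L2_inner \<Omega> (grad \<Omega> w) E\<bar>"
      using C(2)[OF w, of n \<alpha>] unfolding u_def by linarith
    also have "\<bar>L2_inner \<Omega> (grad \<Omega> w) E\<bar> \<le> H.nrm w * (\<epsilon> * H.nrm u)"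
      using L2.cauchy_schwarz[OF grad_L2_H01[OF w] E(1)] mult_left_mono[OF E(2) H.nrm_nonneg[OF w]]
      by (simp add: nrm_grad nrm_classical_grad u)
    finally have "H.nrm w * H.nrm w \<le> (\<epsilon> * H.nrm u + C) * H.nrm w"
      using H.nrm_sq[OF w] by (simp add: w_def power2_eq_square algebra_simps)
    moreover have "0 \<le> \<epsilon> * H.nrm u + C" using \<open>\<epsilon> \<ge> 0\<close> H.nrm_nonneg[OF uH] C(1) by simp
    ultimately show ?thesis using H.nrm_nonneg[OF w] unfolding w_def u_def
      by (cases "H.nrm (shifted a (wave \<phi> \<xi> n \<alpha>)) = 0") (auto dest: mult_right_le_imp_le)
  qed
  then show ?thesis using C(1) by blast
qed

text \<open>Adding the two phases removes the oscillation by \<open>sin\<^sup>2 + cos\<^sup>2 = 1\<close>: the sum of the energies is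
  exactly \<open>\<integral> |\<nabla>\<phi>|\<^sup>2 + n\<^sup>2 \<integral> \<phi>\<^sup>2\<close>.\<close>

lemma wave_energy:
  assumes \<phi>: "\<phi> \<in> test_functions \<Omega>" and \<xi>: "norm \<xi> = 1"
  shows "n\<^sup>2 * L2_inner \<Omega> \<phi> \<phi>
    \<le> (H.nrm (wave \<phi> \<xi> n 0))\<^sup>2 + (H.nrm (wave \<phi> \<xi> n (- (pi / 2))))\<^sup>2"
proof -
  let ?u = "wave \<phi> \<xi> n 0" and ?v = "wave \<phi> \<xi> n (- (pi / 2))"
  have u: "?u \<in> test_functions \<Omega>" "?v \<in> test_functions \<Omega>" using \<phi> by (auto intro: wave_test)
  have gL: "classical_grad ?u \<in> L2 \<Omega>" "classical_grad ?v \<in> L2 \<Omega>" using u \<Omega>(1) by (auto intro: classical_grad_L2)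
  have pw: "n\<^sup>2 * (\<phi> x * \<phi> x) \<le> classical_grad ?u x \<bullet> classical_grad ?u x + classical_grad ?v x \<bullet> classical_grad ?v x" for x
  proof -
    define s c g where "s = sin (n * (\<xi> \<bullet> x))" and "c = cos (n * (\<xi> \<bullet> x))" and "g = classical_grad \<phi> x"
    have sc: "s * s + c * c = 1" unfolding s_def c_def using sin_cos_squared_add[of "n * (\<xi> \<bullet> x)"] by (simp add: power2_eq_square)
    have x1: "\<xi> \<bullet> \<xi> = 1" using \<xi> by (simp add: dot_square_norm)
    have gu: "classical_grad ?u x = c *\<^sub>R g - (n * \<phi> x * s) *\<^sub>R \<xi>"
      unfolding classical_grad_wave[OF test_smooth[OF \<phi>]] by (simp add: s_def c_def g_def)
    have gv: "classical_grad ?v x = s *\<^sub>R g + (n * \<phi> x * c) *\<^sub>R \<xi>"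
      unfolding classical_grad_wave[OF test_smooth[OF \<phi>]]
      using cos_diff[of "n * (\<xi> \<bullet> x)" "pi / 2"] sin_diff[of "n * (\<xi> \<bullet> x)" "pi / 2"] by (simp add: s_def c_def g_def)
    have "classical_grad ?u x \<bullet> classical_grad ?u x + classical_grad ?v x \<bullet> classical_grad ?v x
        = (s * s + c * c) * (g \<bullet> g) + (s * s + c * c) * (n\<^sup>2 * (\<phi> x * \<phi> x))"
      unfolding gu gv
      by (simp add: inner_diff_left inner_diff_right inner_add_left inner_add_right x1 inner_commute[of \<xi> g]
          power2_eq_square algebra_simps)
    then show ?thesis unfolding sc by simp
  qed
  have "n\<^sup>2 * L2_inner \<Omega> \<phi> \<phi> = (LINT x|lebesgue_on \<Omega>. n\<^sup>2 * (\<phi> x * \<phi> x))" by (simp add: L2_inner_def)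
  also have "\<dots> \<le> (LINT x|lebesgue_on \<Omega>. classical_grad ?u x \<bullet> classical_grad ?u x + classical_grad ?v x \<bullet> classical_grad ?v x)"
    using L2_inner_integrable[OF test_L2[OF \<Omega>(1) \<phi>] test_L2[OF \<Omega>(1) \<phi>]]
      L2_inner_integrable[OF gL(1) gL(1)] L2_inner_integrable[OF gL(2) gL(2)] pw
    by (intro integral_mono) auto
  also have "\<dots> = L2_inner \<Omega> (classical_grad ?u) (classical_grad ?u) + L2_inner \<Omega> (classical_grad ?v) (classical_grad ?v)"
    using L2_inner_integrable[OF gL(1) gL(1)] L2_inner_integrable[OF gL(2) gL(2)] by (simp add: L2_inner_def)
  also have "\<dots> = (H.nrm ?u)\<^sup>2 + (H.nrm ?v)\<^sup>2"
    using L2.nrm_sq[OF gL(1)] L2.nrm_sq[OF gL(2)] u by (simp add: nrm_classical_grad)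
  finally show ?thesis .
qed

end

section \<open>The spectrum\<close>

lemma L2_inner_box_bump_pos:
  assumes \<Omega>: "open \<Omega>" and ab: "cbox a b \<subseteq> \<Omega>" "box a b \<noteq> {}"
  shows "L2_inner \<Omega> (box_bump a b) (box_bump a b) > 0"
proof (rule ccontr)
  assume "\<not> ?thesis"
  moreover have L: "box_bump a b \<in> L2 \<Omega>" using \<Omega> ab(1) by (intro test_L2 test_box_bump)
  ultimately have "L2_inner \<Omega> (box_bump a b) (box_bump a b) = 0" using L2.B_nonneg[OF L] by simp
  then have "AE x in lebesgue_on \<Omega>. box_bump a b x = 0" by (rule L2_null_AE[OF L])
  then have "AE x in lebesgue. x \<in> \<Omega> \<longrightarrow> box_bump a b x = 0"
    using \<Omega> by (subst (asm) AE_restrict_space_iff) auto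
  then have "AE x in lebesgue. x \<notin> box a b"
    by eventually_elim (use ab(1) box_subset_cbox[of a b] in \<open>auto simp: box_bump_eq_0_iff\<close>)
  then have "box a b \<in> null_sets lebesgue" by (subst AE_iff_null_sets) auto
  then show False using open_not_negligible[OF open_box ab(2)] by (simp add: negligible_iff_null_sets)
qed

text \<open>A bounded inverse would bound the norms of the quasimodes independently of \<open>n\<close>, although
  these norms grow at least like \<open>n\<close>.\<close>

lemma (in diffusion) in_spectrum:
  assumes near: "\<And>\<epsilon>. \<epsilon> > 0 \<Longrightarrow>
      \<exists>p q. cbox p q \<subseteq> \<Omega> \<and> box p q \<noteq> {} \<and> (\<forall>x\<in>cbox p q. \<forall>i. \<bar>k i - \<kappa> i x\<bar> \<le> \<epsilon>)"
    and \<xi>: "norm \<xi> = 1" "(\<Sum>i\<in>UNIV. (a - k i) * (\<xi> $ i)\<^sup>2) = 0"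
  shows "complex_of_real a \<in> sp \<Omega> T"
proof (rule ccontr)
  let ?S = "shifted_complex (complex_of_real a)"
  assume "complex_of_real a \<notin> sp \<Omega> T"
  moreover have "?S = (\<lambda>f x. complex_of_real a * f x - complexify T f x)"
    by (intro ext) (simp add: shifted_complex_def)
  ultimately have "has_bounded_inverse \<Omega> (?S)" by (simp add: sp_def)
  then obtain R C\<^sub>0 where R: "\<And>f. f \<in> V\<^sub>C \<Longrightarrow> R f \<in> V\<^sub>C"
      "\<And>f. f \<in> V\<^sub>C \<Longrightarrow> norm\<^sub>C (R f) \<le> C\<^sub>0 * norm\<^sub>C f"
      "\<And>f. f \<in> V\<^sub>C \<Longrightarrow> ae_eq \<Omega> (R (?S f)) f"
    unfolding has_bounded_inverse_def bounded_operator_def by blast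
  define C\<^sub>1 where "C\<^sub>1 = max C\<^sub>0 1"
  have C\<^sub>1: "C\<^sub>1 > 0" by (simp add: C\<^sub>1_def)
  have below: "norm\<^sub>C f \<le> C\<^sub>1 * norm\<^sub>C (?S f)" if f: "f \<in> V\<^sub>C" for f
  proof -
    have "norm\<^sub>C f = norm\<^sub>C (R (?S f))"
      using norm_L_complex_cong[OF R(1)[OF shifted_complex_closed[OF f]] f R(3)[OF f]] by simp
    also have "\<dots> \<le> C\<^sub>0 * norm\<^sub>C (?S f)" by (rule R(2)[OF shifted_complex_closed[OF f]])
    also have "\<dots> \<le> C\<^sub>1 * norm\<^sub>C (?S f)"
      by (intro mult_right_mono norm_L_complex_nonneg shifted_complex_closed f) (simp add: C\<^sub>1_def)
    finally show ?thesis .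
  qed
  \<comment> \<open>Small enough for half of the norm to be absorbed on the left below.\<close>
  define \<epsilon> where "\<epsilon> = 1 / (4 * C\<^sub>1)"
  have \<epsilon>: "\<epsilon> > 0" "C\<^sub>1 * \<epsilon> * 4 = 1" using C\<^sub>1 by (simp_all add: \<epsilon>_def)
  obtain p q where pq: "cbox p q \<subseteq> \<Omega>" "box p q \<noteq> {}" "\<And>x i. x \<in> cbox p q \<Longrightarrow> \<bar>k i - \<kappa> i x\<bar> \<le> \<epsilon>"
    using near[OF \<epsilon>(1)] by blast
  define \<phi> where "\<phi> = box_bump p q"
  have \<phi>: "\<phi> \<in> test_functions \<Omega>" unfolding \<phi>_def using pq(1) by (rule test_box_bump)
  define c where "c = L2_inner \<Omega> \<phi> \<phi>"
  have c: "c > 0" unfolding c_def \<phi>_def using \<Omega>(1) pq(1,2) by (rule L2_inner_box_bump_pos)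
  have supp: "x \<in> cbox p q" if "\<phi> x \<noteq> 0" for x
    using that box_subset_cbox[of p q] by (auto simp: \<phi>_def box_bump_eq_0_iff)
  obtain C where C: "C \<ge> 0" "\<And>n \<alpha>. H.nrm (shifted a (wave \<phi> \<xi> n \<alpha>)) \<le> \<epsilon> * H.nrm (wave \<phi> \<xi> n \<alpha>) + C"
    using wave_quasimode[OF \<phi> closed_cbox supp _ less_imp_le[OF \<epsilon>(1)] \<xi>(1) \<xi>(2)] pq(3) by blast
  have le: "n\<^sup>2 * c \<le> (4 * C\<^sub>1 * C)\<^sup>2" for n
  proof -
    define u v where "u = wave \<phi> \<xi> n 0" and "v = wave \<phi> \<xi> n (- (pi / 2))"
    have uv: "u \<in> V" "v \<in> V"
      unfolding u_def v_def using \<phi> \<Omega>(1) by (auto intro: test_H01 wave_test)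
    define f where "f x = Complex (u x) (v x)" for x
    have f: "f \<in> V\<^sub>C" using uv by (simp add: f_def[abs_def] H01_complex_def)
    define N where "N = norm\<^sub>C f"
    have N0: "N \<ge> 0" unfolding N_def using f by (rule norm_L_complex_nonneg)
    have N2: "N\<^sup>2 = (H.nrm u)\<^sup>2 + (H.nrm v)\<^sup>2"
      using norm_L_complex_sq[OF f] uv by (simp add: N_def f_def[abs_def] H.nrm_sq)
    then have "H.nrm u \<le> N" "H.nrm v \<le> N"
      by (intro power2_le_imp_le[OF _ N0]; simp)+
    have "(norm\<^sub>C (?S f))\<^sup>2 = (H.nrm (shifted a u))\<^sup>2 + (H.nrm (shifted a v))\<^sup>2"
      using shifted_complex_norm[OF f, of "complex_of_real a"] shifted_closed[OF uv(1)] shifted_closed[OF uv(2)]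
      by (simp add: f_def[abs_def] H.nrm_sq)
    also have "\<dots> \<le> (H.nrm (shifted a u) + H.nrm (shifted a v))\<^sup>2"
      using H.nrm_nonneg[OF shifted_closed[OF uv(1)], of a] H.nrm_nonneg[OF shifted_closed[OF uv(2)], of a]
      by (simp add: power2_sum)
    finally have "norm\<^sub>C (?S f) \<le> H.nrm (shifted a u) + H.nrm (shifted a v)"
      by (rule power2_le_imp_le) (intro add_nonneg_nonneg H.nrm_nonneg shifted_closed uv)
    also have "\<dots> \<le> (\<epsilon> * H.nrm u + C) + (\<epsilon> * H.nrm v + C)"
      unfolding u_def v_def by (intro add_mono C(2))
    also have "\<dots> \<le> (\<epsilon> * N + C) + (\<epsilon> * N + C)"
      using \<open>H.nrm u \<le> N\<close> \<open>H.nrm v \<le> N\<close> \<epsilon>(1) by (intro add_mono mult_left_mono) auto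
    finally have "C\<^sub>1 * norm\<^sub>C (?S f) \<le> C\<^sub>1 * ((\<epsilon> * N + C) + (\<epsilon> * N + C))"
      using C\<^sub>1 by (intro mult_left_mono) auto
    with below[OF f] have "N \<le> C\<^sub>1 * ((\<epsilon> * N + C) + (\<epsilon> * N + C))" unfolding N_def by (rule order_trans)
    also have "\<dots> = (C\<^sub>1 * \<epsilon> * 4) * N / 2 + 2 * C\<^sub>1 * C" by (simp add: field_simps)
    finally have "N \<le> 4 * C\<^sub>1 * C" unfolding \<epsilon>(2) by simp
    then have "N\<^sup>2 \<le> (4 * C\<^sub>1 * C)\<^sup>2" using N0 by (rule power_mono)
    then show ?thesis using wave_energy[OF \<phi> \<xi>(1), of n] unfolding N2 u_def v_def c_def by linarith
  qed
  \<comment> \<open>The frequency \<open>n = (b + 1) / sqrt c\<close> violates the bound.\<close>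
  define b where "b = 4 * C\<^sub>1 * C"
  have "b \<ge> 0" using C\<^sub>1 C(1) by (simp add: b_def)
  have "((b + 1) / sqrt c)\<^sup>2 * c = (b + 1)\<^sup>2" using c by (simp add: power_divide)
  then have "(b + 1)\<^sup>2 \<le> b\<^sup>2" using le[of "(b + 1) / sqrt c"] by (simp add: b_def)
  then show False using \<open>b \<ge> 0\<close> by (simp add: power2_eq_square algebra_simps)
qed

text \<open>The squares of the coordinates are the weights of a convex combination of \<open>d i\<close> and \<open>d j\<close> that
  vanishes.\<close>

lemma exists_null_direction:
  fixes d :: "'n::finite \<Rightarrow> real"
  assumes "d i \<ge> 0" "d j \<le> 0"
  shows "\<exists>\<xi>::real^'n. norm \<xi> = 1 \<and> (\<Sum>l\<in>UNIV. d l * (\<xi> $ l)\<^sup>2) = 0"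
proof (cases "d i = 0 \<or> d j = 0")
  case True
  then obtain l where "d l = 0" by blast
  then have "(\<Sum>l'\<in>UNIV. d l' * (axis l (1::real) $ l')\<^sup>2) = 0"
    by (intro sum.neutral) (auto simp: axis_def)
  then show ?thesis by (intro exI[of _ "axis l 1"]) (simp add: norm_axis_1)
next
  case False
  then have d: "d i > 0" "d j < 0" using assms by auto
  then have ij: "i \<noteq> j" by auto
  define \<xi> :: "real^'n" where "\<xi> = axis i (sqrt (- d j / (d i - d j))) + axis j (sqrt (d i / (d i - d j)))"
  have sq: "(\<xi> $ l)\<^sup>2 = (if l = i then - d j / (d i - d j) else if l = j then d i / (d i - d j) else 0)" for l
    using d ij by (auto simp: \<xi>_def axis_def divide_nonpos_pos divide_nonneg_pos)
  have sum: "(\<Sum>l\<in>UNIV. f l * (\<xi> $ l)\<^sup>2) = f i * (- d j / (d i - d j)) + f j * (d i / (d i - d j))" for f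
  proof -
    have "(\<Sum>l\<in>UNIV. f l * (\<xi> $ l)\<^sup>2) = (\<Sum>l\<in>{i, j}. f l * (\<xi> $ l)\<^sup>2)"
      by (rule sum.mono_neutral_right) (auto simp: sq)
    then show ?thesis using ij by (simp add: sq)
  qed
  have "(norm \<xi>)\<^sup>2 = (\<Sum>l\<in>UNIV. 1 * (\<xi> $ l)\<^sup>2)"
    unfolding power2_norm_eq_inner inner_vec_def by (simp add: power2_eq_square)
  also have "\<dots> = (d i - d j) / (d i - d j)" unfolding sum by (simp only: mult_1 uminus_add_conv_diff flip: add_divide_distrib)
  finally have "norm \<xi> = 1" using d norm_ge_zero[of \<xi>] by (auto simp: power2_eq_1_iff)
  moreover have "(\<Sum>l\<in>UNIV. d l * (\<xi> $ l)\<^sup>2) = 0" unfolding sum by simp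
  ultimately show ?thesis by blast
qed

text \<open>The ranges of the single coefficients may leave gaps between each other. Still, every \<open>a\<close> in
  the hull lies between two coefficients at one common point: the sets where some coefficient is at most \<open>a\<close> and where
  some coefficient is at least \<open>a\<close> are closed and cover the connected closure of \<open>\<Omega>\<close>, so they meet.\<close>

theorem spectrum_eq_convex_hull:
  fixes \<Omega> :: "(real^'n::finite) set"
    and \<kappa> :: "'n \<Rightarrow> real^'n \<Rightarrow> real"
    and K :: "real^'n \<Rightarrow> real^'n^'n"
  assumes dom: "is_domain \<Omega>" and bnd: "bounded \<Omega>"
    and K_diag: "\<And>x. x \<in> closure \<Omega> \<Longrightarrow> K x = (\<chi> i j. if i = j then \<kappa> i x else 0)"
    and K_cont: "continuous_on (closure \<Omega>) K"
  shows "sp \<Omega> (op_LinvA \<Omega> K) = complex_of_real ` (convex hull (\<Union>i\<in>UNIV. \<kappa> i ` closure \<Omega>))"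
proof -
  have \<Omega>: "open \<Omega>" "connected \<Omega>" "\<Omega> \<noteq> {}" using dom by (auto simp: is_domain_def)
  let ?S = "\<Union>i\<in>UNIV. \<kappa> i ` closure \<Omega>"
  have cl: "compact (closure \<Omega>)" "closure \<Omega> \<noteq> {}" "\<Omega> \<subseteq> closure \<Omega>" "connected (closure \<Omega>)"
    using bnd \<Omega> closure_subset connected_imp_connected_closure by auto
  have \<kappa>K: "\<kappa> i x = K x $ i $ i" if "x \<in> closure \<Omega>" for i x using K_diag[OF that] by simp
  have \<kappa>c: "continuous_on (closure \<Omega>) (\<kappa> i)" for i
  proof -
    have "continuous_on (closure \<Omega>) (\<lambda>x. K x $ i $ i)" using K_cont by (intro continuous_intros)
    then show ?thesis using continuous_on_cong[OF refl, of "closure \<Omega>" "\<kappa> i" "\<lambda>x. K x $ i $ i"] \<kappa>K by simp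
  qed
  have S: "compact ?S" "?S \<noteq> {}" using cl \<kappa>c by (auto intro!: compact_UN compact_continuous_image)
  obtain m where m: "m \<in> ?S" "\<And>t. t \<in> ?S \<Longrightarrow> m \<le> t" using compact_attains_inf[OF S] by blast
  obtain M where M: "M \<in> ?S" "\<And>t. t \<in> ?S \<Longrightarrow> t \<le> M" using compact_attains_sup[OF S] by blast
  have hull: "convex hull ?S = {m..M}"
  proof
    have "t \<in> {m..M}" if "t \<in> ?S" for t using m(2)[OF that] M(2)[OF that] by simp
    then have "?S \<subseteq> {m..M}" by (rule subsetI)
    then show "convex hull ?S \<subseteq> {m..M}" by (rule hull_minimal) (rule convex_real_interval)
    have "closed_segment m M \<subseteq> convex hull ?S"
      using m(1) M(1) by (intro closed_segment_subset hull_inc convex_convex_hull)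
    then show "{m..M} \<subseteq> convex hull ?S" using m(2)[OF M(1)] by (simp add: closed_segment_eq_real_ivl)
  qed
  interpret diffusion \<Omega> \<kappa> K m M
  proof
    show "continuous_on \<Omega> K" using K_cont cl(3) by (rule continuous_on_subset)
    show "m \<le> \<kappa> i x \<and> \<kappa> i x \<le> M" if "x \<in> \<Omega>" for x i using that cl(3) m(2) M(2) by blast
  qed (use \<Omega> bnd K_diag cl(3) in auto)
  have "z \<in> complex_of_real ` {m..M}" if "z \<in> sp \<Omega> T" for z
  proof -
    have "Im z = 0" "m \<le> Re z" "Re z \<le> M" using in_resolvent_set[of z] that by force+
    then show ?thesis by (intro image_eqI[of _ _ "Re z"]) (auto simp: complex_eq_iff)
  qed
  moreover have "complex_of_real a \<in> sp \<Omega> T" if a: "a \<in> {m..M}" for a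
  proof -
    define A where "A = (\<Union>i\<in>UNIV. closure \<Omega> \<inter> \<kappa> i -` {..a})"
    define B where "B = (\<Union>i\<in>UNIV. closure \<Omega> \<inter> \<kappa> i -` {a..})"
    have "closed A" "closed B"
      unfolding A_def B_def by (intro closed_UN finite_UNIV ballI continuous_closed_preimage \<kappa>c; simp)+
    moreover have "x \<in> A \<union> B" if "x \<in> closure \<Omega>" for x
      using that linear[of "\<kappa> undefined x" a] by (auto simp: A_def B_def)
    then have "closure \<Omega> \<subseteq> A \<union> B" by (rule subsetI)
    moreover have "A \<inter> closure \<Omega> \<noteq> {}" "B \<inter> closure \<Omega> \<noteq> {}" using m(1) M(1) a by (auto simp: A_def B_def)
    ultimately have "A \<inter> B \<inter> closure \<Omega> \<noteq> {}" using cl(4) unfolding connected_closed by blast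
    then obtain x\<^sub>0 i j where x\<^sub>0: "x\<^sub>0 \<in> closure \<Omega>" "\<kappa> i x\<^sub>0 \<le> a" "a \<le> \<kappa> j x\<^sub>0" by (auto simp: A_def B_def)
    obtain \<xi> :: "real^'n" where \<xi>: "norm \<xi> = 1" "(\<Sum>l\<in>UNIV. (a - \<kappa> l x\<^sub>0) * (\<xi> $ l)\<^sup>2) = 0"
      using exists_null_direction[of "\<lambda>l. a - \<kappa> l x\<^sub>0" i j] x\<^sub>0 by auto
    show ?thesis
    proof (rule in_spectrum[OF _ \<xi>])
      fix \<epsilon> :: real assume "\<epsilon> > 0"
      then obtain \<delta> where \<delta>: "\<delta> > 0" "\<And>x. x \<in> closure \<Omega> \<Longrightarrow> dist x x\<^sub>0 < \<delta> \<Longrightarrow> dist (K x) (K x\<^sub>0) < \<epsilon>"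
        using K_cont[unfolded continuous_on_iff, rule_format, OF x\<^sub>0(1)] by blast
      obtain y where y: "y \<in> \<Omega>" "dist y x\<^sub>0 < \<delta>" using x\<^sub>0(1)[unfolded closure_approachable, rule_format, OF \<delta>(1)] by blast
      have "open (\<Omega> \<inter> ball x\<^sub>0 \<delta>)" "y \<in> \<Omega> \<inter> ball x\<^sub>0 \<delta>" using \<Omega>(1) y by (auto simp: dist_commute)
      then obtain p q where pq: "cbox p q \<subseteq> \<Omega> \<inter> ball x\<^sub>0 \<delta>" "y \<in> box p q"
        by (rule open_contains_cbox)
      have "\<bar>\<kappa> l x\<^sub>0 - \<kappa> l x\<bar> \<le> \<epsilon>" if x: "x \<in> cbox p q" for x l
      proof -
        have xcl: "x \<in> closure \<Omega>" "dist x x\<^sub>0 < \<delta>" using x pq(1) cl(3) by (auto simp: dist_commute)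
        have "\<kappa> l x\<^sub>0 - \<kappa> l x = (K x\<^sub>0 - K x) $ l $ l" using \<kappa>K xcl(1) x\<^sub>0(1) by simp
        moreover have "\<bar>(K x\<^sub>0 - K x) $ l $ l\<bar> \<le> norm (K x\<^sub>0 - K x)"
          using component_le_norm_cart[of "(K x\<^sub>0 - K x) $ l" l] Finite_Cartesian_Product.norm_nth_le[of "K x\<^sub>0 - K x" l] by linarith
        moreover have "norm (K x\<^sub>0 - K x) < \<epsilon>" using \<delta>(2)[OF xcl] by (simp add: dist_norm norm_minus_commute)
        ultimately show ?thesis by linarith
      qed
      then show "\<exists>p q. cbox p q \<subseteq> \<Omega> \<and> box p q \<noteq> {} \<and> (\<forall>x\<in>cbox p q. \<forall>l. \<bar>\<kappa> l x\<^sub>0 - \<kappa> l x\<bar> \<le> \<epsilon>)"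
        using pq by blast
    qed
  qed
  ultimately show ?thesis unfolding hull by blast
qed

theorem theorem2p1:
  fixes \<Omega> :: "(real^3) set"
    and \<kappa> :: "3 \<Rightarrow> real^3 \<Rightarrow> real"
    and K :: "real^3 \<Rightarrow> real^3^3"
  assumes "is_domain \<Omega>" and "bounded \<Omega>" and "lipschitz_boundary \<Omega>"
    and "\<And>x. x \<in> closure \<Omega> \<Longrightarrow> K x = (\<chi> i j. if i = j then \<kappa> i x else 0)"
    and "continuous_on (closure \<Omega>) K"
  shows "sp \<Omega> (op_LinvA \<Omega> K) = complex_of_real ` (convex hull (\<Union>i\<in>UNIV. \<kappa> i ` closure \<Omega>))"
  using assms(1,2,4,5) by (rule spectrum_eq_convex_hull)

end
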